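(* Work constructively (intuitionistic logic with countable choice). Let $(f_n)_{n \geq 1}$ be a sequence of functions $f_n : \mathbb{N}_\infty \to \mathbb{N}$ such that $f_n(x) \to 0$ for every $x \in \mathbb{N}_\infty$. Then either - there exists $N \in \mathbb{N}$ such that $f_i(\alpha) = 0$ for all $i \geq N$ and all $\alpha \in \mathbb{N}_\infty$ with $\alpha \geq \underline{N}$; - or there exist a sequence $(\alpha_n)_{n\ge1}$ in $\mathbb{N}_\infty$ and a sequence $(k_n)_{n\ge1}$ of natural numbers such that for every $n$: $k_n \geq n$, $\alpha_n \geq \underline{n}$, and $f_{k_n}(\alpha_n) \neq 0$.
   Context: $\mathbb{N}_\infty$ is the set of all increasing binary sequences $\alpha : \mathbb{N} \to \{0,1\}$, with the metric inherited from Cantor space. For $n \in \mathbb{N}$, $\underline{n} \in \mathbb{N}_\infty$ is the sequence $0^n 1 1 1 \dots$ (first $n$ terms $0$, all later terms $1$), and $\omega = 000\dots$. $\mathbb{N}_\infty$ carries the reverse lexicographic order, so for $\alpha \in \mathbb{N}_\infty$, $\alpha \geq \underline{n}$ means that the first $n$ terms of $\alpha$ are $0$. Since $\mathbb{N}$ is discrete, $f_n(x) \to 0$ means $f_n(x) = 0$ for all sufficiently large $n$. The disjunction is constructive. *)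

theory Defs
  imports Main
begin

text \<open>
  The logic of Isabelle/HOL is classical, and classically the disjunction to be stated is an
  instance of excluded middle followed by choice. The constructive claim is therefore stated as
  derivability in a formal system for constructive mathematics: extensional intuitionistic
  arithmetic in all finite types (E-HA$^\omega$, in a lambda-calculus presentation with equality
  at every type) extended by the schema of countable choice.
\<close>

subsection \<open>Finite types, terms, formulas\<close>

datatype ty = Nt | Fn ty ty (infixr "\<rightarrow>" 75)

text \<open>Variables are de Bruijn indices. \<open>Rec a f n\<close> is primitive recursion on \<open>n\<close> with
  initial value \<open>a\<close> and step function \<open>f\<close>, at an arbitrary result type.\<close>

datatype tm =
    Var nat
  | Zero
  | Succ tm
  | Rec tm tm tm
  | Lam ty tm
  | App tm tm (infixl "\<cdot>" 90)

datatype fm =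
    Bot ("\<^bold>\<bottom>")
  | Eq ty tm tm
  | And fm fm (infixr "\<^bold>\<and>" 35)
  | Or fm fm (infixr "\<^bold>\<or>" 30)
  | Imp fm fm (infixr "\<^bold>\<longrightarrow>" 25)
  | All ty fm
  | Ex ty fm

inductive has_ty :: "ty list \<Rightarrow> tm \<Rightarrow> ty \<Rightarrow> bool" where
  ty_Var: "i < length \<Gamma> \<Longrightarrow> \<Gamma> ! i = \<tau> \<Longrightarrow> has_ty \<Gamma> (Var i) \<tau>"
| ty_Zero: "has_ty \<Gamma> Zero Nt"
| ty_Succ: "has_ty \<Gamma> t Nt \<Longrightarrow> has_ty \<Gamma> (Succ t) Nt"
| ty_Rec: "has_ty \<Gamma> a \<tau> \<Longrightarrow> has_ty \<Gamma> f (Nt \<rightarrow> \<tau> \<rightarrow> \<tau>) \<Longrightarrow> has_ty \<Gamma> n Nt \<Longrightarrow> has_ty \<Gamma> (Rec a f n) \<tau>"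
| ty_Lam: "has_ty (\<sigma> # \<Gamma>) t \<tau> \<Longrightarrow> has_ty \<Gamma> (Lam \<sigma> t) (\<sigma> \<rightarrow> \<tau>)"
| ty_App: "has_ty \<Gamma> t (\<sigma> \<rightarrow> \<tau>) \<Longrightarrow> has_ty \<Gamma> s \<sigma> \<Longrightarrow> has_ty \<Gamma> (t \<cdot> s) \<tau>"

primrec wff :: "ty list \<Rightarrow> fm \<Rightarrow> bool" where
  "wff \<Gamma> \<^bold>\<bottom> = True"
| "wff \<Gamma> (Eq \<tau> s t) = (has_ty \<Gamma> s \<tau> \<and> has_ty \<Gamma> t \<tau>)"
| "wff \<Gamma> (\<phi> \<^bold>\<and> \<psi>) = (wff \<Gamma> \<phi> \<and> wff \<Gamma> \<psi>)"
| "wff \<Gamma> (\<phi> \<^bold>\<or> \<psi>) = (wff \<Gamma> \<phi> \<and> wff \<Gamma> \<psi>)"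
| "wff \<Gamma> (\<phi> \<^bold>\<longrightarrow> \<psi>) = (wff \<Gamma> \<phi> \<and> wff \<Gamma> \<psi>)"
| "wff \<Gamma> (All \<tau> \<phi>) = wff (\<tau> # \<Gamma>) \<phi>"
| "wff \<Gamma> (Ex \<tau> \<phi>) = wff (\<tau> # \<Gamma>) \<phi>"

text \<open>\<open>shift k\<close> makes room for a new variable with index \<open>k\<close>; \<open>subst k s\<close> replaces the
  variable with index \<open>k\<close> by \<open>s\<close> and removes that index.\<close>

primrec shift :: "nat \<Rightarrow> tm \<Rightarrow> tm" where
  "shift k (Var i) = Var (if i < k then i else Suc i)"
| "shift k Zero = Zero"
| "shift k (Succ t) = Succ (shift k t)"
| "shift k (Rec a f n) = Rec (shift k a) (shift k f) (shift k n)"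
| "shift k (Lam \<sigma> t) = Lam \<sigma> (shift (Suc k) t)"
| "shift k (t \<cdot> u) = shift k t \<cdot> shift k u"

primrec subst :: "nat \<Rightarrow> tm \<Rightarrow> tm \<Rightarrow> tm" where
  "subst k s (Var i) = (if i < k then Var i else if i = k then s else Var (i - 1))"
| "subst k s Zero = Zero"
| "subst k s (Succ t) = Succ (subst k s t)"
| "subst k s (Rec a f n) = Rec (subst k s a) (subst k s f) (subst k s n)"
| "subst k s (Lam \<sigma> t) = Lam \<sigma> (subst (Suc k) (shift 0 s) t)"
| "subst k s (t \<cdot> u) = subst k s t \<cdot> subst k s u"

primrec fshift :: "nat \<Rightarrow> fm \<Rightarrow> fm" where
  "fshift k \<^bold>\<bottom> = \<^bold>\<bottom>"
| "fshift k (Eq \<tau> s t) = Eq \<tau> (shift k s) (shift k t)"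
| "fshift k (\<phi> \<^bold>\<and> \<psi>) = (fshift k \<phi> \<^bold>\<and> fshift k \<psi>)"
| "fshift k (\<phi> \<^bold>\<or> \<psi>) = (fshift k \<phi> \<^bold>\<or> fshift k \<psi>)"
| "fshift k (\<phi> \<^bold>\<longrightarrow> \<psi>) = (fshift k \<phi> \<^bold>\<longrightarrow> fshift k \<psi>)"
| "fshift k (All \<tau> \<phi>) = All \<tau> (fshift (Suc k) \<phi>)"
| "fshift k (Ex \<tau> \<phi>) = Ex \<tau> (fshift (Suc k) \<phi>)"

primrec fsubst :: "nat \<Rightarrow> tm \<Rightarrow> fm \<Rightarrow> fm" where
  "fsubst k s \<^bold>\<bottom> = \<^bold>\<bottom>"
| "fsubst k s (Eq \<tau> t u) = Eq \<tau> (subst k s t) (subst k s u)"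
| "fsubst k s (\<phi> \<^bold>\<and> \<psi>) = (fsubst k s \<phi> \<^bold>\<and> fsubst k s \<psi>)"
| "fsubst k s (\<phi> \<^bold>\<or> \<psi>) = (fsubst k s \<phi> \<^bold>\<or> fsubst k s \<psi>)"
| "fsubst k s (\<phi> \<^bold>\<longrightarrow> \<psi>) = (fsubst k s \<phi> \<^bold>\<longrightarrow> fsubst k s \<psi>)"
| "fsubst k s (All \<tau> \<phi>) = All \<tau> (fsubst (Suc k) (shift 0 s) \<phi>)"
| "fsubst k s (Ex \<tau> \<phi>) = Ex \<tau> (fsubst (Suc k) (shift 0 s) \<phi>)"

subsection \<open>Derivability\<close>

text \<open>
  \<open>\<Gamma>; \<Delta> \<turnstile> \<phi>\<close>: in the typed variable context \<open>\<Gamma>\<close>, the formula \<open>\<phi>\<close> has an intuitionistic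
  natural deduction derivation from the hypotheses \<open>\<Delta>\<close>. There is no rule for excluded middle or
  double negation, and no choice other than \<open>CC\<close>.

  In \<open>Ind\<close>, \<open>\<phi>\<close> has the induction variable as index 0, and \<open>fsubst 0 (Succ (Var 0)) (fshift 1 \<phi>)\<close>
  is \<open>\<phi>\<close> at its successor. In \<open>CC\<close>, \<open>\<phi>\<close> has \<open>y : \<tau>\<close> as index 0 and \<open>n : Nt\<close> as index 1; in the
  conclusion \<open>n\<close> is index 0, the choice function \<open>g\<close> is index 1, and \<open>y\<close> is replaced by \<open>g n\<close>.
\<close>

inductive prv :: "ty list \<Rightarrow> fm set \<Rightarrow> fm \<Rightarrow> bool" ("(_; _ \<turnstile> _)" [51, 51, 20] 20) where
  Hyp: "\<phi> \<in> \<Delta> \<Longrightarrow> \<Gamma>; \<Delta> \<turnstile> \<phi>"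
| BotE: "\<Gamma>; \<Delta> \<turnstile> \<^bold>\<bottom> \<Longrightarrow> wff \<Gamma> \<phi> \<Longrightarrow> \<Gamma>; \<Delta> \<turnstile> \<phi>"
| AndI: "\<Gamma>; \<Delta> \<turnstile> \<phi> \<Longrightarrow> \<Gamma>; \<Delta> \<turnstile> \<psi> \<Longrightarrow> \<Gamma>; \<Delta> \<turnstile> \<phi> \<^bold>\<and> \<psi>"
| AndE1: "\<Gamma>; \<Delta> \<turnstile> \<phi> \<^bold>\<and> \<psi> \<Longrightarrow> \<Gamma>; \<Delta> \<turnstile> \<phi>"
| AndE2: "\<Gamma>; \<Delta> \<turnstile> \<phi> \<^bold>\<and> \<psi> \<Longrightarrow> \<Gamma>; \<Delta> \<turnstile> \<psi>"
| OrI1: "\<Gamma>; \<Delta> \<turnstile> \<phi> \<Longrightarrow> wff \<Gamma> \<psi> \<Longrightarrow> \<Gamma>; \<Delta> \<turnstile> \<phi> \<^bold>\<or> \<psi>"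
| OrI2: "\<Gamma>; \<Delta> \<turnstile> \<psi> \<Longrightarrow> wff \<Gamma> \<phi> \<Longrightarrow> \<Gamma>; \<Delta> \<turnstile> \<phi> \<^bold>\<or> \<psi>"
| OrE: "\<Gamma>; \<Delta> \<turnstile> \<phi> \<^bold>\<or> \<psi> \<Longrightarrow> \<Gamma>; insert \<phi> \<Delta> \<turnstile> \<chi> \<Longrightarrow> \<Gamma>; insert \<psi> \<Delta> \<turnstile> \<chi> \<Longrightarrow> \<Gamma>; \<Delta> \<turnstile> \<chi>"
| ImpI: "\<Gamma>; insert \<phi> \<Delta> \<turnstile> \<psi> \<Longrightarrow> wff \<Gamma> \<phi> \<Longrightarrow> \<Gamma>; \<Delta> \<turnstile> \<phi> \<^bold>\<longrightarrow> \<psi>"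
| ImpE: "\<Gamma>; \<Delta> \<turnstile> \<phi> \<^bold>\<longrightarrow> \<psi> \<Longrightarrow> \<Gamma>; \<Delta> \<turnstile> \<phi> \<Longrightarrow> \<Gamma>; \<Delta> \<turnstile> \<psi>"
| AllI: "\<tau> # \<Gamma>; fshift 0 ` \<Delta> \<turnstile> \<phi> \<Longrightarrow> \<Gamma>; \<Delta> \<turnstile> All \<tau> \<phi>"
| AllE: "\<Gamma>; \<Delta> \<turnstile> All \<tau> \<phi> \<Longrightarrow> has_ty \<Gamma> t \<tau> \<Longrightarrow> \<Gamma>; \<Delta> \<turnstile> fsubst 0 t \<phi>"
| ExI: "\<Gamma>; \<Delta> \<turnstile> fsubst 0 t \<phi> \<Longrightarrow> has_ty \<Gamma> t \<tau> \<Longrightarrow> wff (\<tau> # \<Gamma>) \<phi> \<Longrightarrow> \<Gamma>; \<Delta> \<turnstile> Ex \<tau> \<phi>"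
| ExE: "\<Gamma>; \<Delta> \<turnstile> Ex \<tau> \<phi> \<Longrightarrow> \<tau> # \<Gamma>; insert \<phi> (fshift 0 ` \<Delta>) \<turnstile> fshift 0 \<psi> \<Longrightarrow> wff \<Gamma> \<psi> \<Longrightarrow> \<Gamma>; \<Delta> \<turnstile> \<psi>"
| EqI: "has_ty \<Gamma> t \<tau> \<Longrightarrow> \<Gamma>; \<Delta> \<turnstile> Eq \<tau> t t"
| EqE: "\<Gamma>; \<Delta> \<turnstile> Eq \<tau> s t \<Longrightarrow> \<Gamma>; \<Delta> \<turnstile> fsubst 0 s \<phi> \<Longrightarrow> wff (\<tau> # \<Gamma>) \<phi> \<Longrightarrow> \<Gamma>; \<Delta> \<turnstile> fsubst 0 t \<phi>"
| Ext: "\<Gamma>; \<Delta> \<turnstile> All \<sigma> (Eq \<tau> (shift 0 s \<cdot> Var 0) (shift 0 t \<cdot> Var 0)) \<Longrightarrow>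
    has_ty \<Gamma> s (\<sigma> \<rightarrow> \<tau>) \<Longrightarrow> has_ty \<Gamma> t (\<sigma> \<rightarrow> \<tau>) \<Longrightarrow> \<Gamma>; \<Delta> \<turnstile> Eq (\<sigma> \<rightarrow> \<tau>) s t"
| Beta: "has_ty (\<sigma> # \<Gamma>) t \<tau> \<Longrightarrow> has_ty \<Gamma> s \<sigma> \<Longrightarrow> \<Gamma>; \<Delta> \<turnstile> Eq \<tau> (Lam \<sigma> t \<cdot> s) (subst 0 s t)"
| RecZero: "has_ty \<Gamma> a \<tau> \<Longrightarrow> has_ty \<Gamma> f (Nt \<rightarrow> \<tau> \<rightarrow> \<tau>) \<Longrightarrow> \<Gamma>; \<Delta> \<turnstile> Eq \<tau> (Rec a f Zero) a"
| RecSucc: "has_ty \<Gamma> a \<tau> \<Longrightarrow> has_ty \<Gamma> f (Nt \<rightarrow> \<tau> \<rightarrow> \<tau>) \<Longrightarrow> has_ty \<Gamma> n Nt \<Longrightarrow>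
    \<Gamma>; \<Delta> \<turnstile> Eq \<tau> (Rec a f (Succ n)) (f \<cdot> n \<cdot> Rec a f n)"
| ZeroSucc: "\<Gamma>; \<Delta> \<turnstile> Eq Nt Zero (Succ t) \<Longrightarrow> \<Gamma>; \<Delta> \<turnstile> \<^bold>\<bottom>"
| SuccInj: "\<Gamma>; \<Delta> \<turnstile> Eq Nt (Succ s) (Succ t) \<Longrightarrow> \<Gamma>; \<Delta> \<turnstile> Eq Nt s t"
| Ind: "\<Gamma>; \<Delta> \<turnstile> fsubst 0 Zero \<phi> \<Longrightarrow>
    \<Gamma>; \<Delta> \<turnstile> All Nt (\<phi> \<^bold>\<longrightarrow> fsubst 0 (Succ (Var 0)) (fshift 1 \<phi>)) \<Longrightarrow> \<Gamma>; \<Delta> \<turnstile> All Nt \<phi>"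
| CC: "\<Gamma>; \<Delta> \<turnstile> All Nt (Ex \<tau> \<phi>) \<Longrightarrow>
    \<Gamma>; \<Delta> \<turnstile> Ex (Nt \<rightarrow> \<tau>) (All Nt (fsubst 0 (Var 1 \<cdot> Var 0) (fshift 2 \<phi>)))"

subsection \<open>Arithmetic and the one-point compactification of the naturals\<close>

abbreviation Seq :: ty where "Seq \<equiv> Nt \<rightarrow> Nt"

abbreviation One :: tm where "One \<equiv> Succ Zero"

abbreviation Neg :: "fm \<Rightarrow> fm" ("\<^bold>\<not> _" [40] 40) where
  "(\<^bold>\<not> \<phi>) \<equiv> (\<phi> \<^bold>\<longrightarrow> \<^bold>\<bottom>)"

definition plus_tm :: "tm \<Rightarrow> tm \<Rightarrow> tm" where
  "plus_tm s t = Rec s (Lam Nt (Lam Nt (Succ (Var 0)))) t"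

definition Le :: "tm \<Rightarrow> tm \<Rightarrow> fm" (infix "\<^bold>\<le>" 50) where
  "(s \<^bold>\<le> t) = Ex Nt (Eq Nt (plus_tm (shift 0 s) (Var 0)) (shift 0 t))"

text \<open>\<open>Ninf a\<close>: the sequence \<open>a\<close> takes values in \<open>{0, 1}\<close> and is increasing.\<close>

definition Ninf :: "tm \<Rightarrow> fm" where
  "Ninf a =
    (All Nt (Eq Nt (shift 0 a \<cdot> Var 0) Zero \<^bold>\<or> Eq Nt (shift 0 a \<cdot> Var 0) One) \<^bold>\<and>
     All Nt (All Nt (Var 1 \<^bold>\<le> Var 0 \<^bold>\<longrightarrow>
       shift 0 (shift 0 a) \<cdot> Var 1 \<^bold>\<le> shift 0 (shift 0 a) \<cdot> Var 0)))"

text \<open>\<open>AtLeast a n\<close>: the first \<open>n\<close> terms of \<open>a\<close> are 0. For \<open>a\<close> in the compactification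
  this is the order relation between \<open>a\<close> and the copy of \<open>n\<close>; reverse lexicographically,
  sequences with more leading zeros are larger.\<close>

definition AtLeast :: "tm \<Rightarrow> tm \<Rightarrow> fm" where
  "AtLeast a n = All Nt (Succ (Var 0) \<^bold>\<le> shift 0 n \<^bold>\<longrightarrow> Eq Nt (shift 0 a \<cdot> Var 0) Zero)"

text \<open>\<open>TendsToZero f x\<close>: there is \<open>N\<close> such that \<open>f\<^sub>n(x) = 0\<close> for all \<open>n \<ge> N\<close>. Sequences indexed
  by the positive naturals are terms of type \<open>Nt \<rightarrow> \<tau>\<close> whose value at 0 is disregarded.\<close>

definition TendsToZero :: "tm \<Rightarrow> tm \<Rightarrow> fm" where
  "TendsToZero f x =
    Ex Nt (All Nt (One \<^bold>\<le> Var 0 \<^bold>\<longrightarrow> Var 1 \<^bold>\<le> Var 0 \<^bold>\<longrightarrow>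
      Eq Nt (shift 0 (shift 0 f) \<cdot> Var 0 \<cdot> shift 0 (shift 0 x)) Zero))"

subsection \<open>Only well-formed formulas are derivable\<close>

lemma has_ty_shift:
  assumes "has_ty \<Gamma> t \<tau>" "k \<le> length \<Gamma>"
  shows "has_ty (take k \<Gamma> @ \<sigma> # drop k \<Gamma>) (shift k t) \<tau>"
  using assms
proof (induction arbitrary: k rule: has_ty.induct)
  case (ty_Var i \<Gamma> \<tau>)
  then show ?case
    by (auto intro!: has_ty.ty_Var simp: nth_append min_def Suc_diff_le)
next
  case (ty_Lam \<rho> \<Gamma> t \<tau>)
  from ty_Lam.IH[of "Suc k"] ty_Lam.prems show ?case
    by (auto intro: has_ty.ty_Lam)
qed (auto intro: has_ty.intros)

lemma has_ty_shift0: "has_ty \<Gamma> t \<tau> \<Longrightarrow> has_ty (\<sigma> # \<Gamma>) (shift 0 t) \<tau>"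
  using has_ty_shift[of \<Gamma> t \<tau> 0] by simp

lemma has_ty_subst:
  assumes "has_ty \<Gamma>' t \<tau>" "\<Gamma>' = take k \<Gamma> @ \<sigma> # drop k \<Gamma>" "k \<le> length \<Gamma>" "has_ty \<Gamma> s \<sigma>"
  shows "has_ty \<Gamma> (subst k s t) \<tau>"
  using assms
proof (induction arbitrary: k \<Gamma> s rule: has_ty.induct)
  case (ty_Var i \<Gamma>' \<tau>)
  then show ?case
    by (cases i k rule: linorder_cases)
       (auto intro!: has_ty.ty_Var simp: nth_append min_def nth_Cons' split: if_splits)
next
  case (ty_Lam \<rho> \<Gamma>' t \<tau>)
  from ty_Lam.IH[of "Suc k" "\<rho> # \<Gamma>" "shift 0 s"] ty_Lam.prems show ?case
    by (auto intro: has_ty.ty_Lam has_ty_shift0)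
next
  case (ty_App \<Gamma>' t \<rho> \<tau> u)
  then show ?case by (simp, blast intro: has_ty.ty_App)
qed (auto intro: has_ty.intros)

lemma wff_fshift:
  "wff \<Gamma> \<phi> \<Longrightarrow> k \<le> length \<Gamma> \<Longrightarrow> wff (take k \<Gamma> @ \<sigma> # drop k \<Gamma>) (fshift k \<phi>)"
proof (induction \<phi> arbitrary: \<Gamma> k)
  case (All \<tau> \<phi>)
  from All.IH[of "\<tau> # \<Gamma>" "Suc k"] All.prems show ?case by simp
next
  case (Ex \<tau> \<phi>)
  from Ex.IH[of "\<tau> # \<Gamma>" "Suc k"] Ex.prems show ?case by simp
qed (auto intro: has_ty_shift)

lemma wff_fsubst:
  "wff (take k \<Gamma> @ \<sigma> # drop k \<Gamma>) \<phi> \<Longrightarrow> k \<le> length \<Gamma> \<Longrightarrow> has_ty \<Gamma> s \<sigma> \<Longrightarrow> wff \<Gamma> (fsubst k s \<phi>)"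
proof (induction \<phi> arbitrary: \<Gamma> k s)
  case (All \<tau> \<phi>)
  from All.IH[of "Suc k" "\<tau> # \<Gamma>" "shift 0 s"] All.prems show ?case
    by (auto intro: has_ty_shift0)
next
  case (Ex \<tau> \<phi>)
  from Ex.IH[of "Suc k" "\<tau> # \<Gamma>" "shift 0 s"] Ex.prems show ?case
    by (auto intro: has_ty_shift0)
qed (auto intro: has_ty_subst)

lemma prv_wff: "\<Gamma>; \<Delta> \<turnstile> \<phi> \<Longrightarrow> (\<And>\<psi>. \<psi> \<in> \<Delta> \<Longrightarrow> wff \<Gamma> \<psi>) \<Longrightarrow> wff \<Gamma> \<phi>"
proof (induction rule: prv.induct)
  case (AllI \<tau> \<Gamma> \<Delta> \<phi>)
  have "wff (\<tau> # \<Gamma>) (fshift 0 \<psi>)" if "\<psi> \<in> \<Delta>" for \<psi>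
    using wff_fshift[of \<Gamma> \<psi> 0] AllI.prems that by simp
  then show ?case using AllI.IH by auto
next
  case (AllE \<Gamma> \<Delta> \<tau> \<phi> t)
  then show ?case using wff_fsubst[of 0 \<Gamma> \<tau> \<phi> t] by simp
next
  case (EqE \<Gamma> \<Delta> \<tau> s t \<phi>)
  then show ?case using wff_fsubst[of 0 \<Gamma> \<tau> \<phi> t] by simp
next
  case (Beta \<sigma> \<Gamma> t \<tau> s \<Delta>)
  have "has_ty \<Gamma> (Lam \<sigma> t \<cdot> s) \<tau>" by (rule ty_App[OF ty_Lam]) fact+
  moreover have "has_ty \<Gamma> (subst 0 s t) \<tau>"
    by (rule has_ty_subst[of "\<sigma> # \<Gamma>" _ _ _ _ \<sigma>]) (use Beta in simp_all)
  ultimately show ?case by simp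
next
  case (CC \<Gamma> \<Delta> \<tau> \<phi>)
  let ?\<Gamma> = "Nt # (Nt \<rightarrow> \<tau>) # \<Gamma>"
  have "wff (\<tau> # ?\<Gamma>) (fshift 2 \<phi>)"
    using wff_fshift[of "\<tau> # Nt # \<Gamma>" \<phi> 2 "Nt \<rightarrow> \<tau>"] CC by (simp add: numeral_2_eq_2)
  moreover have "has_ty ?\<Gamma> (Var 1 \<cdot> Var 0) \<tau>"
    by (rule ty_App[where \<sigma> = Nt]) (auto intro!: ty_Var)
  ultimately show ?case using wff_fsubst[of 0 ?\<Gamma> \<tau> "fshift 2 \<phi>"] by simp
next
  case (SuccInj \<Gamma> \<Delta> s t)
  have "has_ty \<Gamma> t Nt" if "has_ty \<Gamma> (Succ t) Nt" for t
    using that by cases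
  with SuccInj show ?case by simp
next
  case (RecZero \<Gamma> a \<tau> f \<Delta>)
  have "has_ty \<Gamma> (Rec a f Zero) \<tau>" by (rule ty_Rec[OF _ _ ty_Zero]) fact+
  with RecZero show ?case by simp
next
  case (RecSucc \<Gamma> a \<tau> f n \<Delta>)
  have "has_ty \<Gamma> (Rec a f (Succ n)) \<tau>" by (rule ty_Rec[OF _ _ ty_Succ]) fact+
  moreover have "has_ty \<Gamma> (f \<cdot> n \<cdot> Rec a f n) \<tau>" by (rule ty_App[OF ty_App ty_Rec]) fact+
  ultimately show ?case by simp
next
  case (OrE \<Gamma> \<Delta> \<phi> \<psi> \<chi>)
  then show ?case by auto
next
  case (ImpI \<Gamma> \<phi> \<Delta> \<psi>)
  then show ?case by auto
qed simp_all

end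

theory Submission
  imports Defs "HOL-Library.Countable"
begin

text \<open>
  Put \<open>A\<^sub>n\<close> for: some \<open>x \<ge> n\<close> in the compactification has \<open>f\<^sub>k(x) \<noteq> 0\<close> for some \<open>k \<ge> n\<close>.
  For a single \<open>x\<close> the search over \<open>k\<close> is bounded, because \<open>f\<^sub>k(x) \<rightarrow> 0\<close>, and the compactification is
  omniscient for decidable predicates (Escardo); so every \<open>A\<^sub>n\<close> is decidable. If \<open>A\<^sub>n\<close> fails for some
  \<open>n\<close>, the first alternative holds. Suppose that \<open>A\<^sub>0\<close> holds and choose witnesses \<open>\<alpha>\<^sub>n\<close> of \<open>A\<^sub>n\<close>,
  whenever it holds. There is a point \<open>y\<close> whose \<open>i\<close>-th entry is 0 as long as \<open>A\<^sub>i\<^sub>+\<^sub>1\<close> holds and that agrees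
  with \<open>\<alpha>\<^sub>n\<close> if \<open>A\<close> is lost between \<open>n\<close> and \<open>n + 1\<close>; it is well defined because \<open>\<alpha>\<^sub>n \<ge> n\<close>. If
  \<open>f\<^sub>k(y) = 0\<close> for all \<open>k \<ge> M\<close>, then \<open>A\<close> cannot be lost at \<open>M\<close> or later, so deciding \<open>A\<^sub>M\<close> decides
  between the two alternatives.

  The argument is carried out inside the formal system in a forcing style: worlds are finite sets of
  hypotheses over one infinite typed context, and since that context always has a fresh variable,
  quantifiers range over all its terms and no shifting of variables is needed.
\<close>

subsection \<open>Simultaneous substitution\<close>

text \<open>The point \<open>y\<close> is the way around it: \<open>y\<close> is built without
  knowing whether \<open>A\<close> is ever lost, yet convergence at this one point yields a concrete
  \<open>M\<close> from which on no loss can occur. A loss at some \<open>m\<close> at or beyond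
  \<open>M\<close> would make \<open>y\<close> equal to the witness \<open>\<alpha>_m\<close>, at
  which some \<open>f_k\<close> with \<open>k \<ge> m\<close> is nonzero. No continuity of the
  \<open>f_k\<close> is available; the argument only uses that equal sequences have equal values,
  which is why equations between sequences are proved at type \<open>Seq\<close> by the rule
  \<open>Ext\<close>. A disjunction or existential statement derivable from hypotheses supplies
  neither a disjunct nor a witness outside the system. Every case analysis is therefore an
  elimination towards a fixed goal \<open>\<chi>\<close>, carried out in a larger world.\<close>

definition up :: "(nat \<Rightarrow> tm) \<Rightarrow> nat \<Rightarrow> tm" where
  "up s = case_nat (Var 0) (\<lambda>i. shift 0 (s i))"

lemma up_simps [simp]: "up s 0 = Var 0" "up s (Suc i) = shift 0 (s i)"
  by (simp_all add: up_def)

primrec sub :: "(nat \<Rightarrow> tm) \<Rightarrow> tm \<Rightarrow> tm" where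
  "sub s (Var i) = s i"
| "sub s Zero = Zero"
| "sub s (Succ t) = Succ (sub s t)"
| "sub s (Rec a f n) = Rec (sub s a) (sub s f) (sub s n)"
| "sub s (Lam \<sigma> t) = Lam \<sigma> (sub (up s) t)"
| "sub s (t \<cdot> u) = sub s t \<cdot> sub s u"

primrec fsub :: "(nat \<Rightarrow> tm) \<Rightarrow> fm \<Rightarrow> fm" where
  "fsub s \<^bold>\<bottom> = \<^bold>\<bottom>"
| "fsub s (Eq \<tau> t u) = Eq \<tau> (sub s t) (sub s u)"
| "fsub s (\<phi> \<^bold>\<and> \<psi>) = (fsub s \<phi> \<^bold>\<and> fsub s \<psi>)"
| "fsub s (\<phi> \<^bold>\<or> \<psi>) = (fsub s \<phi> \<^bold>\<or> fsub s \<psi>)"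
| "fsub s (\<phi> \<^bold>\<longrightarrow> \<psi>) = (fsub s \<phi> \<^bold>\<longrightarrow> fsub s \<psi>)"
| "fsub s (All \<tau> \<phi>) = All \<tau> (fsub (up s) \<phi>)"
| "fsub s (Ex \<tau> \<phi>) = Ex \<tau> (fsub (up s) \<phi>)"

text \<open>The given \<open>shift k\<close> and \<open>subst k s\<close> are the parallel
  substitutions \<open>skip k\<close> and \<open>inst k s\<close>. Every law by which they commute
  then reduces to composing substitutions and comparing the results index by index.\<close>

definition skip :: "nat \<Rightarrow> nat \<Rightarrow> tm" where
  "skip k i = Var (if i < k then i else Suc i)"

definition inst :: "nat \<Rightarrow> tm \<Rightarrow> nat \<Rightarrow> tm" where
  "inst k s i = (if i < k then Var i else if i = k then s else Var (i - 1))"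

lemma up_Var: "up Var = Var"
  by (auto simp: up_def fun_eq_iff split: nat.split)

lemma up_skip: "up (skip k) = skip (Suc k)"
  by (auto simp: up_def skip_def fun_eq_iff split: nat.split)

lemma up_inst: "up (inst k s) = inst (Suc k) (shift 0 s)"
  by (auto simp: up_def inst_def fun_eq_iff split: nat.split)

lemma sub_Var: "sub Var t = t"
  by (induction t) (simp_all add: up_Var)

lemma shift_eq_sub: "shift k t = sub (skip k) t"
  by (induction t arbitrary: k) (simp_all add: up_skip, simp add: skip_def)

lemma subst_eq_sub: "subst k s t = sub (inst k s) t"
  by (induction t arbitrary: k s) (simp_all add: up_inst, simp add: inst_def)

lemma fsub_Var: "fsub Var \<phi> = \<phi>"
  by (induction \<phi>) (simp_all add: up_Var sub_Var)

lemma fshift_eq_fsub: "fshift k \<phi> = fsub (skip k) \<phi>"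
  by (induction \<phi> arbitrary: k) (simp_all add: up_skip shift_eq_sub)

lemma fsubst_eq_fsub: "fsubst k s \<phi> = fsub (inst k s) \<phi>"
  by (induction \<phi> arbitrary: k s) (simp_all add: up_inst subst_eq_sub)

lemma shift_shift: "j \<le> k \<Longrightarrow> shift (Suc k) (shift j t) = shift j (shift k t)"
  by (induction t arbitrary: j k) auto

text \<open>This and \<open>shift_sub\<close> are the two cases of composition in which one side is
  a shift. They come first because \<open>up_comp\<close>, and with it \<open>sub_sub\<close> under
  a binder, needs both.\<close>

lemma sub_shift: "sub s (shift k t) = sub (\<lambda>i. s (if i < k then i else Suc i)) t"
proof (induction t arbitrary: s k)
  case (Lam \<sigma> t)
  have "(\<lambda>i. up s (if i < Suc k then i else Suc i)) = up (\<lambda>i. s (if i < k then i else Suc i))"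
    by (auto simp: up_def fun_eq_iff split: nat.split)
  with Lam show ?case by simp
qed simp_all

lemma shift_sub: "shift k (sub s t) = sub (\<lambda>i. shift k (s i)) t"
proof (induction t arbitrary: s k)
  case (Lam \<sigma> t)
  have "(\<lambda>i. shift (Suc k) (up s i)) = up (\<lambda>i. shift k (s i))"
    by (auto simp: up_def fun_eq_iff shift_shift split: nat.split)
  with Lam show ?case by simp
qed simp_all

lemma sub_up_shift [simp]: "sub (up s) (shift 0 t) = shift 0 (sub s t)"
  by (simp add: sub_shift shift_sub)

lemma up_comp: "(\<lambda>i. sub (up s) (up r i)) = up (\<lambda>i. sub s (r i))"
  by (auto simp: up_def fun_eq_iff split: nat.split) (simp flip: up_def)

lemma sub_sub: "sub s (sub r t) = sub (\<lambda>i. sub s (r i)) t"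
  by (induction t arbitrary: s r) (simp_all add: up_comp)

lemma fsub_fsub: "fsub s (fsub r \<phi>) = fsub (\<lambda>i. sub s (r i)) \<phi>"
  by (induction \<phi> arbitrary: s r) (simp_all add: up_comp sub_sub)

lemma fsub_up_fshift: "fsub (up s) (fshift 0 \<phi>) = fshift 0 (fsub s \<phi>)"
  by (simp add: fshift_eq_fsub fsub_fsub)
     (simp add: skip_def shift_eq_sub flip: fshift_eq_fsub)

lemma subst_shift [simp]: "subst k s (shift k t) = t"
proof -
  have "(\<lambda>i. inst k s (if i < k then i else Suc i)) = Var"
    by (auto simp: inst_def fun_eq_iff)
  then show ?thesis by (simp add: subst_eq_sub sub_shift sub_Var)
qed

lemma fsubst_fshift [simp]: "fsubst k s (fshift k \<phi>) = \<phi>"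
  by (induction \<phi> arbitrary: k s) simp_all

lemma shift_Suc_shift [simp]: "shift (Suc k) (shift 0 t) = shift 0 (shift k t)"
  by (simp add: shift_shift)

lemma subst_shift_shift [simp]: "subst (Suc 0) u (shift 0 (shift 0 t)) = shift 0 t"
  by (metis shift_Suc_shift subst_shift)

lemma subst_Suc_shift [simp]: "subst (Suc k) (shift 0 s) (shift 0 t) = shift 0 (subst k s t)"
  by (simp add: subst_eq_sub flip: up_inst)

lemma fsub_fsubst: "fsub s (fsubst 0 t \<phi>) = fsubst 0 (sub s t) (fsub (up s) \<phi>)"
proof -
  have "(\<lambda>i. sub s (inst 0 t i)) = (\<lambda>i. sub (inst 0 (sub s t)) (up s i))"
    by (auto simp: inst_def up_def fun_eq_iff simp flip: subst_eq_sub split: nat.split)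
  then show ?thesis by (simp add: fsubst_eq_fsub fsub_fsub)
qed

lemma sub_subst: "sub s (subst 0 t u) = subst 0 (sub s t) (sub (up s) u)"
proof -
  have "(\<lambda>i. sub s (inst 0 t i)) = (\<lambda>i. sub (inst 0 (sub s t)) (up s i))"
    by (auto simp: inst_def up_def fun_eq_iff simp flip: subst_eq_sub split: nat.split)
  then show ?thesis by (simp add: subst_eq_sub sub_sub)
qed

text \<open>The substitution is pushed through the induction step as the rule \<open>Ind\<close>
  writes it, a shift followed by a substitution. Together with \<open>fsub_choice\<close>, which
  does the same for \<open>CC\<close>, it supplies the corresponding cases of
  \<open>prv_fsub\<close>.\<close>

lemma fsub_induct_step:
  "fsub (up s) (fsubst 0 (Succ (Var 0)) (fshift (Suc 0) \<phi>)) =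
    fsubst 0 (Succ (Var 0)) (fshift (Suc 0) (fsub (up s) \<phi>))"
proof -
  have "(\<lambda>i. sub (up s) (sub (inst 0 (Succ (Var 0))) (skip (Suc 0) i))) =
    (\<lambda>i. sub (inst 0 (Succ (Var 0))) (sub (skip (Suc 0)) (up s i)))"
  proof
    fix i
    show "sub (up s) (sub (inst 0 (Succ (Var 0))) (skip (Suc 0) i)) =
      sub (inst 0 (Succ (Var 0))) (sub (skip (Suc 0)) (up s i))"
      by (cases i) (simp_all add: inst_def skip_def flip: shift_eq_sub subst_eq_sub)
  qed
  then show ?thesis by (simp add: fsubst_eq_fsub fshift_eq_fsub fsub_fsub sub_sub)
qed

lemma fsub_choice:
  "fsub (up (up s)) (fsubst 0 (Var (Suc 0) \<cdot> Var 0) (fshift (Suc (Suc 0)) \<phi>)) =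
    fsubst 0 (Var (Suc 0) \<cdot> Var 0) (fshift (Suc (Suc 0)) (fsub (up (up s)) \<phi>))"
proof -
  have "(\<lambda>i. sub (up (up s)) (sub (inst 0 (Var (Suc 0) \<cdot> Var 0)) (skip (Suc (Suc 0)) i))) =
    (\<lambda>i. sub (inst 0 (Var (Suc 0) \<cdot> Var 0)) (sub (skip (Suc (Suc 0))) (up (up s) i)))"
  proof
    fix i
    consider "i = 0" | "i = 1" | j where "i = Suc (Suc j)"
      by (metis One_nat_def not0_implies_Suc)
    then show "sub (up (up s)) (sub (inst 0 (Var (Suc 0) \<cdot> Var 0)) (skip (Suc (Suc 0)) i)) =
      sub (inst 0 (Var (Suc 0) \<cdot> Var 0)) (sub (skip (Suc (Suc 0))) (up (up s) i))"
      by cases (simp_all add: inst_def skip_def flip: shift_eq_sub subst_eq_sub)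
  qed
  then show ?thesis
    by (simp add: fsubst_eq_fsub fshift_eq_fsub fsub_fsub sub_sub up_comp)
qed

section \<open>Substitution preserves typing and derivability\<close>

lemma has_ty_up:
  assumes "\<forall>i<length \<Gamma>. has_ty \<Gamma>' (s i) (\<Gamma> ! i)"
  shows "\<forall>i<length (\<tau> # \<Gamma>). has_ty (\<tau> # \<Gamma>') (up s i) ((\<tau> # \<Gamma>) ! i)"
proof (intro allI impI)
  fix i assume "i < length (\<tau> # \<Gamma>)"
  with assms show "has_ty (\<tau> # \<Gamma>') (up s i) ((\<tau> # \<Gamma>) ! i)"
    by (cases i) (auto intro: has_ty_shift0 ty_Var)
qed

lemma has_ty_sub:
  "has_ty \<Gamma> t \<tau> \<Longrightarrow> \<forall>i<length \<Gamma>. has_ty \<Gamma>' (s i) (\<Gamma> ! i) \<Longrightarrow> has_ty \<Gamma>' (sub s t) \<tau>"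
proof (induction arbitrary: \<Gamma>' s rule: has_ty.induct)
  case (ty_Lam \<sigma> \<Gamma> t \<tau>)
  show ?case unfolding sub.simps
    by (rule has_ty.ty_Lam) (rule ty_Lam.IH[OF has_ty_up[OF ty_Lam.prems]])
next
  case (ty_App \<Gamma> t \<sigma> \<tau> u)
  show ?case unfolding sub.simps
    by (rule has_ty.ty_App) (rule ty_App.IH[OF ty_App.prems])+
qed (auto intro: has_ty.intros)

lemma wff_fsub:
  "wff \<Gamma> \<phi> \<Longrightarrow> \<forall>i<length \<Gamma>. has_ty \<Gamma>' (s i) (\<Gamma> ! i) \<Longrightarrow> wff \<Gamma>' (fsub s \<phi>)"
proof (induction \<phi> arbitrary: \<Gamma> \<Gamma>' s)
  case (All \<tau> \<phi>)
  have "wff (\<tau> # \<Gamma>') (fsub (up s) \<phi>)"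
    by (rule All.IH[OF _ has_ty_up[OF All.prems(2)]]) (use All.prems(1) in simp)
  then show ?case by simp
next
  case (Ex \<tau> \<phi>)
  have "wff (\<tau> # \<Gamma>') (fsub (up s) \<phi>)"
    by (rule Ex.IH[OF _ has_ty_up[OF Ex.prems(2)]]) (use Ex.prems(1) in simp)
  then show ?case by simp
qed (auto intro: has_ty_sub)

text \<open>Its purpose is renaming: in \<open>forces_AllI\<close> and \<open>forces_ExE\<close> a
  fresh variable of the context becomes the bound variable. At a binder the induction hypothesis is
  used with \<open>up s\<close>, which acts on shifted hypotheses as \<open>s\<close> does before
  the shift.\<close>

theorem prv_fsub:
  "\<Gamma>; \<Delta> \<turnstile> \<phi> \<Longrightarrow> \<forall>i<length \<Gamma>. has_ty \<Gamma>' (s i) (\<Gamma> ! i) \<Longrightarrow> \<Gamma>'; fsub s ` \<Delta> \<turnstile> fsub s \<phi>"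
proof (induction arbitrary: \<Gamma>' s rule: prv.induct)
  case (Hyp \<phi> \<Delta> \<Gamma>)
  then show ?case by (simp add: prv.Hyp)
next
  case (BotE \<Gamma> \<Delta> \<phi>)
  show ?case
    by (rule prv.BotE[OF _ wff_fsub[OF BotE.hyps(2) BotE.prems]])
      (use BotE.IH[OF BotE.prems] in simp)
next
  case (AndI \<Gamma> \<Delta> \<phi> \<psi>)
  show ?case unfolding fsub.simps
    by (rule prv.AndI[OF AndI.IH(1)[OF AndI.prems] AndI.IH(2)[OF AndI.prems]])
next
  case (AndE1 \<Gamma> \<Delta> \<phi> \<psi>)
  show ?case by (rule prv.AndE1[OF AndE1.IH[OF AndE1.prems, unfolded fsub.simps]])
next
  case (AndE2 \<Gamma> \<Delta> \<phi> \<psi>)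
  show ?case by (rule prv.AndE2[OF AndE2.IH[OF AndE2.prems, unfolded fsub.simps]])
next
  case (OrI1 \<Gamma> \<Delta> \<phi> \<psi>)
  show ?case unfolding fsub.simps
    by (rule prv.OrI1[OF OrI1.IH[OF OrI1.prems] wff_fsub[OF OrI1.hyps(2) OrI1.prems]])
next
  case (OrI2 \<Gamma> \<Delta> \<psi> \<phi>)
  show ?case unfolding fsub.simps
    by (rule prv.OrI2[OF OrI2.IH[OF OrI2.prems] wff_fsub[OF OrI2.hyps(2) OrI2.prems]])
next
  case (OrE \<Gamma> \<Delta> \<phi> \<psi> \<chi>)
  show ?case
    by (rule prv.OrE[OF OrE.IH(1)[OF OrE.prems, unfolded fsub.simps]
          OrE.IH(2)[OF OrE.prems, unfolded image_insert] OrE.IH(3)[OF OrE.prems, unfolded image_insert]])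
next
  case (ImpI \<Gamma> \<phi> \<Delta> \<psi>)
  show ?case unfolding fsub.simps
    by (rule prv.ImpI[OF ImpI.IH[OF ImpI.prems, unfolded image_insert]
          wff_fsub[OF ImpI.hyps(2) ImpI.prems]])
next
  case (ImpE \<Gamma> \<Delta> \<phi> \<psi>)
  show ?case
    by (rule prv.ImpE[OF ImpE.IH(1)[OF ImpE.prems, unfolded fsub.simps] ImpE.IH(2)[OF ImpE.prems]])
next
  case (AllI \<tau> \<Gamma> \<Delta> \<phi>)
  from AllI.IH[OF has_ty_up[OF AllI.prems]] show ?case
    unfolding fsub.simps by (intro prv.AllI) (simp only: image_image fsub_up_fshift)
next
  case (AllE \<Gamma> \<Delta> \<tau> \<phi> t)
  show ?case unfolding fsub_fsubst
    by (rule prv.AllE[OF AllE.IH[OF AllE.prems, unfolded fsub.simps]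
          has_ty_sub[OF AllE.hyps(2) AllE.prems]])
next
  case (ExI \<Gamma> \<Delta> t \<phi> \<tau>)
  show ?case unfolding fsub.simps
    by (rule prv.ExI[OF ExI.IH[OF ExI.prems, unfolded fsub_fsubst]
          has_ty_sub[OF ExI.hyps(2) ExI.prems] wff_fsub[OF ExI.hyps(3) has_ty_up[OF ExI.prems]]])
next
  case (ExE \<Gamma> \<Delta> \<tau> \<phi> \<psi>)
  have "\<tau> # \<Gamma>'; insert (fsub (up s) \<phi>) (fshift 0 ` fsub s ` \<Delta>) \<turnstile> fshift 0 (fsub s \<psi>)"
    using ExE.IH(2)[OF has_ty_up[OF ExE.prems]]
    by (simp only: image_image image_insert fsub_up_fshift)
  with ExE.IH(1)[OF ExE.prems, unfolded fsub.simps] show ?case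
    by (rule prv.ExE) (rule wff_fsub[OF ExE.hyps(3) ExE.prems])
next
  case (EqI \<Gamma> t \<tau> \<Delta>)
  show ?case unfolding fsub.simps by (rule prv.EqI[OF has_ty_sub[OF EqI]])
next
  case (EqE \<Gamma> \<Delta> \<tau> a b \<phi>)
  show ?case unfolding fsub_fsubst
    by (rule prv.EqE[OF EqE.IH(1)[OF EqE.prems, unfolded fsub.simps]
          EqE.IH(2)[OF EqE.prems, unfolded fsub_fsubst]
          wff_fsub[OF EqE.hyps(3) has_ty_up[OF EqE.prems]]])
next
  case (Ext \<Gamma> \<Delta> \<sigma> \<tau> a b)
  show ?case unfolding fsub.simps
    by (rule prv.Ext[OF _ has_ty_sub[OF Ext.hyps(2) Ext.prems] has_ty_sub[OF Ext.hyps(3) Ext.prems]])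
      (use Ext.IH[OF Ext.prems] in simp)
next
  case (Beta \<sigma> \<Gamma> t \<tau> a \<Delta>)
  show ?case unfolding fsub.simps sub.simps sub_subst
    by (rule prv.Beta[OF has_ty_sub[OF Beta.hyps(1) has_ty_up[OF Beta.prems]]
          has_ty_sub[OF Beta.hyps(2) Beta.prems]])
next
  case (RecZero \<Gamma> a \<tau> f \<Delta>)
  show ?case unfolding fsub.simps sub.simps
    by (rule prv.RecZero; rule has_ty_sub[OF _ RecZero.prems]) (fact RecZero.hyps)+
next
  case (RecSucc \<Gamma> a \<tau> f n \<Delta>)
  show ?case unfolding fsub.simps sub.simps
    by (rule prv.RecSucc; rule has_ty_sub[OF _ RecSucc.prems]) (fact RecSucc.hyps)+
next
  case (ZeroSucc \<Gamma> \<Delta> t)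
  from ZeroSucc.IH[OF ZeroSucc.prems] show ?case by (simp add: prv.ZeroSucc)
next
  case (SuccInj \<Gamma> \<Delta> a b)
  from SuccInj.IH[OF SuccInj.prems] show ?case by (simp add: prv.SuccInj)
next
  case (Ind \<Gamma> \<Delta> \<phi>)
  from Ind.IH(1)[OF Ind.prems] Ind.IH(2)[OF Ind.prems] show ?case
    by (simp add: fsub_fsubst[of _ Zero] fsub_induct_step prv.Ind)
next
  case (CC \<Gamma> \<Delta> \<tau> \<phi>)
  then show ?case
    using prv.CC[of \<Gamma>' "fsub s ` \<Delta>" \<tau> "fsub (up (up s)) \<phi>"]
    by (simp add: fsub_choice numeral_2_eq_2)
qed

subsection \<open>Typing in an infinite context\<close>

text \<open>Countability allows a single environment \<open>G\<close> in which each type occurs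
  infinitely often.\<close>

instance ty :: countable
  by countable_datatype

text \<open>Type inference as a function on an infinite environment. Typing conditions become
  equations that the simplifier can solve, and no bound on the variables in use has to be carried
  along.\<close>

primrec tyof :: "(nat \<Rightarrow> ty) \<Rightarrow> tm \<Rightarrow> ty option" where
  "tyof e (Var i) = Some (e i)"
| "tyof e Zero = Some Nt"
| "tyof e (Succ t) = (if tyof e t = Some Nt then Some Nt else None)"
| "tyof e (Rec a f n) = (case tyof e a of None \<Rightarrow> None | Some \<tau> \<Rightarrow>
    if tyof e f = Some (Nt \<rightarrow> \<tau> \<rightarrow> \<tau>) \<and> tyof e n = Some Nt then Some \<tau> else None)"
| "tyof e (Lam \<sigma> t) = map_option (Fn \<sigma>) (tyof (case_nat \<sigma> e) t)"
| "tyof e (t \<cdot> u) = (case tyof e t of Some (\<sigma> \<rightarrow> \<tau>) \<Rightarrow>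
    if tyof e u = Some \<sigma> then Some \<tau> else None | _ \<Rightarrow> None)"

primrec wfe :: "(nat \<Rightarrow> ty) \<Rightarrow> fm \<Rightarrow> bool" where
  "wfe e \<^bold>\<bottom> = True"
| "wfe e (Eq \<tau> s t) = (tyof e s = Some \<tau> \<and> tyof e t = Some \<tau>)"
| "wfe e (\<phi> \<^bold>\<and> \<psi>) = (wfe e \<phi> \<and> wfe e \<psi>)"
| "wfe e (\<phi> \<^bold>\<or> \<psi>) = (wfe e \<phi> \<and> wfe e \<psi>)"
| "wfe e (\<phi> \<^bold>\<longrightarrow> \<psi>) = (wfe e \<phi> \<and> wfe e \<psi>)"
| "wfe e (All \<tau> \<phi>) = wfe (case_nat \<tau> e) \<phi>"
| "wfe e (Ex \<tau> \<phi>) = wfe (case_nat \<tau> e) \<phi>"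

lemma tyof_shift:
  "\<forall>i. e' (if i < k then i else Suc i) = e i \<Longrightarrow> tyof e' (shift k t) = tyof e t"
proof (induction t arbitrary: e e' k)
  case (Var i)
  then show ?case by (auto dest: spec[of _ i])
next
  case (Succ t)
  from Succ.IH[OF Succ.prems] show ?case by simp
next
  case (Rec a f n)
  from Rec.IH(1,2,3)[OF Rec.prems] show ?case by (simp only: shift.simps tyof.simps)
next
  case (Lam \<sigma> t)
  have "case_nat \<sigma> e' (if i < Suc k then i else Suc i) = case_nat \<sigma> e i" for i
    using Lam.prems[rule_format, of "i - 1"] by (cases i) auto
  then have "\<forall>i. case_nat \<sigma> e' (if i < Suc k then i else Suc i) = case_nat \<sigma> e i" ..
  from Lam.IH[OF this] show ?case by simp
next
  case (App t u)
  from App.IH(1,2)[OF App.prems] show ?case by (simp only: shift.simps tyof.simps)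
qed simp

lemma tyof_shift0 [simp]: "tyof (case_nat \<sigma> e) (shift 0 t) = tyof e t"
  by (rule tyof_shift) simp

lemma tyof_up:
  assumes "\<forall>i. tyof e' (s i) = Some (e i)"
  shows "\<forall>i. tyof (case_nat \<sigma> e') (up s i) = Some (case_nat \<sigma> e i)"
proof
  fix i
  show "tyof (case_nat \<sigma> e') (up s i) = Some (case_nat \<sigma> e i)"
    using assms by (cases i) auto
qed

lemma tyof_sub: "\<forall>i. tyof e' (s i) = Some (e i) \<Longrightarrow> tyof e' (sub s t) = tyof e t"
proof (induction t arbitrary: e e' s)
  case (Succ t)
  from Succ.IH[OF Succ.prems] show ?case by simp
next
  case (Rec a f n)
  from Rec.IH(1,2,3)[OF Rec.prems] show ?case by (simp only: sub.simps tyof.simps)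
next
  case (Lam \<sigma> t)
  from Lam.IH[OF tyof_up[OF Lam.prems]] show ?case by simp
next
  case (App t u)
  from App.IH(1,2)[OF App.prems] show ?case by (simp only: sub.simps tyof.simps)
qed simp_all

lemma wfe_fsub: "\<forall>i. tyof e' (s i) = Some (e i) \<Longrightarrow> wfe e' (fsub s \<phi>) = wfe e \<phi>"
proof (induction \<phi> arbitrary: e e' s)
  case (Eq \<tau> t u)
  from tyof_sub[OF Eq.prems] show ?case by simp
next
  case (And \<phi> \<psi>)
  from And.IH(1,2)[OF And.prems] show ?case by simp
next
  case (Or \<phi> \<psi>)
  from Or.IH(1,2)[OF Or.prems] show ?case by simp
next
  case (Imp \<phi> \<psi>)
  from Imp.IH(1,2)[OF Imp.prems] show ?case by simp
next
  case (All \<tau> \<phi>)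
  from All.IH[OF tyof_up[OF All.prems]] show ?case by simp
next
  case (Ex \<tau> \<phi>)
  from Ex.IH[OF tyof_up[OF Ex.prems]] show ?case by simp
qed simp

lemma wfe_fshift0 [simp]: "wfe (case_nat \<sigma> e) (fshift 0 \<phi>) = wfe e \<phi>"
  by (simp add: fshift_eq_fsub wfe_fsub skip_def)

lemma wfe_fshift1 [simp]:
  "wfe (case_nat \<tau> (case_nat \<sigma> e)) (fshift (Suc 0) \<phi>) = wfe (case_nat \<tau> e) \<phi>"
  by (simp add: fshift_eq_fsub wfe_fsub skip_def split: nat.split)

lemma wfe_fsubst0 [simp]:
  "tyof e t = Some \<tau> \<Longrightarrow> wfe e (fsubst 0 t \<phi>) = wfe (case_nat \<tau> e) \<phi>"
  by (simp add: fsubst_eq_fsub wfe_fsub inst_def split: nat.split)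

section \<open>From the infinite environment to finite contexts\<close>

lemma map_env_Suc: "map (case_nat \<sigma> e) [0..<Suc m] = \<sigma> # map e [0..<m]"
  by (simp add: map_upt_Suc del: upt_Suc)

text \<open>Only finitely many variables occur in a term, so every sufficiently long initial segment
  of the environment types it. Stated as an eventual property, such facts can be intersected without
  naming a common length.\<close>

lemma tyof_has_ty:
  "tyof e t = Some \<tau> \<Longrightarrow> \<forall>\<^sub>F m in sequentially. has_ty (map e [0..<m]) t \<tau>"
proof (induction t arbitrary: e \<tau>)
  case (Var i)
  from eventually_gt_at_top[of i] show ?case
    by eventually_elim (use Var in \<open>auto intro: ty_Var\<close>)
next
  case (Succ t)
  then have t: "tyof e t = Some Nt" and \<tau>: "\<tau> = Nt" by (auto split: if_splits)
  from Succ.IH[OF t] show ?case unfolding \<tau> by eventually_elim (rule ty_Succ)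
next
  case (Rec a f n)
  then have "tyof e a = Some \<tau>" "tyof e f = Some (Nt \<rightarrow> \<tau> \<rightarrow> \<tau>)" "tyof e n = Some Nt"
    by (auto split: option.splits if_splits)
  from Rec.IH(1)[OF this(1)] Rec.IH(2)[OF this(2)] Rec.IH(3)[OF this(3)]
  show ?case by eventually_elim (rule ty_Rec)
next
  case (Lam \<sigma> t)
  then obtain \<rho> where \<rho>: "tyof (case_nat \<sigma> e) t = Some \<rho>" "\<tau> = \<sigma> \<rightarrow> \<rho>" by auto
  from Lam.IH[OF \<rho>(1)]
  have "\<forall>\<^sub>F m in sequentially. has_ty (map (case_nat \<sigma> e) [0..<Suc m]) t \<rho>"
    by (subst eventually_sequentially_Suc)
  then show ?case
    unfolding \<rho>(2) map_env_Suc by eventually_elim (rule ty_Lam)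
next
  case (App t u)
  then obtain \<sigma> where "tyof e t = Some (\<sigma> \<rightarrow> \<tau>)" "tyof e u = Some \<sigma>"
    by (auto split: option.splits if_splits ty.splits)
  from App.IH(1)[OF this(1)] App.IH(2)[OF this(2)]
  show ?case by eventually_elim (rule ty_App)
qed (simp add: ty_Zero)

lemma wfe_wff: "wfe e \<phi> \<Longrightarrow> \<forall>\<^sub>F m in sequentially. wff (map e [0..<m]) \<phi>"
proof (induction \<phi> arbitrary: e)
  case (All \<tau> \<phi>)
  then have "\<forall>\<^sub>F m in sequentially. wff (map (case_nat \<tau> e) [0..<Suc m]) \<phi>"
    by (subst eventually_sequentially_Suc) simp
  then show ?case unfolding map_env_Suc by simp
next
  case (Ex \<tau> \<phi>)
  then have "\<forall>\<^sub>F m in sequentially. wff (map (case_nat \<tau> e) [0..<Suc m]) \<phi>"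
    by (subst eventually_sequentially_Suc) simp
  then show ?case unfolding map_env_Suc by simp
qed (auto intro!: eventually_conj tyof_has_ty)

text \<open>A context of variables that has infinitely many of each type.\<close>

definition G :: "nat \<Rightarrow> ty" where
  "G i = from_nat (fst (prod_decode i))"

lemma fresh_var: "\<exists>i\<ge>N. G i = \<tau>"
proof
  show "prod_encode (to_nat \<tau>, N) \<ge> N \<and> G (prod_encode (to_nat \<tau>, N)) = \<tau>"
    by (simp add: G_def le_prod_encode_2)
qed

lemma sub_cong_has_ty:
  "has_ty \<Gamma> t \<tau> \<Longrightarrow> \<forall>i<length \<Gamma>. s i = s' i \<Longrightarrow> sub s t = sub s' t"
proof (induction arbitrary: s s' rule: has_ty.induct)
  case (ty_Lam \<sigma> \<Gamma> t \<tau>)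
  then have "\<forall>i<length (\<sigma> # \<Gamma>). up s i = up s' i"
    by (auto simp: up_def split: nat.split)
  then show ?case using ty_Lam.IH by simp
qed auto

lemma fsub_cong_wff:
  "wff \<Gamma> \<phi> \<Longrightarrow> \<forall>i<length \<Gamma>. s i = s' i \<Longrightarrow> fsub s \<phi> = fsub s' \<phi>"
proof (induction \<phi> arbitrary: \<Gamma> s s')
  case (All \<tau> \<phi>)
  then have "\<forall>i<length (\<tau> # \<Gamma>). up s i = up s' i"
    by (auto simp: up_def split: nat.split)
  then show ?case using All.IH[of "\<tau> # \<Gamma>"] All.prems by simp
next
  case (Ex \<tau> \<phi>)
  then have "\<forall>i<length (\<tau> # \<Gamma>). up s i = up s' i"
    by (auto simp: up_def split: nat.split)
  then show ?case using Ex.IH[of "\<tau> # \<Gamma>"] Ex.prems by simp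
qed (auto intro: sub_cong_has_ty)

lemma closed_inhabited: "\<exists>t. has_ty \<Gamma> t \<tau>"
  by (induction \<tau> arbitrary: \<Gamma>) (blast intro: ty_Zero ty_Lam)+

text \<open>A variable is dropped from the context by generalizing over it and instantiating. Every
  type is inhabited by \<open>closed_inhabited\<close>, and \<open>\<phi>\<close> survives both
  steps unchanged because all substitutions fix it.\<close>

lemma prv_strengthen: "\<Gamma>; {} \<turnstile> \<phi> \<Longrightarrow> (\<And>s. fsub s \<phi> = \<phi>) \<Longrightarrow> []; {} \<turnstile> \<phi>"
proof (induction \<Gamma>)
  case (Cons \<tau> \<Gamma>)
  obtain t where t: "has_ty \<Gamma> t \<tau>" using closed_inhabited by blast
  from Cons.prems(1) have "\<Gamma>; {} \<turnstile> All \<tau> \<phi>" by (auto intro: prv.AllI)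
  from prv.AllE[OF this t] have "\<Gamma>; {} \<turnstile> \<phi>" by (simp add: fsubst_eq_fsub Cons.prems(2))
  then show ?case by (rule Cons.IH) (rule Cons.prems(2))
qed

subsection \<open>Forcing\<close>

lemma prv_mono: "\<Gamma>; \<Delta> \<turnstile> \<phi> \<Longrightarrow> \<Delta> \<subseteq> \<Delta>' \<Longrightarrow> \<Gamma>; \<Delta>' \<turnstile> \<phi>"
proof (induction arbitrary: \<Delta>' rule: prv.induct)
  case (OrE \<Gamma> \<Delta> \<phi> \<psi> \<chi>)
  show ?case
    by (rule prv.OrE[OF OrE.IH(1)[OF OrE.prems] OrE.IH(2) OrE.IH(3)])
      (use OrE.prems in auto)
next
  case (ImpI \<Gamma> \<phi> \<Delta> \<psi>)
  show ?case by (rule prv.ImpI[OF ImpI.IH ImpI.hyps(2)]) (use ImpI.prems in auto)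
next
  case (AllI \<tau> \<Gamma> \<Delta> \<phi>)
  show ?case by (rule prv.AllI[OF AllI.IH]) (use AllI.prems in auto)
next
  case (ExE \<Gamma> \<Delta> \<tau> \<phi> \<psi>)
  show ?case
    by (rule prv.ExE[OF ExE.IH(1)[OF ExE.prems] ExE.IH(2) ExE.hyps(3)]) (use ExE.prems in auto)
next
  case (AllE \<Gamma> \<Delta> \<tau> \<phi> t)
  show ?case by (rule prv.AllE[OF AllE.IH[OF AllE.prems] AllE.hyps(2)])
next
  case (ExI \<Gamma> \<Delta> t \<phi> \<tau>)
  show ?case by (rule prv.ExI[OF ExI.IH[OF ExI.prems] ExI.hyps(2,3)])
next
  case (EqE \<Gamma> \<Delta> \<tau> s t \<phi>)
  show ?case by (rule prv.EqE[OF EqE.IH[OF EqE.prems] EqE.hyps(3)])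
next
  case (Ext \<Gamma> \<Delta> \<sigma> \<tau> s t)
  show ?case by (rule prv.Ext[OF Ext.IH[OF Ext.prems] Ext.hyps(2,3)])
next
  case (Ind \<Gamma> \<Delta> \<phi>)
  show ?case by (rule prv.Ind[OF Ind.IH[OF Ind.prems]])
next
  case (CC \<Gamma> \<Delta> \<tau> \<phi>)
  show ?case by (rule prv.CC[OF CC.IH[OF CC.prems]])
next
  case (ImpE \<Gamma> \<Delta> \<phi> \<psi>)
  show ?case by (rule prv.ImpE[OF ImpE.IH[OF ImpE.prems]])
next
  case (AndE1 \<Gamma> \<Delta> \<phi> \<psi>)
  show ?case by (rule prv.AndE1[OF AndE1.IH[OF AndE1.prems]])
next
  case (AndE2 \<Gamma> \<Delta> \<phi> \<psi>)
  show ?case by (rule prv.AndE2[OF AndE2.IH[OF AndE2.prems]])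
next
  case (Hyp \<phi> \<Delta> \<Gamma>)
  then show ?case by (auto intro: prv.Hyp)
next
  case (SuccInj \<Gamma> \<Delta> s t)
  show ?case by (rule prv.SuccInj[OF SuccInj.IH[OF SuccInj.prems]])
next
  case (ZeroSucc \<Gamma> \<Delta> t)
  show ?case by (rule prv.ZeroSucc[OF ZeroSucc.IH[OF ZeroSucc.prems]])
qed (simp_all add: prv.BotE prv.AndI prv.OrI1 prv.OrI2 prv.EqI prv.Beta prv.RecZero prv.RecSucc)

text \<open>Finiteness guarantees a variable of each type that occurs in no hypothesis, as
  \<open>generalize\<close> requires.\<close>

definition world :: "fm set \<Rightarrow> bool" where
  "world H \<longleftrightarrow> finite H \<and> (\<forall>\<psi>\<in>H. wfe G \<psi>)"

definition extends :: "fm set \<Rightarrow> fm set \<Rightarrow> bool" (infix "\<preceq>" 50) where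
  "H \<preceq> H' \<longleftrightarrow> H \<subseteq> H' \<and> world H'"

text \<open>This is derivability over all sufficiently long segments of \<open>G\<close>, so that
  formulas in any variables of \<open>G\<close> share one judgement. It is not a Kripke semantics: a
  forced disjunction need not have a forced disjunct. The rules below only have the shape of the
  Kripke clauses, with a goal \<open>\<chi>\<close> in the eliminations.\<close>

definition forces :: "fm set \<Rightarrow> fm \<Rightarrow> bool" ("_ \<Turnstile> _" [51, 20] 20) where
  "(H \<Turnstile> \<phi>) \<longleftrightarrow> world H \<and> wfe G \<phi> \<and> (\<forall>\<^sub>F n in sequentially. map G [0..<n]; H \<turnstile> \<phi>)"

abbreviation trm :: "tm \<Rightarrow> ty \<Rightarrow> bool" where
  "trm t \<tau> \<equiv> tyof G t = Some \<tau>"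

lemma forces_world: "H \<Turnstile> \<phi> \<Longrightarrow> world H"
  by (simp add: forces_def)

lemma forces_wfe: "H \<Turnstile> \<phi> \<Longrightarrow> wfe G \<phi>"
  by (simp add: forces_def)

lemma forces_prv: "H \<Turnstile> \<phi> \<Longrightarrow> \<forall>\<^sub>F n in sequentially. map G [0..<n]; H \<turnstile> \<phi>"
  by (simp add: forces_def)

lemma forcesI:
  "world H \<Longrightarrow> wfe G \<phi> \<Longrightarrow> \<forall>\<^sub>F n in sequentially. map G [0..<n]; H \<turnstile> \<phi> \<Longrightarrow> H \<Turnstile> \<phi>"
  by (simp add: forces_def)

lemma extends_trans [trans]: "H \<preceq> H' \<Longrightarrow> H' \<preceq> H'' \<Longrightarrow> H \<preceq> H''"
  by (auto simp: extends_def)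

lemma forces_mono:
  assumes "H \<Turnstile> \<phi>" "H \<preceq> H'"
  shows "H' \<Turnstile> \<phi>"
proof (rule forcesI)
  show "world H'" "wfe G \<phi>" using assms by (auto simp: forces_def extends_def)
  from forces_prv[OF assms(1)] show "\<forall>\<^sub>F n in sequentially. map G [0..<n]; H' \<turnstile> \<phi>"
    by eventually_elim (use assms(2) in \<open>auto simp: extends_def intro: prv_mono\<close>)
qed

lemma extends_insert: "world H \<Longrightarrow> wfe G \<phi> \<Longrightarrow> H \<preceq> insert \<phi> H"
  by (auto simp: extends_def world_def)

lemma forces_insert: "world H \<Longrightarrow> wfe G \<phi> \<Longrightarrow> insert \<phi> H \<Turnstile> \<phi>"
  by (auto simp: forces_def world_def intro!: always_eventually prv.Hyp)

text \<open>The index \<open>i\<close> is chosen beyond all variables of \<open>H\<close> and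
  \<open>\<phi>\<close>. The substitution \<open>s\<close> sends it to the new bound variable 0 and
  shifts every other variable; so on \<open>H\<close> it is the plain shift, and it turns
  \<open>\<phi>\<close> at \<open>Var i\<close> back into \<open>\<phi>\<close>.\<close>

lemma generalize:
  assumes "world H" "wfe (case_nat \<tau> G) \<phi>"
  obtains i s where "G i = \<tau>" "\<And>\<psi>. \<psi> \<in> H \<Longrightarrow> fsub s \<psi> = fshift 0 \<psi>"
    "fsub s (fsubst 0 (Var i) \<phi>) = \<phi>"
    "\<And>m. i < m \<Longrightarrow> \<forall>j<length (map G [0..<m]). has_ty (\<tau> # map G [0..<m]) (s j) (map G [0..<m] ! j)"
proof -
  have "\<forall>\<^sub>F n in sequentially. \<forall>\<psi>\<in>H. wff (map G [0..<n]) \<psi>"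
    using assms(1) by (auto simp: world_def eventually_ball_finite_distrib intro: wfe_wff)
  moreover have "\<forall>\<^sub>F n in sequentially. wff (map G [0..<n]) (All \<tau> \<phi>)"
    using assms(2) by (intro wfe_wff) simp
  ultimately have "\<forall>\<^sub>F n in sequentially. (\<forall>\<psi>\<in>H. wff (map G [0..<n]) \<psi>) \<and> wff (map G [0..<n]) (All \<tau> \<phi>)"
    by eventually_elim simp
  then obtain N where N: "\<And>\<psi>. \<psi> \<in> H \<Longrightarrow> wff (map G [0..<N]) \<psi>" "wff (\<tau> # map G [0..<N]) \<phi>"
    by (auto simp: eventually_sequentially)
  obtain i where i: "i \<ge> N" "G i = \<tau>" using fresh_var by blast
  define s where "s j = (if j = i then Var 0 else Var (Suc j))" for j
  show thesis
  proof
    show "G i = \<tau>" by fact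
    show "fsub s \<psi> = fshift 0 \<psi>" if "\<psi> \<in> H" for \<psi>
      unfolding fshift_eq_fsub using i
      by (intro fsub_cong_wff[OF N(1)[OF that]]) (auto simp: s_def skip_def)
    have "fsub (up s) \<phi> = fsub (skip (Suc 0)) \<phi>"
    proof (intro fsub_cong_wff[OF N(2)] allI impI)
      fix j assume "j < length (\<tau> # map G [0..<N])"
      then show "up s j = skip (Suc 0) j"
        using i by (cases j) (auto simp: s_def skip_def)
    qed
    moreover have "(\<lambda>j. sub (inst 0 (Var 0)) (skip (Suc 0) j)) = Var"
      by (auto simp: skip_def inst_def fun_eq_iff)
    ultimately show "fsub s (fsubst 0 (Var i) \<phi>) = \<phi>"
      by (simp add: fsub_fsubst, simp add: s_def fsubst_eq_fsub fsub_fsub fsub_Var)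
    show "\<forall>j<length (map G [0..<m]). has_ty (\<tau> # map G [0..<m]) (s j) (map G [0..<m] ! j)"
      if "i < m" for m
      using that i by (auto simp: s_def intro!: ty_Var)
  qed
qed

section \<open>Rules for the quantifiers and connectives\<close>

lemma forces_AllI:
  assumes "\<And>t. trm t \<tau> \<Longrightarrow> H \<Turnstile> fsubst 0 t \<phi>"
  shows "H \<Turnstile> All \<tau> \<phi>"
proof -
  \<comment> \<open>\<open>H\<close> is known only through the assumption. Its instance at some
    variable supplies that \<open>H\<close> is a world and that \<open>\<phi>\<close> is well
    formed.\<close>
  obtain i0 where "G i0 = \<tau>" using fresh_var by blast
  then have "H \<Turnstile> fsubst 0 (Var i0) \<phi>" and ty: "trm (Var i0) \<tau>" by (auto intro: assms)
  then have wd: "world H" and wf: "wfe (case_nat \<tau> G) \<phi>"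
    by (auto simp: forces_def)
  from generalize[OF this] obtain i s where gen: "G i = \<tau>" "\<And>\<psi>. \<psi> \<in> H \<Longrightarrow> fsub s \<psi> = fshift 0 \<psi>"
    "fsub s (fsubst 0 (Var i) \<phi>) = \<phi>"
    "\<And>m. i < m \<Longrightarrow> \<forall>j<length (map G [0..<m]). has_ty (\<tau> # map G [0..<m]) (s j) (map G [0..<m] ! j)"
    by blast
  have "\<forall>\<^sub>F n in sequentially. map G [0..<n]; H \<turnstile> fsubst 0 (Var i) \<phi>"
    using assms[of "Var i"] gen(1) by (simp add: forces_def)
  with eventually_gt_at_top[of i] have "\<forall>\<^sub>F n in sequentially. map G [0..<n]; H \<turnstile> All \<tau> \<phi>"
  proof eventually_elim
    case (elim n)
    from prv_fsub[OF elim(2) gen(4)[OF elim(1)]]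
    have "\<tau> # map G [0..<n]; fshift 0 ` H \<turnstile> \<phi>"
      by (simp only: gen(3) gen(2) cong: image_cong)
    then show ?case by (rule prv.AllI)
  qed
  with wd wf show ?thesis by (simp add: forces_def)
qed

lemma forces_AllE:
  assumes "H \<Turnstile> All \<tau> \<phi>" "trm t \<tau>"
  shows "H \<Turnstile> fsubst 0 t \<phi>"
proof (rule forcesI)
  show "world H" "wfe G (fsubst 0 t \<phi>)" using assms by (auto simp: forces_def)
  from forces_prv[OF assms(1)] tyof_has_ty[OF assms(2)]
  show "\<forall>\<^sub>F n in sequentially. map G [0..<n]; H \<turnstile> fsubst 0 t \<phi>"
    by eventually_elim (rule prv.AllE)
qed

lemma forces_ExI:
  assumes "H \<Turnstile> fsubst 0 t \<phi>" "trm t \<tau>" "wfe (case_nat \<tau> G) \<phi>"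
  shows "H \<Turnstile> Ex \<tau> \<phi>"
proof -
  have "wfe G (Ex \<tau> \<phi>)" using assms(3) by simp
  from wfe_wff[OF this] tyof_has_ty[OF assms(2)] forces_prv[OF assms(1)]
  have "\<forall>\<^sub>F n in sequentially. map G [0..<n]; H \<turnstile> Ex \<tau> \<phi>"
    unfolding wff.simps by eventually_elim (rule prv.ExI)
  with assms show ?thesis by (simp add: forces_def)
qed

lemma forces_ExE:
  assumes "H \<Turnstile> Ex \<tau> \<phi>"
    "\<And>H' t. H \<preceq> H' \<Longrightarrow> trm t \<tau> \<Longrightarrow> H' \<Turnstile> fsubst 0 t \<phi> \<Longrightarrow> H' \<Turnstile> \<chi>"
  shows "H \<Turnstile> \<chi>"
proof -
  have wd: "world H" and wf: "wfe (case_nat \<tau> G) \<phi>"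
    using assms(1) by (auto simp: forces_def)
  have *: "insert (fsubst 0 (Var i) \<phi>) H \<Turnstile> \<chi>" if "G i = \<tau>" for i
    by (rule assms(2)[of _ "Var i"]) (use that wd wf in \<open>auto intro: extends_insert forces_insert\<close>)
  have \<chi>: "wfe G \<chi>" using * fresh_var forces_wfe by blast
  \<comment> \<open>\<open>\<chi>\<close> joins the world so that the fresh variable avoids it too:
    the rule \<open>ExE\<close> asks for the plainly shifted \<open>\<chi>\<close>.\<close>
  have "world (insert \<chi> H)" using wd \<chi> by (simp add: world_def)
  from generalize[OF this wf] obtain i s where gen: "G i = \<tau>"
    "\<And>\<psi>. \<psi> \<in> insert \<chi> H \<Longrightarrow> fsub s \<psi> = fshift 0 \<psi>"
    "fsub s (fsubst 0 (Var i) \<phi>) = \<phi>"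
    "\<And>m. i < m \<Longrightarrow> \<forall>j<length (map G [0..<m]). has_ty (\<tau> # map G [0..<m]) (s j) (map G [0..<m] ! j)"
    by blast
  have "\<forall>\<^sub>F n in sequentially. map G [0..<n]; insert (fsubst 0 (Var i) \<phi>) H \<turnstile> \<chi>"
    using *[OF gen(1)] by (simp add: forces_def)
  moreover have "\<forall>\<^sub>F n in sequentially. map G [0..<n]; H \<turnstile> Ex \<tau> \<phi>"
    using assms(1) by (simp add: forces_def)
  moreover note eventually_gt_at_top[of i] wfe_wff[OF \<chi>]
  ultimately have "\<forall>\<^sub>F n in sequentially. map G [0..<n]; H \<turnstile> \<chi>"
  proof eventually_elim
    case (elim n)
    have "fsub s ` insert (fsubst 0 (Var i) \<phi>) H = insert \<phi> (fshift 0 ` H)"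
      using gen(2,3) by (auto simp: image_iff)
    with prv_fsub[OF elim(1) gen(4)[OF elim(3)]] gen(2)[of \<chi>]
    have "\<tau> # map G [0..<n]; insert \<phi> (fshift 0 ` H) \<turnstile> fshift 0 \<chi>" by simp
    with elim show ?case by (blast intro: prv.ExE)
  qed
  with wd \<chi> show ?thesis by (simp add: forces_def)
qed

lemma forces_BotE:
  assumes "H \<Turnstile> \<^bold>\<bottom>" "wfe G \<phi>"
  shows "H \<Turnstile> \<phi>"
proof (rule forcesI[OF forces_world[OF assms(1)] assms(2)])
  from forces_prv[OF assms(1)] wfe_wff[OF assms(2)]
  show "\<forall>\<^sub>F n in sequentially. map G [0..<n]; H \<turnstile> \<phi>"
    by eventually_elim (rule prv.BotE)
qed

lemma forces_And: "(H \<Turnstile> \<phi> \<^bold>\<and> \<psi>) \<longleftrightarrow> (H \<Turnstile> \<phi>) \<and> (H \<Turnstile> \<psi>)"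
proof -
  have "(\<Gamma>; H \<turnstile> \<phi> \<^bold>\<and> \<psi>) \<longleftrightarrow> (\<Gamma>; H \<turnstile> \<phi>) \<and> (\<Gamma>; H \<turnstile> \<psi>)" for \<Gamma>
    by (blast intro: prv.AndI prv.AndE1 prv.AndE2)
  then show ?thesis by (auto simp: forces_def eventually_conj_iff)
qed

lemma forces_OrI1:
  assumes "H \<Turnstile> \<phi>" "wfe G \<psi>"
  shows "H \<Turnstile> \<phi> \<^bold>\<or> \<psi>"
proof (rule forcesI[OF forces_world[OF assms(1)]])
  show "wfe G (\<phi> \<^bold>\<or> \<psi>)" using assms by (simp add: forces_wfe)
  from forces_prv[OF assms(1)] wfe_wff[OF assms(2)]
  show "\<forall>\<^sub>F n in sequentially. map G [0..<n]; H \<turnstile> \<phi> \<^bold>\<or> \<psi>"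
    by eventually_elim (rule prv.OrI1)
qed

lemma forces_OrI2:
  assumes "H \<Turnstile> \<psi>" "wfe G \<phi>"
  shows "H \<Turnstile> \<phi> \<^bold>\<or> \<psi>"
proof (rule forcesI[OF forces_world[OF assms(1)]])
  show "wfe G (\<phi> \<^bold>\<or> \<psi>)" using assms by (simp add: forces_wfe)
  from forces_prv[OF assms(1)] wfe_wff[OF assms(2)]
  show "\<forall>\<^sub>F n in sequentially. map G [0..<n]; H \<turnstile> \<phi> \<^bold>\<or> \<psi>"
    by eventually_elim (rule prv.OrI2)
qed

lemma forces_OrE [consumes 1, case_names left right]:
  assumes "H \<Turnstile> \<phi> \<^bold>\<or> \<psi>"
    and "\<And>H'. H \<preceq> H' \<Longrightarrow> H' \<Turnstile> \<phi> \<Longrightarrow> H' \<Turnstile> \<chi>"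
    and "\<And>H'. H \<preceq> H' \<Longrightarrow> H' \<Turnstile> \<psi> \<Longrightarrow> H' \<Turnstile> \<chi>"
  shows "H \<Turnstile> \<chi>"
proof -
  have wd: "world H" and "wfe G \<phi>" "wfe G \<psi>" using assms(1) by (auto simp: forces_def)
  then have l: "insert \<phi> H \<Turnstile> \<chi>" and r: "insert \<psi> H \<Turnstile> \<chi>"
    by (auto intro: assms(2,3) extends_insert forces_insert)
  have "\<forall>\<^sub>F n in sequentially. map G [0..<n]; H \<turnstile> \<phi> \<^bold>\<or> \<psi>"
    "\<forall>\<^sub>F n in sequentially. map G [0..<n]; insert \<phi> H \<turnstile> \<chi>"
    "\<forall>\<^sub>F n in sequentially. map G [0..<n]; insert \<psi> H \<turnstile> \<chi>"
    using assms(1) l r by (simp_all add: forces_def)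
  then have "\<forall>\<^sub>F n in sequentially. map G [0..<n]; H \<turnstile> \<chi>"
    by eventually_elim (rule prv.OrE)
  with l wd show ?thesis by (simp add: forces_def)
qed

lemma forces_ImpI:
  assumes "\<And>H'. H \<preceq> H' \<Longrightarrow> H' \<Turnstile> \<phi> \<Longrightarrow> H' \<Turnstile> \<psi>" "world H" "wfe G \<phi>"
  shows "H \<Turnstile> \<phi> \<^bold>\<longrightarrow> \<psi>"
proof -
  have *: "insert \<phi> H \<Turnstile> \<psi>"
    using assms(2,3) by (auto intro: assms(1) extends_insert forces_insert)
  then have "\<forall>\<^sub>F n in sequentially. map G [0..<n]; insert \<phi> H \<turnstile> \<psi>" by (simp add: forces_def)
  with wfe_wff[OF assms(3)] have "\<forall>\<^sub>F n in sequentially. map G [0..<n]; H \<turnstile> \<phi> \<^bold>\<longrightarrow> \<psi>"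
    by eventually_elim (rule prv.ImpI)
  with assms * show ?thesis by (simp add: forces_def)
qed

lemma forces_ImpE:
  assumes "H \<Turnstile> \<phi> \<^bold>\<longrightarrow> \<psi>" "H \<Turnstile> \<phi>"
  shows "H \<Turnstile> \<psi>"
proof (rule forcesI[OF forces_world[OF assms(1)]])
  show "wfe G \<psi>" using forces_wfe[OF assms(1)] by simp
  from forces_prv[OF assms(1)] forces_prv[OF assms(2)]
  show "\<forall>\<^sub>F n in sequentially. map G [0..<n]; H \<turnstile> \<psi>"
    by eventually_elim (rule prv.ImpE)
qed

section \<open>Rules for equality, arithmetic, induction and choice\<close>

lemma forces_EqI:
  assumes "trm t \<tau>" "world H"
  shows "H \<Turnstile> Eq \<tau> t t"
proof (rule forcesI[OF assms(2)])
  show "wfe G (Eq \<tau> t t)" using assms by simp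
  from tyof_has_ty[OF assms(1)] show "\<forall>\<^sub>F n in sequentially. map G [0..<n]; H \<turnstile> Eq \<tau> t t"
    by eventually_elim (rule prv.EqI)
qed

lemma forces_EqE:
  assumes "H \<Turnstile> Eq \<tau> s t" "H \<Turnstile> fsubst 0 s \<phi>" "wfe (case_nat \<tau> G) \<phi>"
  shows "H \<Turnstile> fsubst 0 t \<phi>"
proof (rule forcesI[OF forces_world[OF assms(1)]])
  show "wfe G (fsubst 0 t \<phi>)" using forces_wfe[OF assms(1)] assms(3) by simp
  have "wfe G (All \<tau> \<phi>)" using assms(3) by simp
  from wfe_wff[OF this] forces_prv[OF assms(1)] forces_prv[OF assms(2)]
  show "\<forall>\<^sub>F n in sequentially. map G [0..<n]; H \<turnstile> fsubst 0 t \<phi>"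
    unfolding wff.simps by eventually_elim (rule prv.EqE)
qed

lemma forces_Ext:
  assumes "\<And>u. trm u \<sigma> \<Longrightarrow> H \<Turnstile> Eq \<tau> (s \<cdot> u) (t \<cdot> u)" "trm s (\<sigma> \<rightarrow> \<tau>)" "trm t (\<sigma> \<rightarrow> \<tau>)"
  shows "H \<Turnstile> Eq (\<sigma> \<rightarrow> \<tau>) s t"
proof -
  have "H \<Turnstile> All \<sigma> (Eq \<tau> (shift 0 s \<cdot> Var 0) (shift 0 t \<cdot> Var 0))"
    by (rule forces_AllI) (simp add: assms)
  then have "\<forall>\<^sub>F n in sequentially. map G [0..<n]; H \<turnstile> All \<sigma> (Eq \<tau> (shift 0 s \<cdot> Var 0) (shift 0 t \<cdot> Var 0))"
    and "world H" by (auto simp: forces_def)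
  moreover from this(1) tyof_has_ty[OF assms(2)] tyof_has_ty[OF assms(3)]
  have "\<forall>\<^sub>F n in sequentially. map G [0..<n]; H \<turnstile> Eq (\<sigma> \<rightarrow> \<tau>) s t"
    by eventually_elim (rule prv.Ext)
  ultimately show ?thesis using assms by (simp add: forces_def)
qed

lemma forces_ZeroSucc:
  assumes "H \<Turnstile> Eq Nt Zero (Succ t)"
  shows "H \<Turnstile> \<^bold>\<bottom>"
proof (rule forcesI[OF forces_world[OF assms(1)]])
  from forces_prv[OF assms] show "\<forall>\<^sub>F n in sequentially. map G [0..<n]; H \<turnstile> \<^bold>\<bottom>"
    by eventually_elim (rule prv.ZeroSucc)
qed simp

lemma forces_SuccInj:
  assumes "H \<Turnstile> Eq Nt (Succ s) (Succ t)"
  shows "H \<Turnstile> Eq Nt s t"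
proof (rule forcesI[OF forces_world[OF assms(1)]])
  show "wfe G (Eq Nt s t)" using forces_wfe[OF assms] by (auto split: if_splits)
  from forces_prv[OF assms] show "\<forall>\<^sub>F n in sequentially. map G [0..<n]; H \<turnstile> Eq Nt s t"
    by eventually_elim (rule prv.SuccInj)
qed

lemma fsubst_Succ: "fsubst 0 t (fsubst 0 (Succ (Var 0)) (fshift (Suc 0) \<phi>)) = fsubst 0 (Succ t) \<phi>"
proof -
  have "(\<lambda>i. sub (inst 0 t) (sub (inst 0 (Succ (Var 0))) (skip (Suc 0) i))) = inst 0 (Succ t)"
    by (auto simp: inst_def skip_def fun_eq_iff)
  then show ?thesis by (simp add: fsubst_eq_fsub fshift_eq_fsub fsub_fsub sub_sub)
qed

lemma fsubst_choice:
  "fsubst 0 t (fsubst (Suc 0) (shift 0 g) (fsubst 0 (Var (Suc 0) \<cdot> Var 0) (fshift (Suc (Suc 0)) \<phi>))) =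
    fsubst 0 (g \<cdot> t) (fsubst (Suc 0) (shift 0 t) \<phi>)"
proof -
  have "(\<lambda>i. sub (inst 0 t) (sub (inst (Suc 0) (shift 0 g))
          (sub (inst 0 (Var (Suc 0) \<cdot> Var 0)) (skip (Suc (Suc 0)) i)))) =
    (\<lambda>i. sub (inst 0 (g \<cdot> t)) (inst (Suc 0) (shift 0 t) i))" (is "?l = ?r")
  proof
    fix i
    consider "i = 0" | "i = 1" | j where "i = Suc (Suc j)"
      by (metis One_nat_def not0_implies_Suc)
    then show "?l i = ?r i"
      by cases (simp_all add: inst_def skip_def flip: subst_eq_sub)
  qed
  then show ?thesis by (simp add: fsubst_eq_fsub fshift_eq_fsub fsub_fsub sub_sub)
qed

lemma forces_Ind:
  assumes zero: "H \<Turnstile> fsubst 0 Zero \<phi>"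
    and Suc: "\<And>H' t. H \<preceq> H' \<Longrightarrow> trm t Nt \<Longrightarrow> H' \<Turnstile> fsubst 0 t \<phi> \<Longrightarrow> H' \<Turnstile> fsubst 0 (Succ t) \<phi>"
    and t: "trm t Nt"
  shows "H \<Turnstile> fsubst 0 t \<phi>"
proof -
  have wf: "wfe (case_nat Nt G) \<phi>" and wd: "world H"
    using zero by (auto simp: forces_def)
  have "H \<Turnstile> All Nt (\<phi> \<^bold>\<longrightarrow> fsubst 0 (Succ (Var 0)) (fshift 1 \<phi>))"
  proof (rule forces_AllI)
    fix t assume t: "trm t Nt"
    have "H \<Turnstile> fsubst 0 t \<phi> \<^bold>\<longrightarrow> fsubst 0 (Succ t) \<phi>"
      by (rule forces_ImpI) (use t wf wd Suc in auto)
    then show "H \<Turnstile> fsubst 0 t (\<phi> \<^bold>\<longrightarrow> fsubst 0 (Succ (Var 0)) (fshift 1 \<phi>))"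
      by (simp add: fsubst_Succ)
  qed
  then have "\<forall>\<^sub>F n in sequentially. map G [0..<n]; H \<turnstile> All Nt (\<phi> \<^bold>\<longrightarrow> fsubst 0 (Succ (Var 0)) (fshift 1 \<phi>))"
    "\<forall>\<^sub>F n in sequentially. map G [0..<n]; H \<turnstile> fsubst 0 Zero \<phi>"
    using zero by (simp_all add: forces_def)
  then have "\<forall>\<^sub>F n in sequentially. map G [0..<n]; H \<turnstile> All Nt \<phi>"
    by eventually_elim (rule prv.Ind)
  with wf wd have "H \<Turnstile> All Nt \<phi>" by (simp add: forces_def)
  from forces_AllE[OF this t] show ?thesis .
qed

text \<open>\<open>CC\<close> followed by elimination of the resulting existential statement. The
  formula \<open>\<phi>\<close> has the chosen value at index 0 and the argument at index 1, hence
  the substitution of \<open>t\<close> at \<open>Suc 0\<close>.\<close>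

lemma forces_CC:
  assumes "\<And>t. trm t Nt \<Longrightarrow> H \<Turnstile> Ex \<tau> (fsubst (Suc 0) (shift 0 t) \<phi>)"
    and "\<And>H' g. H \<preceq> H' \<Longrightarrow> trm g (Nt \<rightarrow> \<tau>) \<Longrightarrow>
      (\<And>t. trm t Nt \<Longrightarrow> H' \<Turnstile> fsubst 0 (g \<cdot> t) (fsubst (Suc 0) (shift 0 t) \<phi>)) \<Longrightarrow> H' \<Turnstile> \<chi>"
  shows "H \<Turnstile> \<chi>"
proof -
  let ?c = "All Nt (fsubst 0 (Var 1 \<cdot> Var 0) (fshift 2 \<phi>))"
  have all: "H \<Turnstile> All Nt (Ex \<tau> \<phi>)"
    by (rule forces_AllI) (simp add: assms(1))
  from forces_prv[OF all] have "\<forall>\<^sub>F n in sequentially. map G [0..<n]; H \<turnstile> Ex (Nt \<rightarrow> \<tau>) ?c"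
    by eventually_elim (rule prv.CC)
  moreover have "wfe G (Ex (Nt \<rightarrow> \<tau>) ?c)"
  proof -
    have "wfe (case_nat \<tau> (case_nat Nt G)) \<phi>" using forces_wfe[OF all] by simp
    then show ?thesis
      by (simp add: fsubst_eq_fsub fshift_eq_fsub fsub_fsub)
        (subst wfe_fsub[where e = "case_nat \<tau> (case_nat Nt G)"],
          auto simp: skip_def inst_def split: nat.split)
  qed
  ultimately have "H \<Turnstile> Ex (Nt \<rightarrow> \<tau>) ?c" using forces_world[OF all] by (simp add: forces_def)
  then show ?thesis
  proof (rule forces_ExE)
    fix H' g assume H': "H \<preceq> H'" "trm g (Nt \<rightarrow> \<tau>)" "H' \<Turnstile> fsubst 0 g ?c"
    show "H' \<Turnstile> \<chi>"
    proof (rule assms(2)[OF H'(1,2)])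
      fix t assume "trm t Nt"
      from forces_AllE[OF H'(3)[unfolded fsubst.simps] this]
      show "H' \<Turnstile> fsubst 0 (g \<cdot> t) (fsubst (Suc 0) (shift 0 t) \<phi>)"
        by (simp add: fsubst_choice numeral_2_eq_2)
    qed
  qed
qed

lemma forces_closed:
  assumes "{} \<Turnstile> \<phi>" "\<And>s. fsub s \<phi> = \<phi>"
  shows "[]; {} \<turnstile> \<phi>"
proof -
  from assms(1) obtain n where "map G [0..<n]; {} \<turnstile> \<phi>"
    by (auto simp: forces_def eventually_sequentially)
  from prv_strengthen[OF this assms(2)] show ?thesis .
qed

lemma forces_RecZero:
  assumes "trm a \<tau>" "trm f (Nt \<rightarrow> \<tau> \<rightarrow> \<tau>)" "world H"
  shows "H \<Turnstile> Eq \<tau> (Rec a f Zero) a"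
proof (rule forcesI[OF assms(3)])
  show "wfe G (Eq \<tau> (Rec a f Zero) a)" using assms by simp
  from tyof_has_ty[OF assms(1)] tyof_has_ty[OF assms(2)]
  show "\<forall>\<^sub>F n in sequentially. map G [0..<n]; H \<turnstile> Eq \<tau> (Rec a f Zero) a"
    by eventually_elim (rule prv.RecZero)
qed

lemma forces_RecSucc:
  assumes "trm a \<tau>" "trm f (Nt \<rightarrow> \<tau> \<rightarrow> \<tau>)" "trm n Nt" "world H"
  shows "H \<Turnstile> Eq \<tau> (Rec a f (Succ n)) (f \<cdot> n \<cdot> Rec a f n)"
proof (rule forcesI[OF assms(4)])
  show "wfe G (Eq \<tau> (Rec a f (Succ n)) (f \<cdot> n \<cdot> Rec a f n))" using assms by simp
  from tyof_has_ty[OF assms(1)] tyof_has_ty[OF assms(2)] tyof_has_ty[OF assms(3)]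
  show "\<forall>\<^sub>F m in sequentially. map G [0..<m]; H \<turnstile> Eq \<tau> (Rec a f (Succ n)) (f \<cdot> n \<cdot> Rec a f n)"
    by eventually_elim (rule prv.RecSucc)
qed

lemma forces_Beta:
  assumes "tyof (case_nat \<sigma> G) t = Some \<tau>" "trm u \<sigma>" "world H"
  shows "H \<Turnstile> Eq \<tau> (Lam \<sigma> t \<cdot> u) (subst 0 u t)"
proof (rule forcesI[OF assms(3)])
  have "wfe (case_nat \<sigma> G) (Eq \<tau> t t)" using assms by simp
  then have "wfe G (fsubst 0 u (Eq \<tau> t t))" using assms by (simp only: wfe_fsubst0)
  then show "wfe G (Eq \<tau> (Lam \<sigma> t \<cdot> u) (subst 0 u t))" using assms by simp
  have "\<forall>\<^sub>F n in sequentially. has_ty (map (case_nat \<sigma> G) [0..<Suc n]) t \<tau>"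
    using tyof_has_ty[OF assms(1)] by (subst eventually_sequentially_Suc)
  then show "\<forall>\<^sub>F n in sequentially. map G [0..<n]; H \<turnstile> Eq \<tau> (Lam \<sigma> t \<cdot> u) (subst 0 u t)"
    using tyof_has_ty[OF assms(2)] unfolding map_env_Suc by eventually_elim (rule prv.Beta)
qed

subsection \<open>Equality and order on the naturals\<close>

abbreviation eqn :: "tm \<Rightarrow> tm \<Rightarrow> fm" (infix "\<^bold>=" 50) where
  "s \<^bold>= t \<equiv> Eq Nt s t"

lemma extends_world: "H \<preceq> H' \<Longrightarrow> world H'"
  by (simp add: extends_def)

lemma eq_trm:
  assumes "H \<Turnstile> Eq \<tau> s t"
  shows "trm s \<tau>" "trm t \<tau>"
  using forces_wfe[OF assms] by auto

text \<open>This and the congruence rules below are instances of replacement in a formula whose hole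
  is index 0, with all other terms shifted past it.\<close>

lemma eq_sym: "H \<Turnstile> Eq \<tau> s t \<Longrightarrow> H \<Turnstile> Eq \<tau> t s"
  using forces_EqE[of H \<tau> s t "Eq \<tau> (Var 0) (shift 0 s)"]
  by (simp add: eq_trm forces_EqI forces_world)

lemma eq_trans [trans]: "H \<Turnstile> Eq \<tau> s t \<Longrightarrow> H \<Turnstile> Eq \<tau> t u \<Longrightarrow> H \<Turnstile> Eq \<tau> s u"
  using forces_EqE[of H \<tau> t u "Eq \<tau> (shift 0 s) (Var 0)"] by (simp add: eq_trm)

lemma eq_Succ: "H \<Turnstile> s \<^bold>= t \<Longrightarrow> H \<Turnstile> Succ s \<^bold>= Succ t"
  using forces_EqE[of H Nt s t "Succ (shift 0 s) \<^bold>= Succ (Var 0)"]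
  by (simp add: eq_trm forces_EqI forces_world)

lemma eq_fun: "H \<Turnstile> Eq (\<sigma> \<rightarrow> \<tau>) f g \<Longrightarrow> trm u \<sigma> \<Longrightarrow> H \<Turnstile> Eq \<tau> (f \<cdot> u) (g \<cdot> u)"
  using forces_EqE[of H "\<sigma> \<rightarrow> \<tau>" f g "Eq \<tau> (shift 0 f \<cdot> shift 0 u) (Var 0 \<cdot> shift 0 u)"]
  by (simp add: eq_trm forces_EqI forces_world)

lemma eq_arg: "H \<Turnstile> Eq \<sigma> s t \<Longrightarrow> trm f (\<sigma> \<rightarrow> \<tau>) \<Longrightarrow> H \<Turnstile> Eq \<tau> (f \<cdot> s) (f \<cdot> t)"
  using forces_EqE[of H \<sigma> s t "Eq \<tau> (shift 0 f \<cdot> shift 0 s) (shift 0 f \<cdot> Var 0)"]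
  by (simp add: eq_trm forces_EqI forces_world)

lemma forces_absurd: "H \<Turnstile> Succ t \<^bold>= Zero \<Longrightarrow> H \<Turnstile> \<^bold>\<bottom>"
  by (blast intro: forces_ZeroSucc eq_sym)

lemma tyof_plus [simp]:
  "tyof e (plus_tm s t) = (if tyof e s = Some Nt \<and> tyof e t = Some Nt then Some Nt else None)"
  by (auto simp: plus_tm_def split: option.splits)

lemma shift_plus [simp]: "shift k (plus_tm s t) = plus_tm (shift k s) (shift k t)"
  by (simp add: plus_tm_def)

lemma subst_plus [simp]: "subst k u (plus_tm s t) = plus_tm (subst k u s) (subst k u t)"
  by (simp add: plus_tm_def)

lemma wfe_Le [simp]: "wfe e (s \<^bold>\<le> t) \<longleftrightarrow> tyof e s = Some Nt \<and> tyof e t = Some Nt"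
  by (auto simp: Le_def)

lemma fshift_Le [simp]: "fshift k (s \<^bold>\<le> t) = (shift k s \<^bold>\<le> shift k t)"
  by (simp add: Le_def)

lemma fsubst_Le [simp]: "fsubst k u (s \<^bold>\<le> t) = (subst k u s \<^bold>\<le> subst k u t)"
  by (simp add: Le_def)

lemma plus_Zero: "trm s Nt \<Longrightarrow> world H \<Longrightarrow> H \<Turnstile> plus_tm s Zero \<^bold>= s"
  unfolding plus_tm_def by (rule forces_RecZero) auto

lemma plus_Succ:
  assumes "trm s Nt" "trm t Nt" "world H"
  shows "H \<Turnstile> plus_tm s (Succ t) \<^bold>= Succ (plus_tm s t)"
proof -
  let ?f = "Lam Nt (Lam Nt (Succ (Var 0)))"
  have "H \<Turnstile> plus_tm s (Succ t) \<^bold>= ?f \<cdot> t \<cdot> plus_tm s t"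
    unfolding plus_tm_def by (rule forces_RecSucc) (use assms in auto)
  also have "H \<Turnstile> ?f \<cdot> t \<cdot> plus_tm s t \<^bold>= Lam Nt (Succ (Var 0)) \<cdot> plus_tm s t"
    using forces_Beta[of Nt "Lam Nt (Succ (Var 0))" Seq t H] assms by (auto intro: eq_fun)
  also have "H \<Turnstile> Lam Nt (Succ (Var 0)) \<cdot> plus_tm s t \<^bold>= Succ (plus_tm s t)"
    using forces_Beta[of Nt "Succ (Var 0)" Nt "plus_tm s t" H] assms by auto
  finally show ?thesis .
qed

lemma eq_plus_left: "H \<Turnstile> s \<^bold>= t \<Longrightarrow> trm u Nt \<Longrightarrow> H \<Turnstile> plus_tm s u \<^bold>= plus_tm t u"
  using forces_EqE[of H Nt s t "plus_tm (shift 0 s) (shift 0 u) \<^bold>= plus_tm (Var 0) (shift 0 u)"]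
  by (simp add: eq_trm forces_EqI forces_world)

lemma eq_plus_right: "H \<Turnstile> s \<^bold>= t \<Longrightarrow> trm u Nt \<Longrightarrow> H \<Turnstile> plus_tm u s \<^bold>= plus_tm u t"
  using forces_EqE[of H Nt s t "plus_tm (shift 0 u) (shift 0 s) \<^bold>= plus_tm (shift 0 u) (Var 0)"]
  by (simp add: eq_trm forces_EqI forces_world)

text \<open>\<open>plus_tm\<close> recurses on its right argument, so laws about a zero or successor
  on the left need induction.\<close>

lemma Zero_plus:
  assumes "trm n Nt" "world H"
  shows "H \<Turnstile> plus_tm Zero n \<^bold>= n"
proof -
  have "H \<Turnstile> fsubst 0 n (plus_tm Zero (Var 0) \<^bold>= Var 0)"
  proof (rule forces_Ind[OF _ _ assms(1)])
    show "H \<Turnstile> fsubst 0 Zero (plus_tm Zero (Var 0) \<^bold>= Var 0)"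
      using assms by (simp add: plus_Zero)
    fix H' t assume H': "H \<preceq> H'" "trm t Nt" "H' \<Turnstile> fsubst 0 t (plus_tm Zero (Var 0) \<^bold>= Var 0)"
    have "H' \<Turnstile> plus_tm Zero (Succ t) \<^bold>= Succ (plus_tm Zero t)"
      using H' by (auto intro: plus_Succ extends_world)
    also have "H' \<Turnstile> Succ (plus_tm Zero t) \<^bold>= Succ t"
      using H'(3) by (auto intro: eq_Succ)
    finally show "H' \<Turnstile> fsubst 0 (Succ t) (plus_tm Zero (Var 0) \<^bold>= Var 0)" by simp
  qed
  then show ?thesis by simp
qed

lemma Succ_plus:
  assumes "trm m Nt" "trm n Nt" "world H"
  shows "H \<Turnstile> plus_tm (Succ m) n \<^bold>= Succ (plus_tm m n)"
proof -
  let ?\<phi> = "plus_tm (Succ (shift 0 m)) (Var 0) \<^bold>= Succ (plus_tm (shift 0 m) (Var 0))"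
  have "H \<Turnstile> fsubst 0 n ?\<phi>"
  proof (rule forces_Ind[OF _ _ assms(2)])
    have "H \<Turnstile> plus_tm (Succ m) Zero \<^bold>= Succ m"
      using assms by (auto intro: plus_Zero)
    also have "H \<Turnstile> Succ m \<^bold>= Succ (plus_tm m Zero)"
      using assms by (auto intro: eq_Succ eq_sym plus_Zero)
    finally show "H \<Turnstile> fsubst 0 Zero ?\<phi>" by simp
    fix H' t assume H': "H \<preceq> H'" "trm t Nt" "H' \<Turnstile> fsubst 0 t ?\<phi>"
    note w = extends_world[OF H'(1)]
    have "H' \<Turnstile> plus_tm (Succ m) (Succ t) \<^bold>= Succ (plus_tm (Succ m) t)"
      using H' assms w by (auto intro: plus_Succ)
    also have "H' \<Turnstile> Succ (plus_tm (Succ m) t) \<^bold>= Succ (Succ (plus_tm m t))"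
      using H'(3) by (auto intro: eq_Succ)
    also have "H' \<Turnstile> Succ (Succ (plus_tm m t)) \<^bold>= Succ (plus_tm m (Succ t))"
      using H' assms w by (auto intro: eq_Succ eq_sym plus_Succ)
    finally show "H' \<Turnstile> fsubst 0 (Succ t) ?\<phi>" by simp
  qed
  then show ?thesis by simp
qed

lemma plus_assoc:
  assumes "trm a Nt" "trm b Nt" "trm c Nt" "world H"
  shows "H \<Turnstile> plus_tm (plus_tm a b) c \<^bold>= plus_tm a (plus_tm b c)"
proof -
  let ?\<phi> = "plus_tm (plus_tm (shift 0 a) (shift 0 b)) (Var 0) \<^bold>=
    plus_tm (shift 0 a) (plus_tm (shift 0 b) (Var 0))"
  have "H \<Turnstile> fsubst 0 c ?\<phi>"
  proof (rule forces_Ind[OF _ _ assms(3)])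
    have "H \<Turnstile> plus_tm (plus_tm a b) Zero \<^bold>= plus_tm a b"
      using assms by (auto intro: plus_Zero)
    also have "H \<Turnstile> plus_tm a b \<^bold>= plus_tm a (plus_tm b Zero)"
      using assms by (auto intro: eq_plus_right eq_sym plus_Zero)
    finally show "H \<Turnstile> fsubst 0 Zero ?\<phi>" by simp
    fix H' t assume H': "H \<preceq> H'" "trm t Nt" "H' \<Turnstile> fsubst 0 t ?\<phi>"
    note w = extends_world[OF H'(1)]
    have "H' \<Turnstile> plus_tm (plus_tm a b) (Succ t) \<^bold>= Succ (plus_tm (plus_tm a b) t)"
      using H' assms w by (auto intro: plus_Succ)
    also have "H' \<Turnstile> Succ (plus_tm (plus_tm a b) t) \<^bold>= Succ (plus_tm a (plus_tm b t))"
      using H'(3) by (auto intro: eq_Succ)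
    also have "H' \<Turnstile> Succ (plus_tm a (plus_tm b t)) \<^bold>= plus_tm a (Succ (plus_tm b t))"
      by (rule eq_sym[OF plus_Succ]) (use H' assms w in auto)
    also have "H' \<Turnstile> plus_tm a (Succ (plus_tm b t)) \<^bold>= plus_tm a (plus_tm b (Succ t))"
      using H' assms w by (auto intro: eq_plus_right eq_sym plus_Succ)
    finally show "H' \<Turnstile> fsubst 0 (Succ t) ?\<phi>" by simp
  qed
  then show ?thesis by simp
qed

lemma nat_cases [consumes 2, case_names Zero Succ]:
  assumes "trm t Nt" "world H"
    and Z: "\<And>H'. H \<preceq> H' \<Longrightarrow> H' \<Turnstile> t \<^bold>= Zero \<Longrightarrow> H' \<Turnstile> \<chi>"
    and S: "\<And>H' m. H \<preceq> H' \<Longrightarrow> trm m Nt \<Longrightarrow> H' \<Turnstile> t \<^bold>= Succ m \<Longrightarrow> H' \<Turnstile> \<chi>"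
  shows "H \<Turnstile> \<chi>"
proof -
  let ?\<phi> = "Var 0 \<^bold>= Zero \<^bold>\<or> Ex Nt (Var 1 \<^bold>= Succ (Var 0))"
  have "H \<Turnstile> fsubst 0 t ?\<phi>"
  proof (rule forces_Ind[OF _ _ assms(1)])
    show "H \<Turnstile> fsubst 0 Zero ?\<phi>"
      using assms by (auto intro!: forces_OrI1 forces_EqI)
    fix H' n assume H': "H \<preceq> H'" "trm n Nt"
    have "H' \<Turnstile> Ex Nt (Succ (shift 0 n) \<^bold>= Succ (Var 0))"
      by (rule forces_ExI[of _ n]) (use H' in \<open>auto intro: forces_EqI extends_world\<close>)
    then show "H' \<Turnstile> fsubst 0 (Succ n) ?\<phi>"
      using H' by (auto intro!: forces_OrI2)
  qed
  then have "H \<Turnstile> t \<^bold>= Zero \<^bold>\<or> Ex Nt (shift 0 t \<^bold>= Succ (Var 0))" by simp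
  then show ?thesis
  proof (cases rule: forces_OrE)
    case (right H')
    from right(2) show "H' \<Turnstile> \<chi>"
      by (rule forces_ExE) (rule S[OF extends_trans[OF right(1)]], auto)
  qed (rule Z)
qed

section \<open>The order on the numbers\<close>

lemma leI: "H \<Turnstile> plus_tm s z \<^bold>= t \<Longrightarrow> H \<Turnstile> s \<^bold>\<le> t"
  unfolding Le_def using eq_trm[of H Nt "plus_tm s z" t]
  by (intro forces_ExI[of _ z]) (auto split: if_splits)

lemma leE:
  assumes "H \<Turnstile> s \<^bold>\<le> t"
    and "\<And>H' z. H \<preceq> H' \<Longrightarrow> trm z Nt \<Longrightarrow> H' \<Turnstile> plus_tm s z \<^bold>= t \<Longrightarrow> H' \<Turnstile> \<chi>"
  shows "H \<Turnstile> \<chi>"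
  using assms(1) unfolding Le_def by (rule forces_ExE) (simp add: assms(2))

lemma le_trm:
  assumes "H \<Turnstile> s \<^bold>\<le> t"
  shows "trm s Nt" "trm t Nt"
  using forces_wfe[OF assms] by simp_all

lemma eq_le: "H \<Turnstile> s \<^bold>= t \<Longrightarrow> H \<Turnstile> s \<^bold>\<le> t"
  by (rule leI[of _ _ Zero]) (blast intro: eq_trans plus_Zero eq_trm forces_world)

lemma le_refl: "trm s Nt \<Longrightarrow> world H \<Longrightarrow> H \<Turnstile> s \<^bold>\<le> s"
  by (simp add: eq_le forces_EqI)

lemma Zero_le: "trm s Nt \<Longrightarrow> world H \<Longrightarrow> H \<Turnstile> Zero \<^bold>\<le> s"
  by (rule leI, rule Zero_plus)

lemma le_trans [trans]:
  assumes "H \<Turnstile> s \<^bold>\<le> t" "H \<Turnstile> t \<^bold>\<le> u"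
  shows "H \<Turnstile> s \<^bold>\<le> u"
  using assms(1)
proof (rule leE)
  fix H' z assume H': "H \<preceq> H'" "trm z Nt" "H' \<Turnstile> plus_tm s z \<^bold>= t"
  from forces_mono[OF assms(2) H'(1)] show "H' \<Turnstile> s \<^bold>\<le> u"
  proof (rule leE)
    fix H'' y assume H'': "H' \<preceq> H''" "trm y Nt" "H'' \<Turnstile> plus_tm t y \<^bold>= u"
    have "H'' \<Turnstile> plus_tm s (plus_tm z y) \<^bold>= plus_tm (plus_tm s z) y"
      using H' H'' assms by (auto intro: eq_sym plus_assoc extends_world le_trm)
    also have "H'' \<Turnstile> plus_tm (plus_tm s z) y \<^bold>= plus_tm t y"
      using H'' forces_mono[OF H'(3) H''(1)] by (auto intro: eq_plus_left)
    also note H''(3)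
    finally show "H'' \<Turnstile> s \<^bold>\<le> u" by (rule leI)
  qed
qed

lemma le_Succ: "trm s Nt \<Longrightarrow> world H \<Longrightarrow> H \<Turnstile> s \<^bold>\<le> Succ s"
  by (rule leI[of _ _ One], rule eq_trans, rule plus_Succ) (auto intro: eq_Succ plus_Zero)

lemma Succ_le_Succ: "H \<Turnstile> s \<^bold>\<le> t \<Longrightarrow> H \<Turnstile> Succ s \<^bold>\<le> Succ t"
  by (erule leE, rule leI, rule eq_trans, rule Succ_plus)
    (auto dest: eq_trm split: if_splits intro: eq_Succ extends_world)

lemma Succ_le_SuccD:
  assumes "H \<Turnstile> Succ s \<^bold>\<le> Succ t"
  shows "H \<Turnstile> s \<^bold>\<le> t"
  using assms
proof (rule leE)
  fix H' z assume H': "H \<preceq> H'" "trm z Nt" "H' \<Turnstile> plus_tm (Succ s) z \<^bold>= Succ t"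
  have "trm s Nt" using le_trm[OF assms] by (auto split: if_splits)
  then have "H' \<Turnstile> Succ (plus_tm s z) \<^bold>= plus_tm (Succ s) z"
    using H' by (auto intro: eq_sym Succ_plus extends_world)
  also note H'(3)
  finally show "H' \<Turnstile> s \<^bold>\<le> t" by (blast intro: leI forces_SuccInj)
qed

text \<open>The split is on whether the difference \<open>z\<close> is zero or a successor. Here and
  everywhere below, strict inequality is expressed by a \<open>Succ\<close> on the smaller
  side.\<close>

lemma le_cases:
  assumes "H \<Turnstile> s \<^bold>\<le> t"
    and eq: "\<And>H'. H \<preceq> H' \<Longrightarrow> H' \<Turnstile> s \<^bold>= t \<Longrightarrow> H' \<Turnstile> \<chi>"
    and lt: "\<And>H'. H \<preceq> H' \<Longrightarrow> H' \<Turnstile> Succ s \<^bold>\<le> t \<Longrightarrow> H' \<Turnstile> \<chi>"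
  shows "H \<Turnstile> \<chi>"
  using assms(1)
proof (rule leE)
  fix H1 z assume H1: "H \<preceq> H1" "trm z Nt" "H1 \<Turnstile> plus_tm s z \<^bold>= t"
  have s: "trm s Nt" by (rule le_trm[OF assms(1)])
  from H1(2) extends_world[OF H1(1)] show "H1 \<Turnstile> \<chi>"
  proof (cases rule: nat_cases)
    case (Zero H2)
    have "H2 \<Turnstile> s \<^bold>= plus_tm s Zero"
      using s Zero by (auto intro: eq_sym plus_Zero extends_world)
    also have "H2 \<Turnstile> plus_tm s Zero \<^bold>= plus_tm s z"
      using s Zero by (auto intro: eq_sym eq_plus_right)
    also have "H2 \<Turnstile> plus_tm s z \<^bold>= t" using forces_mono[OF H1(3) Zero(1)] .
    finally show "H2 \<Turnstile> \<chi>" by (rule eq[OF extends_trans[OF H1(1) Zero(1)]])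
  next
    case (Succ H2 m)
    have "H2 \<Turnstile> plus_tm (Succ s) m \<^bold>= Succ (plus_tm s m)"
      using s Succ by (auto intro: Succ_plus extends_world)
    also have "H2 \<Turnstile> Succ (plus_tm s m) \<^bold>= plus_tm s (Succ m)"
      using s Succ by (auto intro: eq_sym plus_Succ extends_world)
    also have "H2 \<Turnstile> plus_tm s (Succ m) \<^bold>= plus_tm s z"
      using s Succ by (auto intro: eq_sym eq_plus_right)
    also have "H2 \<Turnstile> plus_tm s z \<^bold>= t" using forces_mono[OF H1(3) Succ(1)] .
    finally have "H2 \<Turnstile> Succ s \<^bold>\<le> t" by (rule leI)
    then show "H2 \<Turnstile> \<chi>" by (rule lt[OF extends_trans[OF H1(1) Succ(1)]])
  qed
qed

lemma Succ_le_Zero: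
  assumes "H \<Turnstile> Succ s \<^bold>\<le> Zero"
  shows "H \<Turnstile> \<^bold>\<bottom>"
  using assms
proof (rule leE)
  fix H' z assume H': "H \<preceq> H'" "trm z Nt" "H' \<Turnstile> plus_tm (Succ s) z \<^bold>= Zero"
  have "trm s Nt" using le_trm[OF assms] by (auto split: if_splits)
  then have "H' \<Turnstile> Succ (plus_tm s z) \<^bold>= plus_tm (Succ s) z"
    using H' by (auto intro: eq_sym Succ_plus extends_world)
  also note H'(3)
  finally show "H' \<Turnstile> \<^bold>\<bottom>" by (rule forces_absurd)
qed

text \<open>The decidability of the order in \<open>Dec_Le\<close> and the later comparisons of two
  arbitrary indices go back to this.\<close>

lemma le_linear:
  assumes "trm s Nt" "trm t Nt" "world H"
  shows "H \<Turnstile> s \<^bold>\<le> t \<^bold>\<or> Succ t \<^bold>\<le> s"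
proof -
  let ?\<phi> = "shift 0 s \<^bold>\<le> Var 0 \<^bold>\<or> Succ (Var 0) \<^bold>\<le> shift 0 s"
  have "H \<Turnstile> fsubst 0 t ?\<phi>"
  proof (rule forces_Ind[OF _ _ assms(2)])
    from assms(1,3) show "H \<Turnstile> fsubst 0 Zero ?\<phi>"
    proof (cases rule: nat_cases)
      case (Zero H')
      then show "H' \<Turnstile> fsubst 0 Zero ?\<phi>" using assms by (auto intro!: forces_OrI1 eq_le)
    next
      case (Succ H' m)
      have "H' \<Turnstile> One \<^bold>\<le> Succ m" using Succ by (auto intro: Succ_le_Succ Zero_le extends_world)
      then have "H' \<Turnstile> One \<^bold>\<le> s" using Succ by (blast intro: le_trans eq_le eq_sym)
      then show "H' \<Turnstile> fsubst 0 Zero ?\<phi>" using assms by (auto intro!: forces_OrI2)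
    qed
    fix H' t assume H': "H \<preceq> H'" "trm t Nt" "H' \<Turnstile> fsubst 0 t ?\<phi>"
    from H'(3) have "H' \<Turnstile> s \<^bold>\<le> t \<^bold>\<or> Succ t \<^bold>\<le> s" by simp
    then show "H' \<Turnstile> fsubst 0 (Succ t) ?\<phi>"
    proof (cases rule: forces_OrE)
      case (left H2)
      then have "H2 \<Turnstile> s \<^bold>\<le> Succ t"
        using H' by (blast intro: le_trans le_Succ extends_world)
      then show "H2 \<Turnstile> fsubst 0 (Succ t) ?\<phi>" using assms H' by (auto intro!: forces_OrI1)
    next
      case (right H2)
      from right(2) show "H2 \<Turnstile> fsubst 0 (Succ t) ?\<phi>"
      proof (rule le_cases)
        fix H3 assume "H3 \<Turnstile> Succ t \<^bold>= s"
        then show "H3 \<Turnstile> fsubst 0 (Succ t) ?\<phi>"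
          using assms H' by (auto intro!: forces_OrI1 eq_le intro: eq_sym)
      next
        fix H3 assume "H3 \<Turnstile> Succ (Succ t) \<^bold>\<le> s"
        then show "H3 \<Turnstile> fsubst 0 (Succ t) ?\<phi>"
          using assms H' by (auto intro!: forces_OrI2)
      qed
    qed
  qed
  then show ?thesis by simp
qed

lemma Succ_le_self:
  assumes "H \<Turnstile> Succ s \<^bold>\<le> s"
  shows "H \<Turnstile> \<^bold>\<bottom>"
proof -
  have s: "trm s Nt" by (rule le_trm[OF assms])
  have "H \<Turnstile> fsubst 0 s (\<^bold>\<not> Succ (Var 0) \<^bold>\<le> Var 0)"
  proof (rule forces_Ind[OF _ _ s])
    show "H \<Turnstile> fsubst 0 Zero (\<^bold>\<not> Succ (Var 0) \<^bold>\<le> Var 0)"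
      using assms by (auto intro!: forces_ImpI Succ_le_Zero forces_world)
    fix H' t assume H': "H \<preceq> H'" "trm t Nt" "H' \<Turnstile> fsubst 0 t (\<^bold>\<not> Succ (Var 0) \<^bold>\<le> Var 0)"
    then show "H' \<Turnstile> fsubst 0 (Succ t) (\<^bold>\<not> Succ (Var 0) \<^bold>\<le> Var 0)"
      by (auto intro!: forces_ImpI extends_world[OF H'(1)])
        (blast intro: forces_ImpE forces_mono Succ_le_SuccD)
  qed
  then show ?thesis using assms by (auto intro: forces_ImpE)
qed

subsection \<open>Decidable formulas\<close>

abbreviation Dec :: "fm \<Rightarrow> fm" where
  "Dec \<phi> \<equiv> \<phi> \<^bold>\<or> \<^bold>\<not> \<phi>"

lemma fsubst_Suc_fshift [simp]:
  "fsubst (Suc k) (shift 0 t) (fshift 0 \<phi>) = fshift 0 (fsubst k t \<phi>)"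
  by (simp add: fsubst_eq_fsub fsub_up_fshift flip: up_inst)

lemma Dec_Zero:
  assumes "trm t Nt" "world H"
  shows "H \<Turnstile> Dec (t \<^bold>= Zero)"
  using assms
proof (cases rule: nat_cases)
  case (Zero H')
  then show "H' \<Turnstile> Dec (t \<^bold>= Zero)"
    using assms by (auto intro: forces_OrI1)
next
  case (Succ H' m)
  have "H' \<Turnstile> \<^bold>\<not> t \<^bold>= Zero"
  proof (rule forces_ImpI)
    fix H'' assume H'': "H' \<preceq> H''" "H'' \<Turnstile> t \<^bold>= Zero"
    have "H'' \<Turnstile> Succ m \<^bold>= Zero"
      using forces_mono[OF Succ(3) H''(1)] H''(2) by (blast intro: eq_trans eq_sym)
    then show "H'' \<Turnstile> \<^bold>\<bottom>" by (rule forces_absurd)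
  qed (use Succ assms in \<open>auto intro: extends_world\<close>)
  then show "H' \<Turnstile> Dec (t \<^bold>= Zero)"
    using assms by (auto intro: forces_OrI2)
qed

lemma Dec_Le:
  assumes "trm s Nt" "trm t Nt" "world H"
  shows "H \<Turnstile> Dec (s \<^bold>\<le> t)"
  using le_linear[OF assms]
proof (cases rule: forces_OrE)
  case (left H')
  then show "H' \<Turnstile> Dec (s \<^bold>\<le> t)" using assms by (auto intro: forces_OrI1)
next
  case (right H')
  have "H' \<Turnstile> \<^bold>\<not> s \<^bold>\<le> t"
  proof (rule forces_ImpI)
    fix H'' assume "H' \<preceq> H''" "H'' \<Turnstile> s \<^bold>\<le> t"
    then show "H'' \<Turnstile> \<^bold>\<bottom>"
      using right(2) by (blast intro: le_trans forces_mono Succ_le_self)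
  qed (use right assms in \<open>auto intro: extends_world\<close>)
  then show "H' \<Turnstile> Dec (s \<^bold>\<le> t)" using assms by (auto intro: forces_OrI2)
qed

lemma Dec_And:
  assumes "H \<Turnstile> Dec \<phi>" "H \<Turnstile> Dec \<psi>"
  shows "H \<Turnstile> Dec (\<phi> \<^bold>\<and> \<psi>)"
proof -
  have wf: "wfe G \<phi>" "wfe G \<psi>" using assms[THEN forces_wfe] by auto
  from assms(1) show ?thesis
  proof (cases rule: forces_OrE)
    case (left H1)
    from forces_mono[OF assms(2) left(1)] show "H1 \<Turnstile> Dec (\<phi> \<^bold>\<and> \<psi>)"
    proof (cases rule: forces_OrE)
      case l: (left H2)
      then show "H2 \<Turnstile> Dec (\<phi> \<^bold>\<and> \<psi>)"
        using forces_mono[OF left(2) l(1)] wf by (auto intro: forces_OrI1 simp: forces_And)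
    next
      case (right H2)
      have "H2 \<Turnstile> \<^bold>\<not> (\<phi> \<^bold>\<and> \<psi>)"
        by (rule forces_ImpI)
          (use right wf in \<open>auto simp: forces_And intro: extends_world forces_ImpE forces_mono\<close>)
      then show "H2 \<Turnstile> Dec (\<phi> \<^bold>\<and> \<psi>)" using wf by (auto intro: forces_OrI2)
    qed
  next
    case (right H1)
    have "H1 \<Turnstile> \<^bold>\<not> (\<phi> \<^bold>\<and> \<psi>)"
      by (rule forces_ImpI)
        (use right wf in \<open>auto simp: forces_And intro: extends_world forces_ImpE forces_mono\<close>)
    then show "H1 \<Turnstile> Dec (\<phi> \<^bold>\<and> \<psi>)" using wf by (auto intro: forces_OrI2)
  qed
qed

lemma Dec_Neg:
  assumes "H \<Turnstile> Dec \<phi>"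
  shows "H \<Turnstile> Dec (\<^bold>\<not> \<phi>)"
proof -
  have wf: "wfe G \<phi>" using assms[THEN forces_wfe] by auto
  from assms show ?thesis
  proof (cases rule: forces_OrE)
    case (left H1)
    have "H1 \<Turnstile> \<^bold>\<not> (\<^bold>\<not> \<phi>)"
      by (rule forces_ImpI)
        (use left wf in \<open>auto intro: extends_world forces_ImpE forces_mono\<close>)
    then show "H1 \<Turnstile> Dec (\<^bold>\<not> \<phi>)" using wf by (auto intro: forces_OrI2)
  next
    case (right H1)
    then show "H1 \<Turnstile> Dec (\<^bold>\<not> \<phi>)" using wf by (auto intro: forces_OrI1)
  qed
qed

section \<open>Bounded quantifiers and bounded search\<close>

definition bex :: "tm \<Rightarrow> fm \<Rightarrow> fm" where
  "bex n \<phi> = Ex Nt (Succ (Var 0) \<^bold>\<le> shift 0 n \<^bold>\<and> \<phi>)"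

definition bnone :: "tm \<Rightarrow> fm \<Rightarrow> fm" where
  "bnone n \<phi> = All Nt (Succ (Var 0) \<^bold>\<le> shift 0 n \<^bold>\<longrightarrow> \<^bold>\<not> \<phi>)"

lemma wfe_bex [simp]: "wfe e (bex n \<phi>) \<longleftrightarrow> tyof e n = Some Nt \<and> wfe (case_nat Nt e) \<phi>"
  by (auto simp: bex_def)

lemma wfe_bnone [simp]: "wfe e (bnone n \<phi>) \<longleftrightarrow> tyof e n = Some Nt \<and> wfe (case_nat Nt e) \<phi>"
  by (auto simp: bnone_def)

lemma fsubst_bex [simp]:
  "fsubst k u (bex n \<phi>) = bex (subst k u n) (fsubst (Suc k) (shift 0 u) \<phi>)"
  by (simp add: bex_def)

lemma fsubst_bnone [simp]:
  "fsubst k u (bnone n \<phi>) = bnone (subst k u n) (fsubst (Suc k) (shift 0 u) \<phi>)"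
  by (simp add: bnone_def)

lemma bexI: 
  "H \<Turnstile> Succ m \<^bold>\<le> n \<Longrightarrow> H \<Turnstile> fsubst 0 m \<phi> \<Longrightarrow> wfe (case_nat Nt G) \<phi> \<Longrightarrow> H \<Turnstile> bex n \<phi>"
  unfolding bex_def
  by (rule forces_ExI[of _ m]) (auto simp: forces_And dest: forces_wfe split: if_splits)

lemma bexE:
  assumes "H \<Turnstile> bex n \<phi>"
    "\<And>H' m. H \<preceq> H' \<Longrightarrow> trm m Nt \<Longrightarrow> H' \<Turnstile> Succ m \<^bold>\<le> n \<Longrightarrow> H' \<Turnstile> fsubst 0 m \<phi> \<Longrightarrow> H' \<Turnstile> \<chi>"
  shows "H \<Turnstile> \<chi>"
  using assms(1) unfolding bex_def by (rule forces_ExE) (auto simp: forces_And intro: assms(2))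

lemma bnoneI:
  assumes "\<And>H' m. H \<preceq> H' \<Longrightarrow> trm m Nt \<Longrightarrow> H' \<Turnstile> Succ m \<^bold>\<le> n \<Longrightarrow> H' \<Turnstile> fsubst 0 m \<phi> \<Longrightarrow> H' \<Turnstile> \<^bold>\<bottom>"
    "world H" "trm n Nt" "wfe (case_nat Nt G) \<phi>"
  shows "H \<Turnstile> bnone n \<phi>"
  unfolding bnone_def
proof (rule forces_AllI)
  fix m assume m: "trm m Nt"
  have "H \<Turnstile> Succ m \<^bold>\<le> n \<^bold>\<longrightarrow> \<^bold>\<not> fsubst 0 m \<phi>"
  proof (rule forces_ImpI)
    fix H1 assume H1: "H \<preceq> H1" "H1 \<Turnstile> Succ m \<^bold>\<le> n"
    show "H1 \<Turnstile> \<^bold>\<not> fsubst 0 m \<phi>"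
    proof (rule forces_ImpI)
      fix H2 assume H2: "H1 \<preceq> H2" "H2 \<Turnstile> fsubst 0 m \<phi>"
      show "H2 \<Turnstile> \<^bold>\<bottom>"
        by (rule assms(1)[OF extends_trans[OF H1(1) H2(1)] m forces_mono[OF H1(2) H2(1)] H2(2)])
    qed (use H1 m assms in \<open>auto intro: extends_world\<close>)
  qed (use m assms in auto)
  then show "H \<Turnstile> fsubst 0 m (Succ (Var 0) \<^bold>\<le> shift 0 n \<^bold>\<longrightarrow> \<^bold>\<not> \<phi>)" by simp
qed

lemma bnoneD: "H \<Turnstile> bnone n \<phi> \<Longrightarrow> H \<Turnstile> Succ m \<^bold>\<le> n \<Longrightarrow> H \<Turnstile> fsubst 0 m \<phi> \<Longrightarrow> H \<Turnstile> \<^bold>\<bottom>"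
  unfolding bnone_def
  by (drule forces_AllE[of _ _ _ m]) 
    (auto dest: forces_wfe forces_ImpE split: if_splits)

text \<open>Induction on the bound: with nothing found below \<open>t\<close>, decide
  \<open>\<phi>\<close> at \<open>t\<close>. An index below \<open>Succ t\<close> is either equal to
  \<open>t\<close> or below it, so two refutations cover all cases.\<close>

lemma bounded_search:
  assumes dec: "\<And>m. trm m Nt \<Longrightarrow> H \<Turnstile> Dec (fsubst 0 m \<phi>)"
    and wf: "wfe (case_nat Nt G) \<phi>" and n: "trm n Nt"
  shows "H \<Turnstile> bnone n \<phi> \<^bold>\<or> bex n \<phi>"
proof -
  have w: "world H" using forces_world[OF dec[of Zero]] by simp
  let ?\<phi> = "bnone (Var 0) (fshift (Suc 0) \<phi>) \<^bold>\<or> bex (Var 0) (fshift (Suc 0) \<phi>)"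
  have "H \<Turnstile> fsubst 0 n ?\<phi>"
  proof (rule forces_Ind[OF _ _ n])
    have "H \<Turnstile> bnone Zero \<phi>"
      by (rule bnoneI) (use wf w in \<open>auto intro: Succ_le_Zero\<close>)
    then show "H \<Turnstile> fsubst 0 Zero ?\<phi>" using wf by (auto intro: forces_OrI1)
  next
    fix H1 t assume H1: "H \<preceq> H1" and t: "trm t Nt" and IH: "H1 \<Turnstile> fsubst 0 t ?\<phi>"
    from IH have "H1 \<Turnstile> bnone t \<phi> \<^bold>\<or> bex t \<phi>" by simp
    then have "H1 \<Turnstile> bnone (Succ t) \<phi> \<^bold>\<or> bex (Succ t) \<phi>"
    proof (cases rule: forces_OrE)
      case (left H2)
      from forces_mono[OF dec[OF t] extends_trans[OF H1 left(1)]]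
      show "H2 \<Turnstile> bnone (Succ t) \<phi> \<^bold>\<or> bex (Succ t) \<phi>"
      proof (cases rule: forces_OrE)
        case l: (left H3)
        have "H3 \<Turnstile> bex (Succ t) \<phi>"
          by (rule bexI[of _ t]) (use l t wf in \<open>auto intro: le_refl extends_world\<close>)
        then show "H3 \<Turnstile> bnone (Succ t) \<phi> \<^bold>\<or> bex (Succ t) \<phi>"
          using t wf by (auto intro: forces_OrI2)
      next
        case (right H3)
        have "H3 \<Turnstile> bnone (Succ t) \<phi>"
        proof (rule bnoneI)
          fix H4 m assume H4: "H3 \<preceq> H4" "trm m Nt" "H4 \<Turnstile> Succ m \<^bold>\<le> Succ t" "H4 \<Turnstile> fsubst 0 m \<phi>"
          from H4(3) have "H4 \<Turnstile> m \<^bold>\<le> t" by (rule Succ_le_SuccD)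
          then show "H4 \<Turnstile> \<^bold>\<bottom>"
          proof (rule le_cases)
            fix H5 assume H5: "H4 \<preceq> H5" "H5 \<Turnstile> m \<^bold>= t"
            have "H5 \<Turnstile> fsubst 0 t \<phi>"
              using H5(2) forces_mono[OF H4(4) H5(1)] wf by (rule forces_EqE)
            moreover have "H5 \<Turnstile> \<^bold>\<not> fsubst 0 t \<phi>"
              using right(2) H4(1) H5(1) by (blast intro: forces_mono)
            ultimately show "H5 \<Turnstile> \<^bold>\<bottom>" by (blast intro: forces_ImpE)
          next
            fix H5 assume H5: "H4 \<preceq> H5" "H5 \<Turnstile> Succ m \<^bold>\<le> t"
            have "H5 \<Turnstile> bnone t \<phi>"
              using left(2) right(1) H4(1) H5(1) by (blast intro: forces_mono)
            then show "H5 \<Turnstile> \<^bold>\<bottom>" by (rule bnoneD[OF _ H5(2) forces_mono[OF H4(4) H5(1)]])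
          qed
        qed (use t wf right in \<open>auto intro: extends_world\<close>)
        then show "H3 \<Turnstile> bnone (Succ t) \<phi> \<^bold>\<or> bex (Succ t) \<phi>"
          using t wf by (auto intro: forces_OrI1)
      qed
    next
      case (right H2)
      from right(2) have "H2 \<Turnstile> bex (Succ t) \<phi>"
      proof (rule bexE)
        fix H3 m assume H3: "H2 \<preceq> H3" "trm m Nt" "H3 \<Turnstile> Succ m \<^bold>\<le> t" "H3 \<Turnstile> fsubst 0 m \<phi>"
        have "H3 \<Turnstile> Succ m \<^bold>\<le> Succ t"
          using H3 t by (blast intro: le_trans le_Succ extends_world)
        then show "H3 \<Turnstile> bex (Succ t) \<phi>" using H3(4) wf by (rule bexI)
      qed
      then show "H2 \<Turnstile> bnone (Succ t) \<phi> \<^bold>\<or> bex (Succ t) \<phi>"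
        using t wf by (auto intro: forces_OrI2)
    qed
    then show "H1 \<Turnstile> fsubst 0 (Succ t) ?\<phi>" by simp
  qed
  then show ?thesis by simp
qed

text \<open>Both alternatives may hold at the same \<open>t\<close>, and terms cannot branch on
  formulas. Countable choice picks one alternative for each \<open>t\<close> and records it in the
  value of \<open>q\<close>.\<close>

lemma choose_binary:
  assumes "\<And>t. trm t Nt \<Longrightarrow> H \<Turnstile> fsubst 0 t \<phi> \<^bold>\<or> fsubst 0 t \<psi>"
    and wf: "wfe (case_nat Nt G) \<phi>" "wfe (case_nat Nt G) \<psi>"
    and "\<And>H' q. H \<preceq> H' \<Longrightarrow> trm q Seq \<Longrightarrow>
      (\<And>t. trm t Nt \<Longrightarrow> H' \<Turnstile> (q \<cdot> t \<^bold>= Zero \<^bold>\<and> fsubst 0 t \<phi>) \<^bold>\<or> (q \<cdot> t \<^bold>= One \<^bold>\<and> fsubst 0 t \<psi>)) \<Longrightarrow>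
      H' \<Turnstile> \<chi>"
  shows "H \<Turnstile> \<chi>"
proof (rule forces_CC[where \<tau> = Nt and
      \<phi> = "(Var 0 \<^bold>= Zero \<^bold>\<and> fshift 0 \<phi>) \<^bold>\<or> (Var 0 \<^bold>= One \<^bold>\<and> fshift 0 \<psi>)"])
  fix t assume t: "trm t Nt"
  let ?\<Phi> = "\<lambda>v. (v \<^bold>= Zero \<^bold>\<and> fsubst 0 t \<phi>) \<^bold>\<or> (v \<^bold>= One \<^bold>\<and> fsubst 0 t \<psi>)"
  let ?E = "Ex Nt ((Var 0 \<^bold>= Zero \<^bold>\<and> fshift 0 (fsubst 0 t \<phi>)) \<^bold>\<or> (Var 0 \<^bold>= One \<^bold>\<and> fshift 0 (fsubst 0 t \<psi>)))"
  from assms(1)[OF t] have "H \<Turnstile> ?E"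
  proof (cases rule: forces_OrE)
    case (left H')
    have "H' \<Turnstile> ?\<Phi> Zero"
      using left t wf by (intro forces_OrI1) (auto simp: forces_And intro: forces_EqI extends_world)
    then show "H' \<Turnstile> ?E"
      by (intro forces_ExI[of _ Zero]) (use t wf in auto)
  next
    case (right H')
    have "H' \<Turnstile> ?\<Phi> One"
      using right t wf by (intro forces_OrI2) (auto simp: forces_And intro: forces_EqI extends_world)
    then show "H' \<Turnstile> ?E"
      by (intro forces_ExI[of _ One]) (use t wf in auto)
  qed
  then show "H \<Turnstile> Ex Nt (fsubst (Suc 0) (shift 0 t)
      ((Var 0 \<^bold>= Zero \<^bold>\<and> fshift 0 \<phi>) \<^bold>\<or> (Var 0 \<^bold>= One \<^bold>\<and> fshift 0 \<psi>)))"
    by simp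
qed (use assms(4) in simp)

subsection \<open>The one-point compactification\<close>

lemma wfe_Ninf [simp]: "wfe e (Ninf a) \<longleftrightarrow> tyof e a = Some Seq"
  by (auto simp: Ninf_def split: option.splits ty.splits if_splits)

lemma fsubst_Ninf [simp]: "fsubst k u (Ninf a) = Ninf (subst k u a)"
  by (simp add: Ninf_def)

lemma NinfI:
  assumes "trm a Seq" "world H"
    and bin: "\<And>t. trm t Nt \<Longrightarrow> H \<Turnstile> a \<cdot> t \<^bold>= Zero \<^bold>\<or> a \<cdot> t \<^bold>= One"
    and mon: "\<And>H' s t. H \<preceq> H' \<Longrightarrow> trm s Nt \<Longrightarrow> trm t Nt \<Longrightarrow> H' \<Turnstile> s \<^bold>\<le> t \<Longrightarrow> H' \<Turnstile> a \<cdot> s \<^bold>\<le> a \<cdot> t"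
  shows "H \<Turnstile> Ninf a"
  unfolding Ninf_def forces_And
proof (intro conjI forces_AllI)
  fix s assume s: "trm s Nt"
  then show "H \<Turnstile> fsubst 0 s (shift 0 a \<cdot> Var 0 \<^bold>= Zero \<^bold>\<or> shift 0 a \<cdot> Var 0 \<^bold>= One)"
    using bin by simp
  have "H \<Turnstile> All Nt (shift 0 s \<^bold>\<le> Var 0 \<^bold>\<longrightarrow> shift 0 a \<cdot> shift 0 s \<^bold>\<le> shift 0 a \<cdot> Var 0)"
  proof (rule forces_AllI)
    fix t assume t: "trm t Nt"
    have "H \<Turnstile> s \<^bold>\<le> t \<^bold>\<longrightarrow> a \<cdot> s \<^bold>\<le> a \<cdot> t"
      by (rule forces_ImpI) (use s t assms(2) mon in auto)
    then show "H \<Turnstile> fsubst 0 t (shift 0 s \<^bold>\<le> Var 0 \<^bold>\<longrightarrow> shift 0 a \<cdot> shift 0 s \<^bold>\<le> shift 0 a \<cdot> Var 0)"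
      by simp
  qed
  then show "H \<Turnstile> fsubst 0 s (All Nt (Var 1 \<^bold>\<le> Var 0 \<^bold>\<longrightarrow>
      shift 0 (shift 0 a) \<cdot> Var 1 \<^bold>\<le> shift 0 (shift 0 a) \<cdot> Var 0))"
    by simp
qed

lemma Ninf_binary:
  assumes "H \<Turnstile> Ninf a" "trm t Nt"
  shows "H \<Turnstile> a \<cdot> t \<^bold>= Zero \<^bold>\<or> a \<cdot> t \<^bold>= One"
proof -
  from assms(1) have "H \<Turnstile> All Nt (shift 0 a \<cdot> Var 0 \<^bold>= Zero \<^bold>\<or> shift 0 a \<cdot> Var 0 \<^bold>= One)"
    unfolding Ninf_def forces_And by simp
  from forces_AllE[OF this assms(2)] show ?thesis by simp
qed

lemma Ninf_mono:
  assumes "H \<Turnstile> Ninf a" "H \<Turnstile> s \<^bold>\<le> t"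
  shows "H \<Turnstile> a \<cdot> s \<^bold>\<le> a \<cdot> t"
proof -
  from assms(1) have "H \<Turnstile> All Nt (All Nt (Var 1 \<^bold>\<le> Var 0 \<^bold>\<longrightarrow>
      shift 0 (shift 0 a) \<cdot> Var 1 \<^bold>\<le> shift 0 (shift 0 a) \<cdot> Var 0))"
    unfolding Ninf_def forces_And by simp
  from forces_AllE[OF this le_trm(1)[OF assms(2)]]
  have "H \<Turnstile> All Nt (shift 0 s \<^bold>\<le> Var 0 \<^bold>\<longrightarrow> shift 0 a \<cdot> shift 0 s \<^bold>\<le> shift 0 a \<cdot> Var 0)"
    by simp
  from forces_AllE[OF this le_trm(2)[OF assms(2)]]
  have "H \<Turnstile> s \<^bold>\<le> t \<^bold>\<longrightarrow> a \<cdot> s \<^bold>\<le> a \<cdot> t" by simp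
  with assms(2) show ?thesis by (blast intro: forces_ImpE)
qed

lemma wfe_AtLeast [simp]:
  "wfe e (AtLeast a n) \<longleftrightarrow> tyof e a = Some Seq \<and> tyof e n = Some Nt"
  by (auto simp: AtLeast_def split: option.splits ty.splits if_splits)

lemma fsubst_AtLeast [simp]: "fsubst k u (AtLeast a n) = AtLeast (subst k u a) (subst k u n)"
  by (simp add: AtLeast_def)

lemma AtLeastI:
  assumes "trm a Seq" "trm n Nt" "world H"
    and "\<And>H' i. H \<preceq> H' \<Longrightarrow> trm i Nt \<Longrightarrow> H' \<Turnstile> Succ i \<^bold>\<le> n \<Longrightarrow> H' \<Turnstile> a \<cdot> i \<^bold>= Zero"
  shows "H \<Turnstile> AtLeast a n"
  unfolding AtLeast_def
proof (rule forces_AllI)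
  fix i assume i: "trm i Nt"
  have "H \<Turnstile> Succ i \<^bold>\<le> n \<^bold>\<longrightarrow> a \<cdot> i \<^bold>= Zero"
    by (rule forces_ImpI) (use i assms in auto)
  then show "H \<Turnstile> fsubst 0 i (Succ (Var 0) \<^bold>\<le> shift 0 n \<^bold>\<longrightarrow> shift 0 a \<cdot> Var 0 \<^bold>= Zero)"
    by simp
qed

lemma AtLeastD:
  assumes "H \<Turnstile> AtLeast a n" "H \<Turnstile> Succ i \<^bold>\<le> n"
  shows "H \<Turnstile> a \<cdot> i \<^bold>= Zero"
proof -
  have "trm i Nt" using le_trm[OF assms(2)] by (auto split: if_splits)
  from forces_AllE[OF assms(1)[unfolded AtLeast_def] this]
  have "H \<Turnstile> Succ i \<^bold>\<le> n \<^bold>\<longrightarrow> a \<cdot> i \<^bold>= Zero" by simp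
  with assms(2) show ?thesis by (blast intro: forces_ImpE)
qed

lemma Zero_One_absurd:
  assumes "H \<Turnstile> a \<^bold>= Zero" "H \<Turnstile> a \<^bold>= One"
  shows "H \<Turnstile> \<^bold>\<bottom>"
proof -
  have "H \<Turnstile> One \<^bold>= Zero" using assms by (blast intro: eq_trans eq_sym)
  then show ?thesis by (rule forces_absurd)
qed

lemma Ninf_Zero_below:
  assumes "H \<Turnstile> Ninf a" "H \<Turnstile> s \<^bold>\<le> t" "H \<Turnstile> a \<cdot> t \<^bold>= Zero"
  shows "H \<Turnstile> a \<cdot> s \<^bold>= Zero"
proof -
  have *: "H \<Turnstile> a \<cdot> s \<^bold>\<le> Zero"
    by (rule le_trans[OF Ninf_mono[OF assms(1,2)] eq_le[OF assms(3)]])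
  from Ninf_binary[OF assms(1) le_trm(1)[OF assms(2)]] show ?thesis
  proof (cases rule: forces_OrE)
    case (right H')
    have "H' \<Turnstile> One \<^bold>\<le> Zero"
      using forces_mono[OF * right(1)] right(2) by (blast intro: le_trans eq_le eq_sym)
    then have "H' \<Turnstile> \<^bold>\<bottom>" by (rule Succ_le_Zero)
    then show "H' \<Turnstile> a \<cdot> s \<^bold>= Zero"
      by (rule forces_BotE) (use le_trm[OF *] in simp)
  qed
qed

lemma Ninf_One_above:
  assumes "H \<Turnstile> Ninf a" "H \<Turnstile> s \<^bold>\<le> t" "H \<Turnstile> a \<cdot> s \<^bold>= One"
  shows "H \<Turnstile> a \<cdot> t \<^bold>= One"
  using Ninf_binary[OF assms(1) le_trm(2)[OF assms(2)]]
proof (cases rule: forces_OrE)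
  case (left H')
  have "H' \<Turnstile> a \<cdot> s \<^bold>= Zero"
    by (rule Ninf_Zero_below[OF assms(1,2)[THEN forces_mono, OF left(1)] left(2)])
  then have "H' \<Turnstile> \<^bold>\<bottom>" using forces_mono[OF assms(3) left(1)] by (rule Zero_One_absurd)
  then show "H' \<Turnstile> a \<cdot> t \<^bold>= One"
    by (rule forces_BotE) (use left(2) in \<open>auto dest: forces_wfe\<close>)
qed

text \<open>\<open>Und n a\<close>: the sequence \<open>a\<close> is the copy of \<open>n\<close> in the compactification.\<close>

definition Und :: "tm \<Rightarrow> tm \<Rightarrow> fm" where
  "Und n a = (Ninf a \<^bold>\<and> AtLeast a n \<^bold>\<and> a \<cdot> n \<^bold>= One)"

lemma wfe_Und [simp]: "wfe e (Und n a) \<longleftrightarrow> tyof e n = Some Nt \<and> tyof e a = Some Seq"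
  by (auto simp: Und_def)

lemma fsubst_Und [simp]: "fsubst k u (Und n a) = Und (subst k u n) (subst k u a)"
  by (simp add: Und_def)

text \<open>Entries below \<open>n\<close> are 0 and all others are 1. \<open>Ext\<close> makes this
  an equation at type \<open>Seq\<close>, so that one sequence can replace the other inside any
  formula, in particular as an argument of a functional.\<close>

lemma Und_unique:
  assumes "H \<Turnstile> Und n a" "H \<Turnstile> Und n b"
  shows "H \<Turnstile> Eq Seq a b"
proof (rule forces_Ext)
  have n: "trm n Nt" "trm a Seq" "trm b Seq" using assms[THEN forces_wfe] by auto
  then show "trm a Seq" "trm b Seq" by auto
  fix i assume i: "trm i Nt"
  note ab = assms[unfolded Und_def forces_And]
  from le_linear[OF n(1) i forces_world[OF assms(1)]] show "H \<Turnstile> a \<cdot> i \<^bold>= b \<cdot> i"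
  proof (cases rule: forces_OrE)
    case (left H')
    then show "H' \<Turnstile> a \<cdot> i \<^bold>= b \<cdot> i"
      using ab by (meson Ninf_One_above eq_sym eq_trans forces_mono)
  next
    case (right H')
    then show "H' \<Turnstile> a \<cdot> i \<^bold>= b \<cdot> i"
      using ab by (meson AtLeastD eq_sym eq_trans forces_mono)
  qed
qed

lemma Or_left:
  assumes "H \<Turnstile> \<phi> \<^bold>\<or> \<psi>" "\<And>H'. H \<preceq> H' \<Longrightarrow> H' \<Turnstile> \<psi> \<Longrightarrow> H' \<Turnstile> \<^bold>\<bottom>"
  shows "H \<Turnstile> \<phi>"
  using assms(1)
proof (cases rule: forces_OrE)
  case (right H')
  show "H' \<Turnstile> \<phi>"
    by (rule forces_BotE[OF assms(2)[OF right]]) (use forces_wfe[OF assms(1)] in simp)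
qed

lemma Or_right:
  assumes "H \<Turnstile> \<phi> \<^bold>\<or> \<psi>" "\<And>H'. H \<preceq> H' \<Longrightarrow> H' \<Turnstile> \<phi> \<Longrightarrow> H' \<Turnstile> \<^bold>\<bottom>"
  shows "H \<Turnstile> \<psi>"
  using assms(1)
proof (cases rule: forces_OrE)
  case (left H')
  show "H' \<Turnstile> \<psi>"
    by (rule forces_BotE[OF assms(2)[OF left]]) (use forces_wfe[OF assms(1)] in simp)
qed

text \<open>A value 1 at \<open>s\<close> records \<open>\<psi>\<close> there, and
  \<open>clash\<close> rules out \<open>\<phi>\<close>, hence the value 0, at every later
  \<open>t\<close>. So a sequence from \<open>choose_binary\<close> never returns from 1 to
  0.\<close>

lemma binary_Ninf:
  assumes q: "\<And>t. trm t Nt \<Longrightarrow> H \<Turnstile> (q \<cdot> t \<^bold>= Zero \<^bold>\<and> fsubst 0 t \<phi>) \<^bold>\<or> (q \<cdot> t \<^bold>= One \<^bold>\<and> fsubst 0 t \<psi>)"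
    and clash: "\<And>H' s t. H \<preceq> H' \<Longrightarrow> H' \<Turnstile> s \<^bold>\<le> t \<Longrightarrow> H' \<Turnstile> fsubst 0 s \<psi> \<Longrightarrow> H' \<Turnstile> fsubst 0 t \<phi> \<Longrightarrow> H' \<Turnstile> \<^bold>\<bottom>"
    and ty: "trm q Seq"
  shows "H \<Turnstile> Ninf q"
proof (rule NinfI[OF ty])
  show "world H" by (rule forces_world[OF q[of Zero]]) simp
  fix t assume t: "trm t Nt"
  from q[OF t] show "H \<Turnstile> q \<cdot> t \<^bold>= Zero \<^bold>\<or> q \<cdot> t \<^bold>= One"
  proof (cases rule: forces_OrE)
    case (left H')
    then show "H' \<Turnstile> q \<cdot> t \<^bold>= Zero \<^bold>\<or> q \<cdot> t \<^bold>= One"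
      using ty t by (auto intro: forces_OrI1 simp: forces_And)
  next
    case (right H')
    then show "H' \<Turnstile> q \<cdot> t \<^bold>= Zero \<^bold>\<or> q \<cdot> t \<^bold>= One"
      using ty t by (auto intro: forces_OrI2 simp: forces_And)
  qed
next
  fix H1 s t assume H1: "H \<preceq> H1" "trm s Nt" "trm t Nt" "H1 \<Turnstile> s \<^bold>\<le> t"
  from forces_mono[OF q[OF H1(2)] H1(1)] show "H1 \<Turnstile> q \<cdot> s \<^bold>\<le> q \<cdot> t"
  proof (cases rule: forces_OrE)
    case (left H2)
    then have "H2 \<Turnstile> q \<cdot> s \<^bold>\<le> Zero" by (auto simp: forces_And intro: eq_le)
    moreover have "H2 \<Turnstile> Zero \<^bold>\<le> q \<cdot> t" using ty H1 left by (auto intro: Zero_le extends_world)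
    ultimately show "H2 \<Turnstile> q \<cdot> s \<^bold>\<le> q \<cdot> t" by (rule le_trans)
  next
    case (right H2)
    have "H2 \<Turnstile> q \<cdot> t \<^bold>= One \<^bold>\<and> fsubst 0 t \<psi>"
    proof (rule Or_right[OF forces_mono[OF q[OF H1(3)] extends_trans[OF H1(1) right(1)]]])
      fix H3 assume H3: "H2 \<preceq> H3" "H3 \<Turnstile> q \<cdot> t \<^bold>= Zero \<^bold>\<and> fsubst 0 t \<phi>"
      show "H3 \<Turnstile> \<^bold>\<bottom>"
      proof (rule clash)
        show "H \<preceq> H3" by (rule extends_trans[OF extends_trans[OF H1(1) right(1)] H3(1)])
        show "H3 \<Turnstile> s \<^bold>\<le> t" by (rule forces_mono[OF forces_mono[OF H1(4) right(1)] H3(1)])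
        show "H3 \<Turnstile> fsubst 0 s \<psi>" "H3 \<Turnstile> fsubst 0 t \<phi>"
          using H3(2) forces_mono[OF right(2) H3(1)] by (simp_all add: forces_And)
      qed
    qed
    with right(2) show "H2 \<Turnstile> q \<cdot> s \<^bold>\<le> q \<cdot> t"
      by (auto simp: forces_And intro: eq_le eq_trans eq_sym)
  qed
qed

text \<open>The recorded choice determines an entry as soon as the competing alternative is refuted;
  \<open>choose_One\<close> is the mirror image.\<close>

lemma choose_Zero:
  assumes "H \<Turnstile> (a \<^bold>= Zero \<^bold>\<and> \<phi>) \<^bold>\<or> (b \<^bold>\<and> \<psi>)" "\<And>H'. H \<preceq> H' \<Longrightarrow> H' \<Turnstile> \<psi> \<Longrightarrow> H' \<Turnstile> \<^bold>\<bottom>"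
  shows "H \<Turnstile> a \<^bold>= Zero"
proof -
  have "H \<Turnstile> a \<^bold>= Zero \<^bold>\<and> \<phi>"
    by (rule Or_left[OF assms(1)]) (simp add: forces_And assms(2))
  then show ?thesis by (simp add: forces_And)
qed

lemma choose_One:
  assumes "H \<Turnstile> (b \<^bold>\<and> \<phi>) \<^bold>\<or> (a \<^bold>= One \<^bold>\<and> \<psi>)" "\<And>H'. H \<preceq> H' \<Longrightarrow> H' \<Turnstile> \<phi> \<Longrightarrow> H' \<Turnstile> \<^bold>\<bottom>"
  shows "H \<Turnstile> a \<^bold>= One"
proof -
  have "H \<Turnstile> a \<^bold>= One \<^bold>\<and> \<psi>"
    by (rule Or_right[OF assms(1)]) (simp add: forces_And assms(2))
  then show ?thesis by (simp add: forces_And)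
qed

text \<open>The comparison of \<open>i\<close> with \<open>n\<close> is decidable, and
  \<open>choose_binary\<close> turns the decision into a sequence: 0 for \<open>i\<close> below
  \<open>n\<close>, and 1 from \<open>n\<close> on.\<close>

lemma Und_exists:
  assumes n: "trm n Nt" and w: "world H"
  shows "H \<Turnstile> Ex Seq (Und (shift 0 n) (Var 0))"
proof (rule choose_binary[where \<phi> = "Succ (Var 0) \<^bold>\<le> shift 0 n" and \<psi> = "shift 0 n \<^bold>\<le> Var 0"])
  fix i assume i: "trm i Nt"
  from le_linear[OF n i w]
  have "H \<Turnstile> Succ i \<^bold>\<le> n \<^bold>\<or> n \<^bold>\<le> i"
  proof (cases rule: forces_OrE)
    case (left H')
    then show "H' \<Turnstile> Succ i \<^bold>\<le> n \<^bold>\<or> n \<^bold>\<le> i" using n i by (auto intro: forces_OrI2)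
  next
    case (right H')
    then show "H' \<Turnstile> Succ i \<^bold>\<le> n \<^bold>\<or> n \<^bold>\<le> i" using n i by (auto intro: forces_OrI1)
  qed
  then show "H \<Turnstile> fsubst 0 i (Succ (Var 0) \<^bold>\<le> shift 0 n) \<^bold>\<or> fsubst 0 i (shift 0 n \<^bold>\<le> Var 0)"
    by simp
next
  fix H1 q assume H1: "H \<preceq> H1" and q: "trm q Seq" 
    and qv: "\<And>t. trm t Nt \<Longrightarrow> H1 \<Turnstile> (q \<cdot> t \<^bold>= Zero \<^bold>\<and> fsubst 0 t (Succ (Var 0) \<^bold>\<le> shift 0 n)) \<^bold>\<or>
      (q \<cdot> t \<^bold>= One \<^bold>\<and> fsubst 0 t (shift 0 n \<^bold>\<le> Var 0))"
  have clash: "H' \<Turnstile> \<^bold>\<bottom>" if "H' \<Turnstile> Succ i \<^bold>\<le> n" "H' \<Turnstile> n \<^bold>\<le> j" "H' \<Turnstile> j \<^bold>\<le> i" for H' i j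
    using that by (blast intro: le_trans Succ_le_self)
  have "H1 \<Turnstile> Und n q"
    unfolding Und_def forces_And
  proof (intro conjI)
    show "H1 \<Turnstile> Ninf q"
    proof (rule binary_Ninf[OF qv _ q])
      fix H' s t
      assume "H' \<Turnstile> s \<^bold>\<le> t" "H' \<Turnstile> fsubst 0 s (shift 0 n \<^bold>\<le> Var 0)"
        "H' \<Turnstile> fsubst 0 t (Succ (Var 0) \<^bold>\<le> shift 0 n)"
      then show "H' \<Turnstile> \<^bold>\<bottom>" using clash[of H' t s] by simp
    qed
    show "H1 \<Turnstile> AtLeast q n"
    proof (rule AtLeastI[OF q n extends_world[OF H1]])
      fix H2 i assume H2: "H1 \<preceq> H2" "trm i Nt" "H2 \<Turnstile> Succ i \<^bold>\<le> n"
      show "H2 \<Turnstile> q \<cdot> i \<^bold>= Zero"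
      proof (rule choose_Zero[OF forces_mono[OF qv[OF H2(2)] H2(1)]])
        fix H3 assume "H2 \<preceq> H3" "H3 \<Turnstile> fsubst 0 i (shift 0 n \<^bold>\<le> Var 0)"
        then show "H3 \<Turnstile> \<^bold>\<bottom>"
          using clash[of H3 i i] H2 forces_mono by (auto intro: le_refl extends_world)
      qed
    qed
    show "H1 \<Turnstile> q \<cdot> n \<^bold>= One"
    proof (rule choose_One[OF qv[OF n]])
      fix H2 assume "H1 \<preceq> H2" "H2 \<Turnstile> fsubst 0 n (Succ (Var 0) \<^bold>\<le> shift 0 n)"
      then show "H2 \<Turnstile> \<^bold>\<bottom>" using Succ_le_self by simp
    qed
  qed
  then show "H1 \<Turnstile> Ex Seq (Und (shift 0 n) (Var 0))"
    by (intro forces_ExI[of _ q]) (use q n in auto)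
qed (use n in auto)

text \<open>Names all copies of numbers by one term \<open>u\<close>, so that a property of the copy
  of \<open>n\<close> becomes a formula in the number variable.\<close>

lemma Und_sequence:
  assumes "world H"
    and "\<And>H' u. H \<preceq> H' \<Longrightarrow> trm u (Nt \<rightarrow> Seq) \<Longrightarrow> (\<And>n. trm n Nt \<Longrightarrow> H' \<Turnstile> Und n (u \<cdot> n)) \<Longrightarrow> H' \<Turnstile> \<chi>"
  shows "H \<Turnstile> \<chi>"
  by (rule forces_CC[where \<tau> = Seq and \<phi> = "Und (Var (Suc 0)) (Var 0)"])
    (use assms Und_exists in auto)

text \<open>Descend from \<open>n\<close> to the first entry 1. Since entries are 0 or 1, at each
  step either the preceding entry is 0, and \<open>a\<close> is the copy of the current index, or
  the descent continues, at the latest to index 0.\<close>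

lemma Ninf_One_Und:
  assumes a: "H \<Turnstile> Ninf a" and one: "H \<Turnstile> a \<cdot> n \<^bold>= One" and n: "trm n Nt"
  shows "H \<Turnstile> Ex Nt (Und (Var 0) (shift 0 a))"
proof -
  have ty: "trm a Seq" using forces_wfe[OF a] by simp
  have Und: "H' \<Turnstile> Ex Nt (Und (Var 0) (shift 0 a))" if "H' \<Turnstile> Und m a" for H' m
    by (rule forces_ExI[of _ m]) (use that ty in \<open>auto dest: forces_wfe\<close>)
  let ?\<phi> = "shift 0 a \<cdot> Var 0 \<^bold>= One \<^bold>\<longrightarrow> Ex Nt (Und (Var 0) (shift 0 (shift 0 a)))"
  have "H \<Turnstile> fsubst 0 n ?\<phi>"
  proof (rule forces_Ind[OF _ _ n])
    have "H \<Turnstile> a \<cdot> Zero \<^bold>= One \<^bold>\<longrightarrow> Ex Nt (Und (Var 0) (shift 0 a))"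
    proof (rule forces_ImpI)
      fix H1 assume H1: "H \<preceq> H1" "H1 \<Turnstile> a \<cdot> Zero \<^bold>= One"
      have "H1 \<Turnstile> AtLeast a Zero"
        by (rule AtLeastI)
          (use ty H1 in \<open>auto intro: extends_world forces_BotE[OF Succ_le_Zero]\<close>)
      with H1 forces_mono[OF a H1(1)] have "H1 \<Turnstile> Und Zero a" by (simp add: Und_def forces_And)
      then show "H1 \<Turnstile> Ex Nt (Und (Var 0) (shift 0 a))" by (rule Und)
    qed (use ty a in \<open>auto intro: forces_world\<close>)
    then show "H \<Turnstile> fsubst 0 Zero ?\<phi>" by simp
  next
    fix H1 t assume H1: "H \<preceq> H1" "trm t Nt" "H1 \<Turnstile> fsubst 0 t ?\<phi>"
    have "H1 \<Turnstile> a \<cdot> Succ t \<^bold>= One \<^bold>\<longrightarrow> Ex Nt (Und (Var 0) (shift 0 a))"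
    proof (rule forces_ImpI)
      fix H2 assume H2: "H1 \<preceq> H2" "H2 \<Turnstile> a \<cdot> Succ t \<^bold>= One"
      note a2 = forces_mono[OF a extends_trans[OF H1(1) H2(1)]]
      from Ninf_binary[OF a2 H1(2)] show "H2 \<Turnstile> Ex Nt (Und (Var 0) (shift 0 a))"
      proof (cases rule: forces_OrE)
        case (left H3)
        have "H3 \<Turnstile> AtLeast a (Succ t)"
        proof (rule AtLeastI)
          fix H4 i assume H4: "H3 \<preceq> H4" "H4 \<Turnstile> Succ i \<^bold>\<le> Succ t"
          show "H4 \<Turnstile> a \<cdot> i \<^bold>= Zero"
            by (rule Ninf_Zero_below[OF _ Succ_le_SuccD[OF H4(2)]])
              (use a2 left H4(1) in \<open>blast intro: forces_mono\<close>)+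
        qed (use ty H1 left in \<open>auto intro: extends_world\<close>)
        with forces_mono[OF H2(2) left(1)] forces_mono[OF a2 left(1)] have "H3 \<Turnstile> Und (Succ t) a"
          by (simp add: Und_def forces_And)
        then show "H3 \<Turnstile> Ex Nt (Und (Var 0) (shift 0 a))" by (rule Und)
      next
        case (right H3)
        have "H3 \<Turnstile> a \<cdot> t \<^bold>= One \<^bold>\<longrightarrow> Ex Nt (Und (Var 0) (shift 0 a))"
          using forces_mono[OF forces_mono[OF H1(3) H2(1)] right(1)] by simp
        then show "H3 \<Turnstile> Ex Nt (Und (Var 0) (shift 0 a))" by (rule forces_ImpE[OF _ right(2)])
      qed
    qed (use ty H1 in \<open>auto intro: extends_world\<close>)
    then show "H1 \<Turnstile> fsubst 0 (Succ t) ?\<phi>" by simp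
  qed
  with one show ?thesis by (auto intro: forces_ImpE)
qed

section \<open>Omniscience of the compactification\<close>

lemma fsubst_fsubst_shift:
  "fsubst 0 t (fsubst 0 (shift 0 u \<cdot> Var 0) (fshift (Suc 0) \<phi>)) = fsubst 0 (u \<cdot> t) \<phi>"
proof -
  have "(\<lambda>i. sub (inst 0 t) (sub (inst 0 (shift 0 u \<cdot> Var 0)) (skip (Suc 0) i))) = inst 0 (u \<cdot> t)"
    by (auto simp: inst_def skip_def fun_eq_iff simp flip: subst_eq_sub)
  then show ?thesis by (simp add: fsubst_eq_fsub fshift_eq_fsub fsub_fsub sub_sub)
qed

text \<open>The sequence \<open>q\<close> is 0 as long as no copy of a number so far satisfies
  \<open>\<phi>\<close>, and 1 afterwards. Classically, it is the first copy satisfying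
  \<open>\<phi>\<close> if there is one, and \<open>\<omega>\<close> otherwise, so deciding
  \<open>\<phi>\<close> at this single point decides the existential statement. If
  \<open>\<phi>\<close> fails at \<open>q\<close>, then it fails at all copies of numbers,
  \<open>q\<close> is \<open>\<omega>\<close>, and any \<open>x\<close> satisfying
  \<open>\<phi>\<close> has no entry 1 and therefore equals \<open>q\<close>, a
  contradiction.\<close>

theorem omniscience:
  assumes dec: "\<And>H' x. H \<preceq> H' \<Longrightarrow> H' \<Turnstile> Ninf x \<Longrightarrow> H' \<Turnstile> Dec (fsubst 0 x \<phi>)"
    and wf: "wfe (case_nat Seq G) \<phi>" and w: "world H"
  shows "H \<Turnstile> Dec (Ex Seq (Ninf (Var 0) \<^bold>\<and> \<phi>))" (is "_ \<Turnstile> ?goal")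
  using w
proof (rule Und_sequence)
  fix H1 u assume H1: "H \<preceq> H1" and u: "trm u (Nt \<rightarrow> Seq)"
    and Und: "\<And>n. trm n Nt \<Longrightarrow> H1 \<Turnstile> Und n (u \<cdot> n)"
  \<comment> \<open>\<open>\<psi>\<close> expresses \<open>\<phi>\<close> at the copy of a number as
    a property of that number, so that it can be searched.\<close>
  define \<psi> where "\<psi> = fsubst 0 (shift 0 u \<cdot> Var 0) (fshift (Suc 0) \<phi>)"
  have wf': "wfe (case_nat Nt G) \<psi>"
    unfolding \<psi>_def using u wf by (subst wfe_fsubst0[of _ _ Seq]) auto
  have \<psi>: "fsubst 0 t \<psi> = fsubst 0 (u \<cdot> t) \<phi>" for t
    by (simp add: \<psi>_def fsubst_fsubst_shift)
  \<comment> \<open>The bound \<open>Succ t\<close> includes \<open>t\<close> itself. For the first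
    \<open>m\<close> with \<open>\<psi>\<close>, the sequence \<open>q\<close> is then 0 strictly
    below \<open>m\<close> and 1 at \<open>m\<close>, which makes it exactly the copy of
    \<open>m\<close>.\<close>
  have bs: "H1 \<Turnstile> bnone (Succ t) \<psi> \<^bold>\<or> bex (Succ t) \<psi>" if "trm t Nt" for t
  proof (rule bounded_search)
    fix m assume "trm m Nt"
    then have "H1 \<Turnstile> Ninf (u \<cdot> m)" using Und[of m] by (simp add: Und_def forces_And)
    then show "H1 \<Turnstile> Dec (fsubst 0 m \<psi>)" unfolding \<psi> by (rule dec[OF H1])
  qed (use wf' that in auto)
  show "H1 \<Turnstile> ?goal"
  proof (rule choose_binary[where \<phi> = "bnone (Succ (Var 0)) (fshift (Suc 0) \<psi>)"
        and \<psi> = "bex (Succ (Var 0)) (fshift (Suc 0) \<psi>)"])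
    fix H2 q assume H2: "H1 \<preceq> H2" and q: "trm q Seq"
      and "\<And>t. trm t Nt \<Longrightarrow> H2 \<Turnstile> (q \<cdot> t \<^bold>= Zero \<^bold>\<and> fsubst 0 t (bnone (Succ (Var 0)) (fshift (Suc 0) \<psi>))) \<^bold>\<or>
        (q \<cdot> t \<^bold>= One \<^bold>\<and> fsubst 0 t (bex (Succ (Var 0)) (fshift (Suc 0) \<psi>)))"
    then have qv: "H2 \<Turnstile> (q \<cdot> t \<^bold>= Zero \<^bold>\<and> bnone (Succ t) \<psi>) \<^bold>\<or> (q \<cdot> t \<^bold>= One \<^bold>\<and> bex (Succ t) \<psi>)"
      if "trm t Nt" for t
      using that by simp
    have "H2 \<Turnstile> Ninf q"
    proof (rule binary_Ninf[OF _ _ q, where \<phi> = "bnone (Succ (Var 0)) (fshift (Suc 0) \<psi>)"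
        and \<psi> = "bex (Succ (Var 0)) (fshift (Suc 0) \<psi>)"])
      fix H3 s t assume H3: "H3 \<Turnstile> s \<^bold>\<le> t"
        "H3 \<Turnstile> fsubst 0 s (bex (Succ (Var 0)) (fshift (Suc 0) \<psi>))"
        "H3 \<Turnstile> fsubst 0 t (bnone (Succ (Var 0)) (fshift (Suc 0) \<psi>))"
      from H3(2) have "H3 \<Turnstile> bex (Succ s) \<psi>" by simp
      then show "H3 \<Turnstile> \<^bold>\<bottom>"
      proof (rule bexE)
        fix H4 m assume H4: "H3 \<preceq> H4" "H4 \<Turnstile> Succ m \<^bold>\<le> Succ s" "H4 \<Turnstile> fsubst 0 m \<psi>"
        have "H4 \<Turnstile> bnone (Succ t) \<psi>" using forces_mono[OF H3(3) H4(1)] by simp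
        moreover have "H4 \<Turnstile> Succ m \<^bold>\<le> Succ t"
          using H4(2) Succ_le_Succ[OF forces_mono[OF H3(1) H4(1)]] by (rule le_trans)
        ultimately show "H4 \<Turnstile> \<^bold>\<bottom>" using H4(3) by (rule bnoneD)
      qed
    qed (use qv in simp)
    note Nq = this
    from dec[OF extends_trans[OF H1 H2] Nq] show "H2 \<Turnstile> ?goal"
    proof (cases rule: forces_OrE)
      case (left H3)
      have "H3 \<Turnstile> Ex Seq (Ninf (Var 0) \<^bold>\<and> \<phi>)"
        by (rule forces_ExI[of _ q]) (use left forces_mono[OF Nq] q wf in \<open>auto simp: forces_And\<close>)
      then show "H3 \<Turnstile> ?goal" using wf by (auto intro: forces_OrI1)
    next
      case (right H3)
      note up3 = extends_trans[OF H2 right(1)]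
      have notq: "H' \<Turnstile> \<^bold>\<bottom>" if "H3 \<preceq> H'" "H' \<Turnstile> Eq Seq x q" "H' \<Turnstile> fsubst 0 x \<phi>" for H' x
        by (rule forces_ImpE[OF forces_mono[OF right(2) that(1)]])
          (use forces_EqE[OF that(2,3) wf] in simp)
      \<comment> \<open>Induction on the bound: if nothing below \<open>n\<close> satisfies
        \<open>\<psi>\<close> but some \<open>m\<close> at most \<open>n\<close> does, then
        \<open>q\<close> is the copy of \<open>m\<close>. So \<open>\<phi>\<close> holds at
        \<open>q\<close>, which \<open>notq\<close> refutes.\<close>
      have none: "H3 \<Turnstile> bnone t \<psi>" if t: "trm t Nt" for t
      proof -
        have "H3 \<Turnstile> fsubst 0 t (bnone (Var 0) (fshift (Suc 0) \<psi>))"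
        proof (rule forces_Ind[OF _ _ t])
          have "H3 \<Turnstile> bnone Zero \<psi>"
            by (rule bnoneI) (use right wf' in \<open>auto intro: extends_world Succ_le_Zero\<close>)
          then show "H3 \<Turnstile> fsubst 0 Zero (bnone (Var 0) (fshift (Suc 0) \<psi>))" by simp
        next
          fix H4 n assume H4: "H3 \<preceq> H4" "trm n Nt"
            and "H4 \<Turnstile> fsubst 0 n (bnone (Var 0) (fshift (Suc 0) \<psi>))"
          then have IH: "H4 \<Turnstile> bnone n \<psi>" by simp
          have "H4 \<Turnstile> bnone (Succ n) \<psi>"
          proof (rule bnoneI)
            fix H5 m assume H5: "H4 \<preceq> H5" "trm m Nt" "H5 \<Turnstile> Succ m \<^bold>\<le> Succ n" "H5 \<Turnstile> fsubst 0 m \<psi>"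
            have up: "H3 \<preceq> H5" by (rule extends_trans[OF H4(1) H5(1)])
            note up' = extends_trans[OF right(1) up]
            note mn = Succ_le_SuccD[OF H5(3)]
            have "H5 \<Turnstile> Und m q"
              unfolding Und_def forces_And
            proof (intro conjI)
              show "H5 \<Turnstile> Ninf q" by (rule forces_mono[OF Nq up'])
              show "H5 \<Turnstile> AtLeast q m"
              proof (rule AtLeastI[OF q H5(2) extends_world[OF up]])
                fix H6 i assume H6: "H5 \<preceq> H6" "trm i Nt" "H6 \<Turnstile> Succ i \<^bold>\<le> m"
                show "H6 \<Turnstile> q \<cdot> i \<^bold>= Zero"
                proof (rule choose_Zero[OF forces_mono[OF qv[OF H6(2)] extends_trans[OF up' H6(1)]]])
                  fix H7 assume H7: "H6 \<preceq> H7" "H7 \<Turnstile> bex (Succ i) \<psi>"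
                  from H7(2) show "H7 \<Turnstile> \<^bold>\<bottom>"
                  proof (rule bexE)
                    fix H8 k assume H8: "H7 \<preceq> H8" "H8 \<Turnstile> Succ k \<^bold>\<le> Succ i" "H8 \<Turnstile> fsubst 0 k \<psi>"
                    have up8: "H6 \<preceq> H8" by (rule extends_trans[OF H7(1) H8(1)])
                    note H8(2)
                    also note forces_mono[OF H6(3) up8]
                    also note forces_mono[OF mn extends_trans[OF H6(1) up8]]
                    finally show "H8 \<Turnstile> \<^bold>\<bottom>"
                      by (rule bnoneD[OF forces_mono[OF IH extends_trans[OF H5(1) extends_trans[OF H6(1) up8]]]])
                        (rule H8(3))
                  qed
                qed
              qed
              show "H5 \<Turnstile> q \<cdot> m \<^bold>= One"
              proof (rule choose_One[OF forces_mono[OF qv[OF H5(2)] up']])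
                fix H6 assume H6: "H5 \<preceq> H6" "H6 \<Turnstile> bnone (Succ m) \<psi>"
                show "H6 \<Turnstile> \<^bold>\<bottom>"
                  by (rule bnoneD[OF H6(2) _ forces_mono[OF H5(4) H6(1)]])
                    (use H5 H6 in \<open>auto intro: le_refl extends_world\<close>)
              qed
            qed
            then have "H5 \<Turnstile> Eq Seq (u \<cdot> m) q"
              using forces_mono[OF Und[OF H5(2)] extends_trans[OF up3 up]] by (blast intro: Und_unique)
            then show "H5 \<Turnstile> \<^bold>\<bottom>" by (rule notq[OF up]) (use H5(4) in \<open>simp add: \<psi>\<close>)
          qed (use H4 wf' in \<open>auto intro: extends_world\<close>)
          then show "H4 \<Turnstile> fsubst 0 (Succ n) (bnone (Var 0) (fshift (Suc 0) \<psi>))" by simp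
        qed
        then show ?thesis by simp
      qed
      have notu: "H' \<Turnstile> \<^bold>\<bottom>" if "H3 \<preceq> H'" "trm m Nt" "H' \<Turnstile> fsubst 0 m \<psi>" for H' m
        by (rule bnoneD[OF forces_mono[OF none that(1)] _ that(3), of "Succ m"])
          (use that in \<open>auto intro: le_refl extends_world\<close>)
      have q0: "H3 \<Turnstile> q \<cdot> t \<^bold>= Zero" if "trm t Nt" for t
      proof (rule choose_Zero[OF forces_mono[OF qv[OF that] right(1)]])
        fix H4 assume H4: "H3 \<preceq> H4" "H4 \<Turnstile> bex (Succ t) \<psi>"
        from H4(2) show "H4 \<Turnstile> \<^bold>\<bottom>"
          by (rule bexE) (rule notu[OF extends_trans[OF H4(1)]])
      qed
      have "H3 \<Turnstile> \<^bold>\<not> Ex Seq (Ninf (Var 0) \<^bold>\<and> \<phi>)"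
      proof (rule forces_ImpI)
        fix H4 assume H4: "H3 \<preceq> H4" "H4 \<Turnstile> Ex Seq (Ninf (Var 0) \<^bold>\<and> \<phi>)"
        from H4(2) show "H4 \<Turnstile> \<^bold>\<bottom>"
        proof (rule forces_ExE)
          fix H5 x assume H5: "H4 \<preceq> H5" and x: "trm x Seq" "H5 \<Turnstile> fsubst 0 x (Ninf (Var 0) \<^bold>\<and> \<phi>)"
          from x(2) have Nx: "H5 \<Turnstile> Ninf x" and Px: "H5 \<Turnstile> fsubst 0 x \<phi>"
            by (simp_all add: forces_And)
          note up5 = extends_trans[OF H4(1) H5]
          \<comment> \<open>An entry 1 would make \<open>x\<close> the copy of some
            \<open>m\<close>, where \<open>notu\<close> refutes \<open>\<phi>\<close>. Hence
            \<open>x\<close>, like \<open>q\<close>, is 0 everywhere.\<close>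
          have "H5 \<Turnstile> Eq Seq x q"
          proof (rule forces_Ext[OF _ x(1) q])
            fix i assume i: "trm i Nt"
            have "H5 \<Turnstile> x \<cdot> i \<^bold>= Zero"
            proof (rule Or_left[OF Ninf_binary[OF Nx i]])
              fix H6 assume H6: "H5 \<preceq> H6" "H6 \<Turnstile> x \<cdot> i \<^bold>= One"
              from Ninf_One_Und[OF forces_mono[OF Nx H6(1)] H6(2) i] show "H6 \<Turnstile> \<^bold>\<bottom>"
              proof (rule forces_ExE)
                fix H7 m assume H7: "H6 \<preceq> H7" and m: "trm m Nt" "H7 \<Turnstile> fsubst 0 m (Und (Var 0) (shift 0 x))"
                note up7 = extends_trans[OF up5 extends_trans[OF H6(1) H7]]
                have "H7 \<Turnstile> Und m x" using m by simp
                then have "H7 \<Turnstile> Eq Seq x (u \<cdot> m)"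
                  using forces_mono[OF Und[OF m(1)] extends_trans[OF up3 up7]] by (rule Und_unique)
                then have "H7 \<Turnstile> fsubst 0 (u \<cdot> m) \<phi>"
                  using forces_mono[OF Px extends_trans[OF H6(1) H7]] wf by (rule forces_EqE)
                then show "H7 \<Turnstile> \<^bold>\<bottom>" by (intro notu[OF up7 m(1)]) (simp add: \<psi>)
              qed
            qed
            also have "H5 \<Turnstile> Zero \<^bold>= q \<cdot> i" using q0[OF i] up5 by (blast intro: eq_sym forces_mono)
            finally show "H5 \<Turnstile> x \<cdot> i \<^bold>= q \<cdot> i" .
          qed
          then show "H5 \<Turnstile> \<^bold>\<bottom>" using Px by (rule notq[OF up5])
        qed
      qed (use right wf in \<open>auto intro: extends_world\<close>)
      then show "H3 \<Turnstile> ?goal" using wf by (auto intro: forces_OrI2)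
    qed
  qed (use bs wf' in simp_all)
qed

subsection \<open>The dichotomy\<close>

abbreviation Fseq :: ty where
  "Fseq \<equiv> Nt \<rightarrow> Seq \<rightarrow> Nt"

lemma wfe_TendsToZero [simp]:
  "tyof e f = Some Fseq \<Longrightarrow> tyof e x = Some Seq \<Longrightarrow> wfe e (TendsToZero f x)"
  by (simp add: TendsToZero_def)

lemma fsubst_TendsToZero [simp]:
  "fsubst k u (TendsToZero f x) = TendsToZero (subst k u f) (subst k u x)"
  by (simp add: TendsToZero_def)

lemma TendsToZeroE:
  assumes "H \<Turnstile> TendsToZero f x"
    and "\<And>H' M. H \<preceq> H' \<Longrightarrow> trm M Nt \<Longrightarrow>
      (\<And>H'' k. H' \<preceq> H'' \<Longrightarrow> H'' \<Turnstile> One \<^bold>\<le> k \<Longrightarrow> H'' \<Turnstile> M \<^bold>\<le> k \<Longrightarrow> H'' \<Turnstile> f \<cdot> k \<cdot> x \<^bold>= Zero) \<Longrightarrow> H' \<Turnstile> \<chi>"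
  shows "H \<Turnstile> \<chi>"
  using assms(1) unfolding TendsToZero_def
proof (rule forces_ExE)
  fix H1 M
  assume H1: "H \<preceq> H1" and M: "trm M Nt" and "H1 \<Turnstile> fsubst 0 M (All Nt (One \<^bold>\<le> Var 0 \<^bold>\<longrightarrow> Var 1 \<^bold>\<le> Var 0 \<^bold>\<longrightarrow>
      shift 0 (shift 0 f) \<cdot> Var 0 \<cdot> shift 0 (shift 0 x) \<^bold>= Zero))"
  then have *: "H1 \<Turnstile> All Nt (One \<^bold>\<le> Var 0 \<^bold>\<longrightarrow> shift 0 M \<^bold>\<le> Var 0 \<^bold>\<longrightarrow>
      shift 0 f \<cdot> Var 0 \<cdot> shift 0 x \<^bold>= Zero)" by simp
  from H1 M show "H1 \<Turnstile> \<chi>"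
  proof (rule assms(2))
    fix H2 k assume H2: "H1 \<preceq> H2" "H2 \<Turnstile> One \<^bold>\<le> k" "H2 \<Turnstile> M \<^bold>\<le> k"
    from forces_AllE[OF forces_mono[OF * H2(1)] le_trm(2)[OF H2(2)]]
    have "H2 \<Turnstile> One \<^bold>\<le> k \<^bold>\<longrightarrow> M \<^bold>\<le> k \<^bold>\<longrightarrow> f \<cdot> k \<cdot> x \<^bold>= Zero" by simp
    with H2(2,3) show "H2 \<Turnstile> f \<cdot> k \<cdot> x \<^bold>= Zero" by (blast intro: forces_ImpE)
  qed
qed

text \<open>Here \<open>n\<close> may be 0, while the sequence \<open>f\<close> is indexed from 1.
  The clause with \<open>One\<close> keeps the disregarded value of \<open>f\<close> at 0 from
  counting as a witness.\<close>

definition NonzeroBeyond :: "tm \<Rightarrow> tm \<Rightarrow> tm \<Rightarrow> fm" where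
  "NonzeroBeyond f n x = (AtLeast x n \<^bold>\<and> Ex Nt (shift 0 n \<^bold>\<le> Var 0 \<^bold>\<and> One \<^bold>\<le> Var 0 \<^bold>\<and>
    \<^bold>\<not> shift 0 f \<cdot> Var 0 \<cdot> shift 0 x \<^bold>= Zero))"

lemma wfe_NonzeroBeyond [simp]:
  "wfe e (NonzeroBeyond f n x) \<longleftrightarrow> tyof e f = Some Fseq \<and> tyof e n = Some Nt \<and> tyof e x = Some Seq"
  by (auto simp: NonzeroBeyond_def split: option.splits ty.splits if_splits)

lemma fsubst_NonzeroBeyond [simp]: "fsubst k u (NonzeroBeyond f n x) = NonzeroBeyond (subst k u f) (subst k u n) (subst k u x)"
  by (simp add: NonzeroBeyond_def)

lemma NonzeroBeyond_I:
  assumes "H \<Turnstile> AtLeast x n" "H \<Turnstile> n \<^bold>\<le> k" "H \<Turnstile> One \<^bold>\<le> k" "H \<Turnstile> \<^bold>\<not> f \<cdot> k \<cdot> x \<^bold>= Zero" "trm f Fseq"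
  shows "H \<Turnstile> NonzeroBeyond f n x"
  unfolding NonzeroBeyond_def forces_And
  by (intro conjI assms(1) forces_ExI[of _ k])
    (use assms(2-5) forces_wfe[OF assms(1)] le_trm[OF assms(2)] in \<open>auto simp: forces_And\<close>)

lemma NonzeroBeyond_E:
  assumes "H \<Turnstile> NonzeroBeyond f n x"
    and "\<And>H' k. H \<preceq> H' \<Longrightarrow> trm k Nt \<Longrightarrow> H' \<Turnstile> AtLeast x n \<Longrightarrow> H' \<Turnstile> n \<^bold>\<le> k \<Longrightarrow> H' \<Turnstile> One \<^bold>\<le> k \<Longrightarrow>
      H' \<Turnstile> \<^bold>\<not> f \<cdot> k \<cdot> x \<^bold>= Zero \<Longrightarrow> H' \<Turnstile> \<chi>"
  shows "H \<Turnstile> \<chi>"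
proof -
  from assms(1) have a: "H \<Turnstile> AtLeast x n" and "H \<Turnstile> Ex Nt (shift 0 n \<^bold>\<le> Var 0 \<^bold>\<and> One \<^bold>\<le> Var 0 \<^bold>\<and>
      \<^bold>\<not> shift 0 f \<cdot> Var 0 \<cdot> shift 0 x \<^bold>= Zero)"
    unfolding NonzeroBeyond_def forces_And by auto
  from this(2) show ?thesis
    by (rule forces_ExE) (rule assms(2)[OF _ _ forces_mono[OF a]], auto simp: forces_And)
qed

lemma NonzeroBeyond_eq:
  assumes "H \<Turnstile> Eq Seq x y" "H \<Turnstile> NonzeroBeyond f n x"
  shows "H \<Turnstile> NonzeroBeyond f n y"
  using forces_EqE[OF assms(1), of "NonzeroBeyond (shift 0 f) (shift 0 n) (Var 0)"] assms(2) forces_wfe[OF assms(2)]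
  by simp

lemma Dec_AtLeast:
  assumes "trm x Seq" "trm n Nt" "world H"
  shows "H \<Turnstile> Dec (AtLeast x n)"
proof -
  have "H \<Turnstile> bnone n (\<^bold>\<not> shift 0 x \<cdot> Var 0 \<^bold>= Zero) \<^bold>\<or> bex n (\<^bold>\<not> shift 0 x \<cdot> Var 0 \<^bold>= Zero)"
    by (rule bounded_search) (use assms in \<open>auto intro!: Dec_Neg Dec_Zero\<close>)
  then show ?thesis
  proof (cases rule: forces_OrE)
    case (left H1)
    have "H1 \<Turnstile> AtLeast x n"
    proof (rule AtLeastI[OF assms(1,2) extends_world[OF left(1)]])
      fix H2 i assume H2: "H1 \<preceq> H2" "trm i Nt" "H2 \<Turnstile> Succ i \<^bold>\<le> n"
      have "H2 \<Turnstile> Dec (x \<cdot> i \<^bold>= Zero)"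
        by (rule Dec_Zero) (use assms H2 in \<open>auto intro: extends_world\<close>)
      then show "H2 \<Turnstile> x \<cdot> i \<^bold>= Zero"
      proof (rule Or_left)
        fix H3 assume H3: "H2 \<preceq> H3" "H3 \<Turnstile> \<^bold>\<not> x \<cdot> i \<^bold>= Zero"
        from bnoneD[OF forces_mono[OF left(2) extends_trans[OF H2(1) H3(1)]] forces_mono[OF H2(3) H3(1)]] H3(2)
        show "H3 \<Turnstile> \<^bold>\<bottom>" by simp
      qed
    qed
    then show "H1 \<Turnstile> Dec (AtLeast x n)" using assms by (auto intro: forces_OrI1)
  next
    case (right H1)
    have "H1 \<Turnstile> \<^bold>\<not> AtLeast x n"
    proof (rule forces_ImpI)
      fix H2 assume H2: "H1 \<preceq> H2" "H2 \<Turnstile> AtLeast x n"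
      from forces_mono[OF right(2) H2(1)] show "H2 \<Turnstile> \<^bold>\<bottom>"
      proof (rule bexE)
        fix H3 m assume H3: "H2 \<preceq> H3" "H3 \<Turnstile> Succ m \<^bold>\<le> n" "H3 \<Turnstile> fsubst 0 m (\<^bold>\<not> shift 0 x \<cdot> Var 0 \<^bold>= Zero)"
        from AtLeastD[OF forces_mono[OF H2(2) H3(1)] H3(2)] H3(3) show "H3 \<Turnstile> \<^bold>\<bottom>"
          by (auto intro: forces_ImpE)
      qed
    qed (use assms right in \<open>auto intro: extends_world\<close>)
    then show "H1 \<Turnstile> Dec (AtLeast x n)" using assms by (auto intro: forces_OrI2)
  qed
qed

lemma Dec_NonzeroBeyond:
  assumes lim: "H \<Turnstile> TendsToZero f x" and ty: "trm f Fseq" "trm n Nt" "trm x Seq"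
  shows "H \<Turnstile> Dec (NonzeroBeyond f n x)"
  unfolding NonzeroBeyond_def
proof (rule Dec_And)
  show "H \<Turnstile> Dec (AtLeast x n)" by (rule Dec_AtLeast[OF ty(3,2) forces_world[OF lim]])
  let ?\<theta> = "shift 0 n \<^bold>\<le> Var 0 \<^bold>\<and> One \<^bold>\<le> Var 0 \<^bold>\<and> \<^bold>\<not> shift 0 f \<cdot> Var 0 \<cdot> shift 0 x \<^bold>= Zero"
  have wf: "wfe (case_nat Nt G) ?\<theta>" using ty by simp
  from lim show "H \<Turnstile> Dec (Ex Nt ?\<theta>)"
  proof (rule TendsToZeroE)
    fix H1 M assume H1: "H \<preceq> H1" and M: "trm M Nt"
      and zero: "\<And>H'' k. H1 \<preceq> H'' \<Longrightarrow> H'' \<Turnstile> One \<^bold>\<le> k \<Longrightarrow> H'' \<Turnstile> M \<^bold>\<le> k \<Longrightarrow> H'' \<Turnstile> f \<cdot> k \<cdot> x \<^bold>= Zero"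
    have "H1 \<Turnstile> bnone M ?\<theta> \<^bold>\<or> bex M ?\<theta>"
    proof (rule bounded_search[OF _ wf M])
      fix m assume "trm m Nt"
      then show "H1 \<Turnstile> Dec (fsubst 0 m ?\<theta>)"
        using ty extends_world[OF H1] by (auto intro!: Dec_And Dec_Neg Dec_Le Dec_Zero)
    qed
    then show "H1 \<Turnstile> Dec (Ex Nt ?\<theta>)"
    proof (cases rule: forces_OrE)
      case (left H2)
      have "H2 \<Turnstile> \<^bold>\<not> Ex Nt ?\<theta>"
      proof (rule forces_ImpI)
        fix H3 assume H3: "H2 \<preceq> H3" "H3 \<Turnstile> Ex Nt ?\<theta>"
        from H3(2) show "H3 \<Turnstile> \<^bold>\<bottom>"
        proof (rule forces_ExE)
          fix H4 k assume H4: "H3 \<preceq> H4" "trm k Nt" "H4 \<Turnstile> fsubst 0 k ?\<theta>"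
          \<comment> \<open>A witness at or beyond \<open>M\<close> contradicts convergence, and one
            below \<open>M\<close> contradicts the failed search.\<close>
          from le_linear[OF M H4(2) extends_world[OF H4(1)]] show "H4 \<Turnstile> \<^bold>\<bottom>"
          proof (cases rule: forces_OrE)
            case l: (left H5)
            from forces_mono[OF H4(3) l(1)] have "H5 \<Turnstile> One \<^bold>\<le> k" "H5 \<Turnstile> \<^bold>\<not> f \<cdot> k \<cdot> x \<^bold>= Zero"
              by (simp_all add: forces_And)
            moreover have "H1 \<preceq> H5" using left(1) H3(1) H4(1) l(1) by (blast intro: extends_trans)
            ultimately show "H5 \<Turnstile> \<^bold>\<bottom>" using zero l(2) by (blast intro: forces_ImpE)
          next
            case (right H5)
            have "H5 \<Turnstile> bnone M ?\<theta>" using left(2) H3(1) H4(1) right(1) by (blast intro: forces_mono)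
            then show "H5 \<Turnstile> \<^bold>\<bottom>" using right(2) forces_mono[OF H4(3) right(1)] by (rule bnoneD)
          qed
        qed
      qed (use wf left in \<open>auto intro: extends_world\<close>)
      then show "H2 \<Turnstile> Dec (Ex Nt ?\<theta>)" using wf by (auto intro: forces_OrI2)
    next
      case (right H2)
      from right(2) have "H2 \<Turnstile> Ex Nt ?\<theta>"
        by (rule bexE) (rule forces_ExI[OF _ _ wf])
      then show "H2 \<Turnstile> Dec (Ex Nt ?\<theta>)" using wf by (auto intro: forces_OrI1)
    qed
  qed
qed

text \<open>The formula \<open>A\<^sub>n\<close> of the introduction.\<close>

definition Active :: "tm \<Rightarrow> tm \<Rightarrow> fm" where
  "Active f n = Ex Seq (Ninf (Var 0) \<^bold>\<and> NonzeroBeyond (shift 0 f) (shift 0 n) (Var 0))"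

lemma wfe_Active [simp]: "wfe e (Active f n) \<longleftrightarrow> tyof e f = Some Fseq \<and> tyof e n = Some Nt"
  by (auto simp: Active_def)

lemma fsubst_Active [simp]: "fsubst k u (Active f n) = Active (subst k u f) (subst k u n)"
  by (simp add: Active_def)

lemma Active_I: "H \<Turnstile> Ninf x \<Longrightarrow> H \<Turnstile> NonzeroBeyond f n x \<Longrightarrow> H \<Turnstile> Active f n"
  unfolding Active_def by (rule forces_ExI[of _ x]) (auto simp: forces_And dest: forces_wfe)

lemma Active_E:
  assumes "H \<Turnstile> Active f n"
    and "\<And>H' x. H \<preceq> H' \<Longrightarrow> trm x Seq \<Longrightarrow> H' \<Turnstile> Ninf x \<Longrightarrow> H' \<Turnstile> NonzeroBeyond f n x \<Longrightarrow> H' \<Turnstile> \<chi>"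
  shows "H \<Turnstile> \<chi>"
  using assms(1) unfolding Active_def by (rule forces_ExE) (rule assms(2), auto simp: forces_And)

lemma Dec_Active:
  assumes "\<And>H' x. H \<preceq> H' \<Longrightarrow> H' \<Turnstile> Ninf x \<Longrightarrow> H' \<Turnstile> TendsToZero f x"
    and "trm f Fseq" "trm n Nt" "world H"
  shows "H \<Turnstile> Dec (Active f n)"
  unfolding Active_def
proof (rule omniscience)
  fix H' x assume "H \<preceq> H'" "H' \<Turnstile> Ninf x"
  from assms(1)[OF this] have "H' \<Turnstile> Dec (NonzeroBeyond f n x)"
    by (rule Dec_NonzeroBeyond) (use assms(2,3) forces_wfe[OF \<open>H' \<Turnstile> Ninf x\<close>] in auto)
  then show "H' \<Turnstile> Dec (fsubst 0 x (NonzeroBeyond (shift 0 f) (shift 0 n) (Var 0)))" by simp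
qed (use assms in auto)

text \<open>The point \<open>x\<close> and the index \<open>k\<close> found for \<open>n\<close>
  serve for \<open>m\<close> as well, since the conditions on both only get weaker.\<close>

lemma Active_antimono:
  assumes "H \<Turnstile> Active f n" "H \<Turnstile> m \<^bold>\<le> n"
  shows "H \<Turnstile> Active f m"
  using assms(1)
proof (rule Active_E)
  fix H1 x assume H1: "H \<preceq> H1" and x: "trm x Seq" "H1 \<Turnstile> Ninf x" "H1 \<Turnstile> NonzeroBeyond f n x"
  from x(3) show "H1 \<Turnstile> Active f m"
  proof (rule NonzeroBeyond_E)
    fix H2 k assume H2: "H1 \<preceq> H2" and k: "H2 \<Turnstile> AtLeast x n" "H2 \<Turnstile> n \<^bold>\<le> k" "H2 \<Turnstile> One \<^bold>\<le> k"
      "H2 \<Turnstile> \<^bold>\<not> f \<cdot> k \<cdot> x \<^bold>= Zero"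
    note mn = forces_mono[OF assms(2) extends_trans[OF H1 H2]]
    have "H2 \<Turnstile> AtLeast x m"
    proof (rule AtLeastI)
      fix H3 i assume H3: "H2 \<preceq> H3" "H3 \<Turnstile> Succ i \<^bold>\<le> m"
      show "H3 \<Turnstile> x \<cdot> i \<^bold>= Zero"
        by (rule AtLeastD[OF forces_mono[OF k(1) H3(1)] le_trans[OF H3(2) forces_mono[OF mn H3(1)]]])
    qed (use x H2 le_trm[OF mn] in \<open>auto intro: extends_world\<close>)
    then have "H2 \<Turnstile> NonzeroBeyond f m x"
      by (rule NonzeroBeyond_I[OF _ le_trans[OF mn k(2)] k(3,4)]) (use forces_wfe[OF assms(1)] in simp)
    then show "H2 \<Turnstile> Active f m" by (rule Active_I[OF forces_mono[OF x(2) H2]])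
  qed
qed

section \<open>The place where activity is lost\<close>

definition Flip :: "tm \<Rightarrow> tm \<Rightarrow> fm" where
  "Flip f n = (Active f n \<^bold>\<and> \<^bold>\<not> Active f (Succ n))"

lemma wfe_Flip [simp]: "wfe e (Flip f n) \<longleftrightarrow> tyof e f = Some Fseq \<and> tyof e n = Some Nt"
  by (auto simp: Flip_def)

lemma fsubst_Flip [simp]: "fsubst k u (Flip f n) = Flip (subst k u f) (subst k u n)"
  by (simp add: Flip_def)

text \<open>If \<open>m\<close> were below \<open>n\<close>, then \<open>Active_antimono\<close>
  would bring activity at \<open>n\<close> down to \<open>Succ m\<close>, where it has just been
  lost. Used in both directions, this shows in \<open>Flip_unique\<close> that activity is lost at
  most once.\<close>

lemma Flip_le:
  assumes "H \<Turnstile> Active f n" "H \<Turnstile> Flip f m"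
  shows "H \<Turnstile> n \<^bold>\<le> m"
proof -
  have "trm n Nt" "trm m Nt" using assms[THEN forces_wfe] by auto
  from le_linear[OF this forces_world[OF assms(1)]] show ?thesis
  proof (rule Or_left)
    fix H' assume H': "H \<preceq> H'" "H' \<Turnstile> Succ m \<^bold>\<le> n"
    have "H' \<Turnstile> Active f (Succ m)" by (rule Active_antimono[OF forces_mono[OF assms(1) H'(1)] H'(2)])
    then show "H' \<Turnstile> \<^bold>\<bottom>"
      using forces_mono[OF assms(2) H'(1)] unfolding Flip_def forces_And by (blast intro: forces_ImpE)
  qed
qed

lemma Flip_unique:
  assumes "H \<Turnstile> Flip f n" "H \<Turnstile> Flip f m"
  shows "H \<Turnstile> n \<^bold>= m"
proof -
  have "H \<Turnstile> n \<^bold>\<le> m" "H \<Turnstile> m \<^bold>\<le> n"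
    using assms Flip_le by (auto simp: Flip_def forces_And)
  from this(1) show ?thesis
  proof (rule le_cases)
    fix H' assume H': "H \<preceq> H'" "H' \<Turnstile> Succ n \<^bold>\<le> m"
    have "H' \<Turnstile> Succ n \<^bold>\<le> n" by (rule le_trans[OF H'(2) forces_mono[OF \<open>H \<Turnstile> m \<^bold>\<le> n\<close> H'(1)]])
    then have "H' \<Turnstile> \<^bold>\<bottom>" by (rule Succ_le_self)
    then show "H' \<Turnstile> n \<^bold>= m"
      by (rule forces_BotE) (use assms[THEN forces_wfe] in auto)
  qed
qed

lemma bex_mono:
  assumes "H \<Turnstile> bex m \<phi>" "H \<Turnstile> m \<^bold>\<le> n"
  shows "H \<Turnstile> bex n \<phi>"
  using assms(1)
  by (rule bexE) (rule bexI, rule le_trans[OF _ forces_mono[OF assms(2)]], 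
      use forces_wfe[OF assms(1)] in auto)

text \<open>Induction on \<open>n\<close>: while activity has survived, deciding it at the next
  index either extends it or exhibits the flip.\<close>

lemma Active_or_Flip:
  assumes dec: "\<And>n. trm n Nt \<Longrightarrow> H \<Turnstile> Dec (Active f n)" and zero: "H \<Turnstile> Active f Zero" and n: "trm n Nt"
  shows "H \<Turnstile> Active f n \<^bold>\<or> bex n (Flip (shift 0 f) (Var 0))"
proof -
  have f: "trm f Fseq" using forces_wfe[OF zero] by simp
  let ?\<phi> = "Active (shift 0 f) (Var 0) \<^bold>\<or> bex (Var 0) (Flip (shift 0 (shift 0 f)) (Var 0))"
  have "H \<Turnstile> fsubst 0 n ?\<phi>"
  proof (rule forces_Ind[OF _ _ n])
    show "H \<Turnstile> fsubst 0 Zero ?\<phi>" using zero f by (auto intro: forces_OrI1)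
  next
    fix H1 t assume H1: "H \<preceq> H1" and t: "trm t Nt" and "H1 \<Turnstile> fsubst 0 t ?\<phi>"
    then have "H1 \<Turnstile> Active f t \<^bold>\<or> bex t (Flip (shift 0 f) (Var 0))" by simp
    then have "H1 \<Turnstile> Active f (Succ t) \<^bold>\<or> bex (Succ t) (Flip (shift 0 f) (Var 0))"
    proof (cases rule: forces_OrE)
      case (left H2)
      have "H \<preceq> H2" by (rule extends_trans[OF H1 left(1)])
      with dec[of "Succ t"] t have "H2 \<Turnstile> Dec (Active f (Succ t))" by (auto intro: forces_mono)
      then show "H2 \<Turnstile> Active f (Succ t) \<^bold>\<or> bex (Succ t) (Flip (shift 0 f) (Var 0))"
      proof (cases rule: forces_OrE)
        case l: (left H3)
        then show "H3 \<Turnstile> Active f (Succ t) \<^bold>\<or> bex (Succ t) (Flip (shift 0 f) (Var 0))"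
          using f t by (auto intro: forces_OrI1)
      next
        case (right H3)
        have "H3 \<Turnstile> Flip f t" using right forces_mono[OF left(2)] by (simp add: Flip_def forces_And)
        then have "H3 \<Turnstile> bex (Succ t) (Flip (shift 0 f) (Var 0))"
          by (intro bexI[of _ t]) (use f t right in \<open>auto intro: le_refl extends_world\<close>)
        then show "H3 \<Turnstile> Active f (Succ t) \<^bold>\<or> bex (Succ t) (Flip (shift 0 f) (Var 0))"
          using f t by (auto intro: forces_OrI2)
      qed
    next
      case (right H2)
      have "H2 \<Turnstile> bex (Succ t) (Flip (shift 0 f) (Var 0))"
        by (rule bex_mono[OF right(2) le_Succ[OF t extends_world[OF right(1)]]])
      then show "H2 \<Turnstile> Active f (Succ t) \<^bold>\<or> bex (Succ t) (Flip (shift 0 f) (Var 0))"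
        using f t by (auto intro: forces_OrI2)
    qed
    then show "H1 \<Turnstile> fsubst 0 (Succ t) ?\<phi>" by simp
  qed
  then show ?thesis by simp
qed

text \<open>\<open>Splice f a i v\<close>: the \<open>i\<close>-th entry of the point \<open>y\<close> of the introduction, for the witnesses
  \<open>a\<close>, is \<open>v\<close>.\<close>

definition Splice :: "tm \<Rightarrow> tm \<Rightarrow> tm \<Rightarrow> tm \<Rightarrow> fm" where
  "Splice f a i v = ((Active f (Succ i) \<^bold>\<and> v \<^bold>= Zero) \<^bold>\<or>
    bex (Succ i) (Flip (shift 0 f) (Var 0) \<^bold>\<and> shift 0 v \<^bold>= shift 0 a \<cdot> Var 0 \<cdot> shift 0 i))"

lemma wfe_Splice [simp]:
  "tyof e f = Some Fseq \<Longrightarrow> tyof e a = Some (Nt \<rightarrow> Seq) \<Longrightarrow> tyof e i = Some Nt \<Longrightarrow> 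
    wfe e (Splice f a i v) \<longleftrightarrow> tyof e v = Some Nt"
  by (auto simp: Splice_def)

lemma fsubst_Splice [simp]:
  "fsubst k u (Splice f a i v) = Splice (subst k u f) (subst k u a) (subst k u i) (subst k u v)"
  by (simp add: Splice_def)

section \<open>The spliced point: existence of its entries, membership, agreement with a
  witness\<close>

lemma Splice_cases:
  assumes "H \<Turnstile> Splice f a i v"
    and "\<And>H'. H \<preceq> H' \<Longrightarrow> H' \<Turnstile> Active f (Succ i) \<Longrightarrow> H' \<Turnstile> v \<^bold>= Zero \<Longrightarrow> H' \<Turnstile> \<chi>"
    and "\<And>H' m. H \<preceq> H' \<Longrightarrow> trm m Nt \<Longrightarrow> H' \<Turnstile> m \<^bold>\<le> i \<Longrightarrow> H' \<Turnstile> Flip f m \<Longrightarrow> H' \<Turnstile> v \<^bold>= a \<cdot> m \<cdot> i \<Longrightarrow> H' \<Turnstile> \<chi>"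
  shows "H \<Turnstile> \<chi>"
  using assms(1) unfolding Splice_def
proof (cases rule: forces_OrE)
  case (left H')
  then show "H' \<Turnstile> \<chi>" using assms(2) by (simp add: forces_And)
next
  case (right H')
  from right(2) show "H' \<Turnstile> \<chi>"
    by (rule bexE) (rule assms(3)[OF extends_trans[OF right(1)]], 
        auto simp: forces_And intro: Succ_le_SuccD)
qed

text \<open>\<open>Active_or_Flip\<close> at \<open>Succ i\<close> settles which clause of
  \<open>Splice\<close> applies. A flip below \<open>Succ i\<close> lies at some \<open>m\<close> at
  most \<open>i\<close>, and the entry is then copied from \<open>a \<cdot> m\<close>.\<close>

lemma Splice_exists:
  assumes dec: "\<And>n. trm n Nt \<Longrightarrow> H \<Turnstile> Dec (Active f n)" and zero: "H \<Turnstile> Active f Zero"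
    and a: "trm a (Nt \<rightarrow> Seq)" and i: "trm i Nt"
  shows "H \<Turnstile> Ex Nt (Splice (shift 0 f) (shift 0 a) (shift 0 i) (Var 0))"
proof -
  have f: "trm f Fseq" using forces_wfe[OF zero] by simp
  have ex: "H' \<Turnstile> Ex Nt (Splice (shift 0 f) (shift 0 a) (shift 0 i) (Var 0))"
    if "H' \<Turnstile> Splice f a i v" "trm v Nt" for H' v
    by (rule forces_ExI[of _ v]) (use that f a i in auto)
  have "H \<Turnstile> Active f (Succ i) \<^bold>\<or> bex (Succ i) (Flip (shift 0 f) (Var 0))"
    by (rule Active_or_Flip[OF _ zero]) (use dec i in simp_all)
  then show ?thesis
  proof (cases rule: forces_OrE)
    case (left H1)
    have "H1 \<Turnstile> Splice f a i Zero"
      unfolding Splice_def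
      by (rule forces_OrI1) (use left f a i in \<open>auto simp: forces_And intro: forces_EqI extends_world\<close>)
    then show "H1 \<Turnstile> Ex Nt (Splice (shift 0 f) (shift 0 a) (shift 0 i) (Var 0))"
      by (rule ex) simp
  next
    case (right H1)
    from right(2) show "H1 \<Turnstile> Ex Nt (Splice (shift 0 f) (shift 0 a) (shift 0 i) (Var 0))"
    proof (rule bexE)
      fix H2 m assume H2: "H1 \<preceq> H2" "trm m Nt" "H2 \<Turnstile> Succ m \<^bold>\<le> Succ i" "H2 \<Turnstile> fsubst 0 m (Flip (shift 0 f) (Var 0))"
      have "H2 \<Turnstile> bex (Succ i) (Flip (shift 0 f) (Var 0) \<^bold>\<and> shift 0 (a \<cdot> m \<cdot> i) \<^bold>= shift 0 a \<cdot> Var 0 \<cdot> shift 0 i)"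
        by (rule bexI[OF H2(3)])
          (use H2 f a i in \<open>auto simp: forces_And intro: forces_EqI extends_world\<close>)
      then have "H2 \<Turnstile> Splice f a i (a \<cdot> m \<cdot> i)"
        unfolding Splice_def by (rule forces_OrI2) (use f a i H2 in auto)
      then show "H2 \<Turnstile> Ex Nt (Splice (shift 0 f) (shift 0 a) (shift 0 i) (Var 0))"
        by (rule ex) (use a i H2 in auto)
    qed
  qed
qed

text \<open>For monotonicity, suppose the entry at \<open>s\<close> is copied after a flip at
  \<open>m\<close>, which is at most \<open>s\<close>. Activity at \<open>Succ t\<close> would force
  \<open>Succ t\<close> to be at most \<open>m\<close> by \<open>Flip_le\<close>, which is
  impossible for \<open>t\<close> at or beyond \<open>s\<close>. So the entry at \<open>t\<close> is
  copied after a flip too, by uniqueness the same one, and the order is inherited from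
  \<open>a \<cdot> m\<close>.\<close>

lemma Splice_Ninf:
  assumes y: "trm y Seq" "\<And>i. trm i Nt \<Longrightarrow> H \<Turnstile> Splice f a i (y \<cdot> i)"
    and a: "trm a (Nt \<rightarrow> Seq)" "\<And>n. trm n Nt \<Longrightarrow> H \<Turnstile> Ninf (a \<cdot> n)"
  shows "H \<Turnstile> Ninf y"
proof (rule NinfI[OF y(1)])
  show "world H" using forces_world[OF a(2)[of Zero]] by simp
  fix t assume t: "trm t Nt"
  from y(2)[OF t] show "H \<Turnstile> y \<cdot> t \<^bold>= Zero \<^bold>\<or> y \<cdot> t \<^bold>= One"
  proof (rule Splice_cases)
    fix H' assume "H' \<Turnstile> y \<cdot> t \<^bold>= Zero"
    then show "H' \<Turnstile> y \<cdot> t \<^bold>= Zero \<^bold>\<or> y \<cdot> t \<^bold>= One" using y(1) t by (auto intro: forces_OrI1)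
  next
    fix H' m assume H': "H \<preceq> H'" "trm m Nt" "H' \<Turnstile> y \<cdot> t \<^bold>= a \<cdot> m \<cdot> t"
    from Ninf_binary[OF forces_mono[OF a(2)[OF H'(2)] H'(1)] t]
    show "H' \<Turnstile> y \<cdot> t \<^bold>= Zero \<^bold>\<or> y \<cdot> t \<^bold>= One"
    proof (cases rule: forces_OrE)
      case (left H'')
      from eq_trans[OF forces_mono[OF H'(3) left(1)] left(2)] 
      show "H'' \<Turnstile> y \<cdot> t \<^bold>= Zero \<^bold>\<or> y \<cdot> t \<^bold>= One" by (rule forces_OrI1) (use y(1) t in simp)
    next
      case (right H'')
      from eq_trans[OF forces_mono[OF H'(3) right(1)] right(2)] 
      show "H'' \<Turnstile> y \<cdot> t \<^bold>= Zero \<^bold>\<or> y \<cdot> t \<^bold>= One" by (rule forces_OrI2) (use y(1) t in simp)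
    qed
  qed
next
  fix H1 s t assume H1: "H \<preceq> H1" and s: "trm s Nt" and t: "trm t Nt" and st: "H1 \<Turnstile> s \<^bold>\<le> t"
  from forces_mono[OF y(2)[OF s] H1] show "H1 \<Turnstile> y \<cdot> s \<^bold>\<le> y \<cdot> t"
  proof (rule Splice_cases)
    fix H2 assume H2: "H1 \<preceq> H2" "H2 \<Turnstile> y \<cdot> s \<^bold>= Zero"
    have "H2 \<Turnstile> Zero \<^bold>\<le> y \<cdot> t" by (rule Zero_le) (use y t H2 in \<open>auto intro: extends_world\<close>)
    with eq_le[OF H2(2)] show "H2 \<Turnstile> y \<cdot> s \<^bold>\<le> y \<cdot> t" by (rule le_trans)
  next
    fix H2 m assume H2: "H1 \<preceq> H2" and m: "trm m Nt" "H2 \<Turnstile> m \<^bold>\<le> s" "H2 \<Turnstile> Flip f m" "H2 \<Turnstile> y \<cdot> s \<^bold>= a \<cdot> m \<cdot> s"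
    note up2 = extends_trans[OF H1 H2]
    from forces_mono[OF y(2)[OF t] up2] show "H2 \<Turnstile> y \<cdot> s \<^bold>\<le> y \<cdot> t"
    proof (rule Splice_cases)
      fix H3 assume H3: "H2 \<preceq> H3" "H3 \<Turnstile> Active f (Succ t)"
      have "H3 \<Turnstile> Succ t \<^bold>\<le> m" by (rule Flip_le[OF H3(2) forces_mono[OF m(3) H3(1)]])
      also have "H3 \<Turnstile> m \<^bold>\<le> t"
        by (rule le_trans[OF forces_mono[OF m(2) H3(1)] forces_mono[OF st extends_trans[OF H2 H3(1)]]])
      finally have "H3 \<Turnstile> \<^bold>\<bottom>" by (rule Succ_le_self)
      then show "H3 \<Turnstile> y \<cdot> s \<^bold>\<le> y \<cdot> t" by (rule forces_BotE) (use y s t in simp)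
    next
      fix H3 k assume H3: "H2 \<preceq> H3" and k: "trm k Nt" "H3 \<Turnstile> Flip f k" "H3 \<Turnstile> y \<cdot> t \<^bold>= a \<cdot> k \<cdot> t"
      have "H3 \<Turnstile> m \<^bold>= k" by (rule Flip_unique[OF forces_mono[OF m(3) H3] k(2)])
      then have "H3 \<Turnstile> a \<cdot> m \<cdot> t \<^bold>= a \<cdot> k \<cdot> t" using a(1) t by (blast intro: eq_fun eq_arg)
      then have yt: "H3 \<Turnstile> a \<cdot> m \<cdot> t \<^bold>= y \<cdot> t" using k(3) by (blast intro: eq_trans eq_sym)
      have "H3 \<Turnstile> a \<cdot> m \<cdot> s \<^bold>\<le> a \<cdot> m \<cdot> t"
        by (rule Ninf_mono[OF forces_mono[OF a(2)[OF m(1)] extends_trans[OF up2 H3]] forces_mono[OF st extends_trans[OF H2 H3]]])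
      with eq_le[OF forces_mono[OF m(4) H3]] eq_le[OF yt] show "H3 \<Turnstile> y \<cdot> s \<^bold>\<le> y \<cdot> t"
        by (blast intro: le_trans)
    qed
  qed
qed

text \<open>Where the entry of \<open>y\<close> is copied, uniqueness of the flip shows that it
  comes from \<open>a \<cdot> m\<close>. Where it is 0 because activity persists at
  \<open>Succ i\<close>, \<open>Flip_le\<close> puts \<open>i\<close> below \<open>m\<close>, and
  there \<open>a \<cdot> m\<close> is 0 as well because it is at least the copy of
  \<open>m\<close>.\<close>

lemma Splice_Flip:
  assumes y: "trm y Seq" "\<And>i. trm i Nt \<Longrightarrow> H \<Turnstile> Splice f a i (y \<cdot> i)"
    and a: "trm a (Nt \<rightarrow> Seq)" and m: "H \<Turnstile> Flip f m" and far: "H \<Turnstile> NonzeroBeyond f m (a \<cdot> m)"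
  shows "H \<Turnstile> Eq Seq (a \<cdot> m) y"
proof -
  have mt: "trm m Nt" using forces_wfe[OF m] by simp
  show ?thesis
  proof (rule forces_Ext)
    fix i assume i: "trm i Nt"
    from y(2)[OF i] show "H \<Turnstile> a \<cdot> m \<cdot> i \<^bold>= y \<cdot> i"
    proof (rule Splice_cases)
      fix H1 assume H1: "H \<preceq> H1" "H1 \<Turnstile> Active f (Succ i)" "H1 \<Turnstile> y \<cdot> i \<^bold>= Zero"
      have "H1 \<Turnstile> Succ i \<^bold>\<le> m" by (rule Flip_le[OF H1(2) forces_mono[OF m H1(1)]])
      moreover have "H1 \<Turnstile> AtLeast (a \<cdot> m) m" using forces_mono[OF far H1(1)] by (simp add: NonzeroBeyond_def forces_And)
      ultimately have "H1 \<Turnstile> a \<cdot> m \<cdot> i \<^bold>= Zero" by (blast intro: AtLeastD)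
      with H1(3) show "H1 \<Turnstile> a \<cdot> m \<cdot> i \<^bold>= y \<cdot> i" by (blast intro: eq_trans eq_sym)
    next
      fix H1 k assume H1: "H \<preceq> H1" "H1 \<Turnstile> Flip f k" "H1 \<Turnstile> y \<cdot> i \<^bold>= a \<cdot> k \<cdot> i"
      have "H1 \<Turnstile> m \<^bold>= k" by (rule Flip_unique[OF forces_mono[OF m H1(1)] H1(2)])
      then have "H1 \<Turnstile> a \<cdot> m \<cdot> i \<^bold>= a \<cdot> k \<cdot> i" using a i by (blast intro: eq_fun eq_arg)
      then show "H1 \<Turnstile> a \<cdot> m \<cdot> i \<^bold>= y \<cdot> i" using H1(3) by (blast intro: eq_trans eq_sym)
    qed
  qed (use a mt y in auto)
qed

section \<open>The two alternatives of the conclusion\<close>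

definition Bounded :: "tm \<Rightarrow> fm" where
  "Bounded f = Ex Nt (All Nt (One \<^bold>\<le> Var 0 \<^bold>\<longrightarrow> Var 1 \<^bold>\<le> Var 0 \<^bold>\<longrightarrow>
    All Seq (Ninf (Var 0) \<^bold>\<longrightarrow> AtLeast (Var 0) (Var 2) \<^bold>\<longrightarrow>
      Eq Nt (shift 0 (shift 0 (shift 0 f)) \<cdot> Var 1 \<cdot> Var 0) Zero)))"

text \<open>In both alternatives \<open>f\<close> is an arbitrary term shifted past three binders.
  The version with a bound \<open>f\<close> is recovered only at the end.\<close>

definition Unbounded :: "tm \<Rightarrow> fm" where
  "Unbounded f = Ex (Nt \<rightarrow> Seq) (Ex (Nt \<rightarrow> Nt) (All Nt (One \<^bold>\<le> Var 0 \<^bold>\<longrightarrow>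
    Ninf (Var 2 \<cdot> Var 0) \<^bold>\<and> Var 0 \<^bold>\<le> Var 1 \<cdot> Var 0 \<^bold>\<and> AtLeast (Var 2 \<cdot> Var 0) (Var 0) \<^bold>\<and>
    \<^bold>\<not> Eq Nt (shift 0 (shift 0 (shift 0 f)) \<cdot> (Var 1 \<cdot> Var 0) \<cdot> (Var 2 \<cdot> Var 0)) Zero)))"

lemma wfe_Bounded: "trm f Fseq \<Longrightarrow> wfe G (Bounded f)"
  by (simp add: Bounded_def numeral_2_eq_2)

lemma wfe_Unbounded: "trm f Fseq \<Longrightarrow> wfe G (Unbounded f)"
  by (simp add: Unbounded_def numeral_2_eq_2)

text \<open>Equality of a number with zero is decidable, so refuting a nonzero value really gives
  the value 0 and not just its double negation. The index \<open>n\<close> itself serves as the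
  bound.\<close>

lemma not_Active_Bounded:
  assumes "H \<Turnstile> \<^bold>\<not> Active f n"
  shows "H \<Turnstile> Bounded f"
proof -
  have f: "trm f Fseq" and n: "trm n Nt" using forces_wfe[OF assms] by auto
  note w = forces_world[OF assms]
  have zero: "H' \<Turnstile> f \<cdot> k \<cdot> x \<^bold>= Zero"
    if "H \<preceq> H'" "H' \<Turnstile> One \<^bold>\<le> k" "H' \<Turnstile> n \<^bold>\<le> k" "H' \<Turnstile> Ninf x" "H' \<Turnstile> AtLeast x n" for H' k x
  proof -
    have "trm (f \<cdot> k \<cdot> x) Nt" using f le_trm[OF that(3)] forces_wfe[OF that(4)] by simp
    from Dec_Zero[OF this extends_world[OF that(1)]] show ?thesis
    proof (rule Or_left)
      fix H'' assume H'': "H' \<preceq> H''" "H'' \<Turnstile> \<^bold>\<not> f \<cdot> k \<cdot> x \<^bold>= Zero"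
      have "H'' \<Turnstile> NonzeroBeyond f n x"
        by (rule NonzeroBeyond_I[OF that(5,3,2)[THEN forces_mono, OF H''(1)] H''(2) f])
      then have "H'' \<Turnstile> Active f n" by (rule Active_I[OF forces_mono[OF that(4) H''(1)]])
      then show "H'' \<Turnstile> \<^bold>\<bottom>"
        using forces_mono[OF assms extends_trans[OF that(1) H''(1)]] by (blast intro: forces_ImpE)
    qed
  qed
  have "H \<Turnstile> All Nt (One \<^bold>\<le> Var 0 \<^bold>\<longrightarrow> shift 0 n \<^bold>\<le> Var 0 \<^bold>\<longrightarrow>
    All Seq (Ninf (Var 0) \<^bold>\<longrightarrow> AtLeast (Var 0) (shift 0 (shift 0 n)) \<^bold>\<longrightarrow>
      shift 0 (shift 0 f) \<cdot> Var 1 \<cdot> Var 0 \<^bold>= Zero))"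
  proof (rule forces_AllI)
    fix k assume k: "trm k Nt"
    have "H \<Turnstile> One \<^bold>\<le> k \<^bold>\<longrightarrow> n \<^bold>\<le> k \<^bold>\<longrightarrow> All Seq (Ninf (Var 0) \<^bold>\<longrightarrow> AtLeast (Var 0) (shift 0 n) \<^bold>\<longrightarrow>
        shift 0 f \<cdot> shift 0 k \<cdot> Var 0 \<^bold>= Zero)"
    proof (intro forces_ImpI)
      fix H1 H2 assume H1: "H \<preceq> H1" "H1 \<Turnstile> One \<^bold>\<le> k" and H2: "H1 \<preceq> H2" "H2 \<Turnstile> n \<^bold>\<le> k"
      show "H2 \<Turnstile> All Seq (Ninf (Var 0) \<^bold>\<longrightarrow> AtLeast (Var 0) (shift 0 n) \<^bold>\<longrightarrow>
          shift 0 f \<cdot> shift 0 k \<cdot> Var 0 \<^bold>= Zero)"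
      proof (rule forces_AllI)
        fix x assume x: "trm x Seq"
        have "H2 \<Turnstile> Ninf x \<^bold>\<longrightarrow> AtLeast x n \<^bold>\<longrightarrow> f \<cdot> k \<cdot> x \<^bold>= Zero"
        proof (intro forces_ImpI)
          fix H3 H4 assume H3: "H2 \<preceq> H3" "H3 \<Turnstile> Ninf x" and H4: "H3 \<preceq> H4" "H4 \<Turnstile> AtLeast x n"
          have "H1 \<preceq> H4" "H2 \<preceq> H4" "H \<preceq> H4"
            using H1 H2 H3 H4 by (blast intro: extends_trans)+
          with H1 H2 H3 H4 show "H4 \<Turnstile> f \<cdot> k \<cdot> x \<^bold>= Zero"
            by (intro zero) (blast intro: forces_mono)+
        qed (use x n H2 in \<open>auto intro: extends_world\<close>)
        then show "H2 \<Turnstile> fsubst 0 x (Ninf (Var 0) \<^bold>\<longrightarrow> AtLeast (Var 0) (shift 0 n) \<^bold>\<longrightarrow>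
            shift 0 f \<cdot> shift 0 k \<cdot> Var 0 \<^bold>= Zero)" by simp
      qed
    qed (use w n k in \<open>auto intro: extends_world\<close>)
    then show "H \<Turnstile> fsubst 0 k (One \<^bold>\<le> Var 0 \<^bold>\<longrightarrow> shift 0 n \<^bold>\<le> Var 0 \<^bold>\<longrightarrow>
      All Seq (Ninf (Var 0) \<^bold>\<longrightarrow> AtLeast (Var 0) (shift 0 (shift 0 n)) \<^bold>\<longrightarrow>
        shift 0 (shift 0 f) \<cdot> Var 1 \<cdot> Var 0 \<^bold>= Zero))" by simp
  qed
  then show ?thesis
    unfolding Bounded_def
    by (intro forces_ExI[of _ n]) (use f n in \<open>simp_all add: numeral_2_eq_2\<close>)
qed

text \<open>Countable choice is applied twice: first to the points, then to the indices
  \<open>k\<close> belonging to the points already chosen.\<close>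

lemma Active_Unbounded:
  assumes "\<And>n. trm n Nt \<Longrightarrow> H \<Turnstile> Active f n"
  shows "H \<Turnstile> Unbounded f"
proof -
  have f: "trm f Fseq" using forces_wfe[OF assms[of Zero]] by simp
  show ?thesis
  proof (rule forces_CC[where \<tau> = Seq and
        \<phi> = "Ninf (Var 0) \<^bold>\<and> NonzeroBeyond (shift 0 (shift 0 f)) (Var (Suc 0)) (Var 0)"])
    fix n assume "trm n Nt"
    from assms[OF this] show "H \<Turnstile> Ex Seq (fsubst (Suc 0) (shift 0 n)
        (Ninf (Var 0) \<^bold>\<and> NonzeroBeyond (shift 0 (shift 0 f)) (Var (Suc 0)) (Var 0)))"
      by (simp add: Active_def)
  next
    fix H1 a assume H1: "H \<preceq> H1" and a: "trm a (Nt \<rightarrow> Seq)"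
      and "\<And>n. trm n Nt \<Longrightarrow> H1 \<Turnstile> fsubst 0 (a \<cdot> n) (fsubst (Suc 0) (shift 0 n)
        (Ninf (Var 0) \<^bold>\<and> NonzeroBeyond (shift 0 (shift 0 f)) (Var (Suc 0)) (Var 0)))"
    then have N: "H1 \<Turnstile> Ninf (a \<cdot> n)" and P: "H1 \<Turnstile> NonzeroBeyond f n (a \<cdot> n)" if "trm n Nt" for n
      using that by (auto simp: forces_And)
    let ?\<kappa> = "\<lambda>n k. n \<^bold>\<le> k \<^bold>\<and> \<^bold>\<not> f \<cdot> k \<cdot> (a \<cdot> n) \<^bold>= Zero"
    let ?\<phi> = "Var (Suc 0) \<^bold>\<le> Var 0 \<^bold>\<and>
      \<^bold>\<not> shift 0 (shift 0 f) \<cdot> Var 0 \<cdot> (shift 0 (shift 0 a) \<cdot> Var (Suc 0)) \<^bold>= Zero"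
    show "H1 \<Turnstile> Unbounded f"
    proof (rule forces_CC[where \<tau> = Nt and \<phi> = ?\<phi>])
      fix n assume n: "trm n Nt"
      have "H1 \<Turnstile> Ex Nt (shift 0 n \<^bold>\<le> Var 0 \<^bold>\<and> \<^bold>\<not> shift 0 f \<cdot> Var 0 \<cdot> (shift 0 a \<cdot> shift 0 n) \<^bold>= Zero)"
        using P[OF n]
      proof (rule NonzeroBeyond_E)
        fix H2 k assume "trm k Nt" "H2 \<Turnstile> n \<^bold>\<le> k" "H2 \<Turnstile> \<^bold>\<not> f \<cdot> k \<cdot> (a \<cdot> n) \<^bold>= Zero"
        then show "H2 \<Turnstile> Ex Nt (shift 0 n \<^bold>\<le> Var 0 \<^bold>\<and> \<^bold>\<not> shift 0 f \<cdot> Var 0 \<cdot> (shift 0 a \<cdot> shift 0 n) \<^bold>= Zero)"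
          by (intro forces_ExI[of _ k]) (use f a n in \<open>auto simp: forces_And\<close>)
      qed
      then show "H1 \<Turnstile> Ex Nt (fsubst (Suc 0) (shift 0 n) ?\<phi>)" by simp
    next
      fix H2 k assume H2: "H1 \<preceq> H2" and k: "trm k (Nt \<rightarrow> Nt)"
        and K: "\<And>n. trm n Nt \<Longrightarrow> H2 \<Turnstile> fsubst 0 (k \<cdot> n) (fsubst (Suc 0) (shift 0 n) ?\<phi>)"
      let ?\<psi> = "\<lambda>a k f. One \<^bold>\<le> Var 0 \<^bold>\<longrightarrow>
        Ninf (a \<cdot> Var 0) \<^bold>\<and> Var 0 \<^bold>\<le> k \<cdot> Var 0 \<^bold>\<and> AtLeast (a \<cdot> Var 0) (Var 0) \<^bold>\<and>
        \<^bold>\<not> f \<cdot> (k \<cdot> Var 0) \<cdot> (a \<cdot> Var 0) \<^bold>= Zero"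
      have all: "H2 \<Turnstile> All Nt (?\<psi> (shift 0 a) (shift 0 k) (shift 0 f))"
      proof (rule forces_AllI)
        fix n assume n: "trm n Nt"
        have "H2 \<Turnstile> One \<^bold>\<le> n \<^bold>\<longrightarrow> Ninf (a \<cdot> n) \<^bold>\<and> n \<^bold>\<le> k \<cdot> n \<^bold>\<and> AtLeast (a \<cdot> n) n \<^bold>\<and>
            \<^bold>\<not> f \<cdot> (k \<cdot> n) \<cdot> (a \<cdot> n) \<^bold>= Zero"
        proof (rule forces_ImpI)
          fix H3 assume H3: "H2 \<preceq> H3"
          from forces_mono[OF N[OF n] extends_trans[OF H2 H3]] forces_mono[OF P[OF n] extends_trans[OF H2 H3]] forces_mono[OF K[OF n] H3]
          show "H3 \<Turnstile> Ninf (a \<cdot> n) \<^bold>\<and> n \<^bold>\<le> k \<cdot> n \<^bold>\<and> AtLeast (a \<cdot> n) n \<^bold>\<and>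
            \<^bold>\<not> f \<cdot> (k \<cdot> n) \<cdot> (a \<cdot> n) \<^bold>= Zero"
            by (simp add: forces_And NonzeroBeyond_def)
        qed (use H2 n in \<open>auto intro: extends_world\<close>)
        then show "H2 \<Turnstile> fsubst 0 n (?\<psi> (shift 0 a) (shift 0 k) (shift 0 f))" by simp
      qed
      have "H2 \<Turnstile> Ex (Nt \<rightarrow> Nt) (All Nt (?\<psi> (shift 0 (shift 0 a)) (Var 1) (shift 0 (shift 0 f))))"
        by (rule forces_ExI[of _ k]) (use all f a k in simp_all)
      then show "H2 \<Turnstile> Unbounded f"
        unfolding Unbounded_def
        by (intro forces_ExI[of _ a]) (use f a k in \<open>simp_all add: numeral_2_eq_2\<close>)
    qed
  qed
qed

theorem dichotomy:
  assumes lim: "\<And>H' x. H \<preceq> H' \<Longrightarrow> H' \<Turnstile> Ninf x \<Longrightarrow> H' \<Turnstile> TendsToZero f x"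
    and f: "trm f Fseq" and w: "world H"
  shows "H \<Turnstile> Bounded f \<^bold>\<or> Unbounded f"
proof -
  have dec: "H \<Turnstile> Dec (Active f n)" if "trm n Nt" for n
    by (rule Dec_Active) (use lim f w that in auto)
  have bdd: "H' \<Turnstile> Bounded f \<^bold>\<or> Unbounded f" if "H' \<Turnstile> \<^bold>\<not> Active f n" for H' n
    by (rule forces_OrI1[OF not_Active_Bounded[OF that] wfe_Unbounded[OF f]])
  have "H \<Turnstile> Dec (Active f Zero)" by (rule dec) simp
  then show ?thesis
  proof (cases rule: forces_OrE)
    case (left H1)
    from left(2) show "H1 \<Turnstile> Bounded f \<^bold>\<or> Unbounded f"
    proof (rule Active_E)
      fix H2 x0 assume H2: "H1 \<preceq> H2" and x0: "H2 \<Turnstile> Ninf x0"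
      have up2: "H \<preceq> H2" by (rule extends_trans[OF left(1) H2])
      have dec2: "H2 \<Turnstile> Dec (Active f n)" if "trm n Nt" for n by (rule forces_mono[OF dec[OF that] up2])
      \<comment> \<open>The choice function must be total although witnesses exist only where
        activity holds. Hence the implication; where activity fails, \<open>x0\<close>, the witness
        of activity at zero, serves as the default point.\<close>
      let ?\<phi> = "Ninf (Var 0) \<^bold>\<and> (Active (shift 0 (shift 0 f)) (Var (Suc 0)) \<^bold>\<longrightarrow>
        NonzeroBeyond (shift 0 (shift 0 f)) (Var (Suc 0)) (Var 0))"
      show "H2 \<Turnstile> Bounded f \<^bold>\<or> Unbounded f"
      proof (rule forces_CC[where \<tau> = Seq and \<phi> = ?\<phi>])
        fix n assume n: "trm n Nt"
        let ?E = "Ex Seq (Ninf (Var 0) \<^bold>\<and> (Active (shift 0 f) (shift 0 n) \<^bold>\<longrightarrow> NonzeroBeyond (shift 0 f) (shift 0 n) (Var 0)))"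
        have ex: "H' \<Turnstile> ?E" if "H' \<Turnstile> Ninf x" "H' \<Turnstile> Active f n \<^bold>\<longrightarrow> NonzeroBeyond f n x" for H' x
          by (rule forces_ExI[of _ x]) 
            (use that f n forces_wfe[OF that(1)] in \<open>auto simp: forces_And\<close>)
        from dec2[OF n] have "H2 \<Turnstile> ?E"
        proof (cases rule: forces_OrE)
          case (left H3)
          from left(2) show "H3 \<Turnstile> ?E"
          proof (rule Active_E)
            fix H4 x assume H4: "H3 \<preceq> H4" "H4 \<Turnstile> Ninf x" "H4 \<Turnstile> NonzeroBeyond f n x"
            have "H4 \<Turnstile> Active f n \<^bold>\<longrightarrow> NonzeroBeyond f n x"
              by (rule forces_ImpI) (use H4 f n in \<open>auto intro: forces_mono extends_world\<close>)
            with H4(2) show "H4 \<Turnstile> ?E" by (rule ex)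
          qed
        next
          case (right H3)
          have "H3 \<Turnstile> Active f n \<^bold>\<longrightarrow> NonzeroBeyond f n x0"
          proof (rule forces_ImpI)
            fix H4 assume "H3 \<preceq> H4" "H4 \<Turnstile> Active f n"
            then have "H4 \<Turnstile> \<^bold>\<bottom>" using right(2) by (blast intro: forces_ImpE forces_mono)
            then show "H4 \<Turnstile> NonzeroBeyond f n x0"
              by (rule forces_BotE) (use f n forces_wfe[OF x0] in simp)
          qed (use f n right in \<open>auto intro: extends_world\<close>)
          with forces_mono[OF x0 right(1)] show "H3 \<Turnstile> ?E" by (rule ex)
        qed
        then show "H2 \<Turnstile> Ex Seq (fsubst (Suc 0) (shift 0 n) ?\<phi>)" by simp
      next
        fix H3 a assume H3: "H2 \<preceq> H3" and a: "trm a (Nt \<rightarrow> Seq)"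
          and "\<And>n. trm n Nt \<Longrightarrow> H3 \<Turnstile> fsubst 0 (a \<cdot> n) (fsubst (Suc 0) (shift 0 n) ?\<phi>)"
        then have Na: "H3 \<Turnstile> Ninf (a \<cdot> n)" and Pa: "H3 \<Turnstile> Active f n \<^bold>\<longrightarrow> NonzeroBeyond f n (a \<cdot> n)"
          if "trm n Nt" for n using that by (auto simp: forces_And)
        have up3: "H1 \<preceq> H3" "H \<preceq> H3" using extends_trans[OF H2 H3] extends_trans[OF up2 H3] by auto
        show "H3 \<Turnstile> Bounded f \<^bold>\<or> Unbounded f"
        proof (rule forces_CC[where \<tau> = Nt and
              \<phi> = "Splice (shift 0 (shift 0 f)) (shift 0 (shift 0 a)) (Var (Suc 0)) (Var 0)"])
          fix i assume i: "trm i Nt"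
          have "H3 \<Turnstile> Ex Nt (Splice (shift 0 f) (shift 0 a) (shift 0 i) (Var 0))"
            by (rule Splice_exists[OF _ forces_mono[OF left(2) up3(1)] a i]) (rule forces_mono[OF dec up3(2)])
          then show "H3 \<Turnstile> Ex Nt (fsubst (Suc 0) (shift 0 i)
              (Splice (shift 0 (shift 0 f)) (shift 0 (shift 0 a)) (Var (Suc 0)) (Var 0)))" by simp
        next
          fix H4 y assume H4: "H3 \<preceq> H4" and y: "trm y Seq"
            and "\<And>i. trm i Nt \<Longrightarrow> H4 \<Turnstile> fsubst 0 (y \<cdot> i) (fsubst (Suc 0) (shift 0 i)
              (Splice (shift 0 (shift 0 f)) (shift 0 (shift 0 a)) (Var (Suc 0)) (Var 0)))"
          then have Q: "H4 \<Turnstile> Splice f a i (y \<cdot> i)" if "trm i Nt" for i using that by simp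
          have up4: "H1 \<preceq> H4" "H \<preceq> H4" using up3[THEN extends_trans, OF H4] by auto
          have "H4 \<Turnstile> Ninf y" by (rule Splice_Ninf[OF y Q a forces_mono[OF Na H4]])
          from lim[OF up4(2) this] show "H4 \<Turnstile> Bounded f \<^bold>\<or> Unbounded f"
          proof (rule TendsToZeroE)
            fix H5 M assume H5: "H4 \<preceq> H5" and M: "trm M Nt"
              and zero: "\<And>H'' k. H5 \<preceq> H'' \<Longrightarrow> H'' \<Turnstile> One \<^bold>\<le> k \<Longrightarrow> H'' \<Turnstile> M \<^bold>\<le> k \<Longrightarrow>
                H'' \<Turnstile> f \<cdot> k \<cdot> y \<^bold>= Zero"
            have up5: "H \<preceq> H5" "H1 \<preceq> H5" "H3 \<preceq> H5"
              using extends_trans[OF up4(2) H5] extends_trans[OF up4(1) H5] extends_trans[OF H4 H5] by auto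
            \<comment> \<open>A flip at \<open>m\<close> makes \<open>y\<close> equal to
              \<open>a \<cdot> m\<close>, at which \<open>f\<close> is nonzero for some
              \<open>k\<close> at or beyond \<open>m\<close>. With \<open>m\<close> at or beyond
              \<open>M\<close> this contradicts the choice of \<open>M\<close> as a convergence
              bound at \<open>y\<close>.\<close>
            have flip: "H6 \<Turnstile> \<^bold>\<bottom>" if H6: "H5 \<preceq> H6" and m: "H6 \<Turnstile> Flip f m" "H6 \<Turnstile> M \<^bold>\<le> m" for H6 m
            proof -
              have mt: "trm m Nt" using forces_wfe[OF m(1)] by simp
              note up36 = extends_trans[OF up5(3) H6] and up46 = extends_trans[OF H5 H6]
              have P: "H6 \<Turnstile> NonzeroBeyond f m (a \<cdot> m)"
                using m(1) forces_mono[OF Pa[OF mt] up36] unfolding Flip_def forces_And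
                by (blast intro: forces_ImpE)
              have "H6 \<Turnstile> Eq Seq (a \<cdot> m) y"
                by (rule Splice_Flip[OF y _ a m(1) P]) (rule forces_mono[OF Q up46])
              from NonzeroBeyond_eq[OF this P] show ?thesis
              proof (rule NonzeroBeyond_E)
                fix H7 k assume H7: "H6 \<preceq> H7" "H7 \<Turnstile> m \<^bold>\<le> k" "H7 \<Turnstile> One \<^bold>\<le> k" "H7 \<Turnstile> \<^bold>\<not> f \<cdot> k \<cdot> y \<^bold>= Zero"
                have "H7 \<Turnstile> f \<cdot> k \<cdot> y \<^bold>= Zero"
                  by (rule zero[OF extends_trans[OF H6 H7(1)] H7(3) le_trans[OF forces_mono[OF m(2) H7(1)] H7(2)]])
                with H7(4) show "H7 \<Turnstile> \<^bold>\<bottom>" by (rule forces_ImpE)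
              qed
            qed
            from forces_mono[OF dec[OF M] up5(1)] show "H5 \<Turnstile> Bounded f \<^bold>\<or> Unbounded f"
            proof (cases rule: forces_OrE)
              case l: (left H6)
              \<comment> \<open>Otherwise a flip occurs below \<open>n\<close>. Activity at
                \<open>M\<close> places it at or beyond \<open>M\<close> by \<open>Flip_le\<close>,
                where \<open>flip\<close> excludes it.\<close>
              have "H6 \<Turnstile> Active f n" if n: "trm n Nt" for n
              proof -
                have "H6 \<Turnstile> Active f n \<^bold>\<or> bex n (Flip (shift 0 f) (Var 0))"
                  by (rule Active_or_Flip[OF _ forces_mono[OF left(2) extends_trans[OF up5(2) l(1)]] n])
                    (rule forces_mono[OF dec extends_trans[OF up5(1) l(1)]])
                then show ?thesis
                proof (rule Or_left)
                  fix H7 assume H7: "H6 \<preceq> H7" "H7 \<Turnstile> bex n (Flip (shift 0 f) (Var 0))"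
                  from H7(2) show "H7 \<Turnstile> \<^bold>\<bottom>"
                  proof (rule bexE)
                    fix H8 m assume H8: "H7 \<preceq> H8" "H8 \<Turnstile> fsubst 0 m (Flip (shift 0 f) (Var 0))"
                    note up68 = extends_trans[OF H7(1) H8(1)]
                    from H8(2) have "H8 \<Turnstile> Flip f m" by simp
                    moreover from Flip_le[OF forces_mono[OF l(2) up68] this] have "H8 \<Turnstile> M \<^bold>\<le> m" .
                    ultimately show "H8 \<Turnstile> \<^bold>\<bottom>" by (rule flip[OF extends_trans[OF l(1) up68]])
                  qed
                qed
              qed
              then have "H6 \<Turnstile> Unbounded f" by (rule Active_Unbounded)
              then show "H6 \<Turnstile> Bounded f \<^bold>\<or> Unbounded f"
                by (rule forces_OrI2[OF _ wfe_Bounded[OF f]])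
            qed (rule bdd)
          qed
        qed
      qed
    qed
  qed (rule bdd)
qed

(* Bound variables, outermost first. Premise: f, x. First disjunct: f, N, i, a (indices 3, 2, 1, 0).
   Second disjunct: f, (a_n), (k_n), n (indices 3, 2, 1, 0). *)
theorem theorem6:
  shows "[]; {} \<turnstile>
    All (Nt \<rightarrow> Seq \<rightarrow> Nt)
      (All Seq (Ninf (Var 0) \<^bold>\<longrightarrow> TendsToZero (Var 1) (Var 0)) \<^bold>\<longrightarrow>
        Ex Nt
          (All Nt (One \<^bold>\<le> Var 0 \<^bold>\<longrightarrow> Var 1 \<^bold>\<le> Var 0 \<^bold>\<longrightarrow>
            All Seq (Ninf (Var 0) \<^bold>\<longrightarrow> AtLeast (Var 0) (Var 2) \<^bold>\<longrightarrow>
              Eq Nt (Var 3 \<cdot> Var 1 \<cdot> Var 0) Zero)))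
        \<^bold>\<or>
        Ex (Nt \<rightarrow> Seq) (Ex (Nt \<rightarrow> Nt)
          (All Nt (One \<^bold>\<le> Var 0 \<^bold>\<longrightarrow>
            Ninf (Var 2 \<cdot> Var 0) \<^bold>\<and>
            Var 0 \<^bold>\<le> Var 1 \<cdot> Var 0 \<^bold>\<and>
            AtLeast (Var 2 \<cdot> Var 0) (Var 0) \<^bold>\<and>
            \<^bold>\<not> Eq Nt (Var 3 \<cdot> (Var 1 \<cdot> Var 0) \<cdot> (Var 2 \<cdot> Var 0)) Zero))))"
    (is "[]; {} \<turnstile> ?\<phi>")
proof (rule forces_closed)
  let ?h = "\<lambda>f. All Seq (Ninf (Var 0) \<^bold>\<longrightarrow> TendsToZero (shift 0 f) (Var 0))"
  have "{} \<Turnstile> ?h f \<^bold>\<longrightarrow> Bounded f \<^bold>\<or> Unbounded f" if f: "trm f Fseq" for f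
  proof (rule forces_ImpI)
    fix H assume H: "H \<Turnstile> ?h f"
    show "H \<Turnstile> Bounded f \<^bold>\<or> Unbounded f"
    proof (rule dichotomy)
      fix H' x assume H': "H \<preceq> H'" "H' \<Turnstile> Ninf x"
      have "trm x Seq" using forces_wfe[OF H'(2)] by simp
      from forces_AllE[OF forces_mono[OF H H'(1)] this]
      have "H' \<Turnstile> Ninf x \<^bold>\<longrightarrow> TendsToZero f x" by simp
      then show "H' \<Turnstile> TendsToZero f x" using H'(2) by (rule forces_ImpE)
    qed (use f forces_world[OF H] in auto)
  qed (use f in \<open>auto simp: world_def\<close>)
  \<comment> \<open>Instantiating the outermost quantifier at a term produces exactly the shifts
    under three binders that \<open>Bounded\<close> and \<open>Unbounded\<close> contain.\<close>
  then show "{} \<Turnstile> ?\<phi>"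
    by (intro forces_AllI) 
      (simp add: Bounded_def Unbounded_def numeral_2_eq_2 numeral_3_eq_3)
  \<comment> \<open>The formula is closed, which is what allows \<open>forces_closed\<close> to
    return from a segment of \<open>G\<close> to the empty context.\<close>
  show "fsub s ?\<phi> = ?\<phi>" for s
    by (simp add: Ninf_def AtLeast_def TendsToZero_def Le_def plus_tm_def eval_nat_numeral)
qed

end
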